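(* Let $0<\theta<1$ and let $F$ be a $\theta$-Hilbert space. Then $$\mathcal{L}(\ell_1,F)=\mathcal{M}_{\frac{2}{1-\theta},2}(\ell_1,F)=\Pi_{\frac{2}{\theta},2}(\ell_1,F),$$ and this implies $$\mathcal{L}(\ell_1,F)=\mathcal{M}_{\frac{2}{1-\theta},1}(\ell_1,F)=\Pi_{\frac{2}{1+\theta},1}(\ell_1,F).$$
   Context: All Banach spaces are over $\mathbb{C}$. $\mathcal{L}(E,F)$ denotes the bounded linear operators $E\to F$; $E'$ is the dual of $E$ and $B_E$ its closed unit ball. For $0<\theta<1$ and an interpolation couple $[F_0,F_1]$ of Banach spaces, $[F_0,F_1]_\theta$ denotes the complex (Calderón) interpolation space. A Banach space $F$ is a $\theta$-Hilbert space if $F=[F_0,F_1]_\theta$ for some interpolation couple $[F_0,F_1]$ in which $F_1$ is a Hilbert space. For $1\le p\le r\le\infty$, $T\in\mathcal{L}(E,F)$ is absolutely $(r,p)$-summing, $T\in\Pi_{r,p}(E,F)$, if there is $\rho\ge 0$ such that for all finite families $x_1,\dots,x_n\in E$ $$\Big(\sum_{i=1}^n\|Tx_i\|^r\Big)^{1/r}\le\rho\cdot\sup_{x'\in B_{E'}}\Big(\sum_{i=1}^n|\langle x',x_i\rangle|^p\Big)^{1/p}$$ (with the obvious modification if $p$ or $r$ is $\infty$). $\Pi_p:=\Pi_{p,p}$ is the class of absolutely $p$-summing operators. For $1\le p\le s\le\infty$, $T\in\mathcal{L}(E,F)$ is $(s,p)$-mixing, $T\in\mathcal{M}_{s,p}(E,F)$,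 if $ST\in\Pi_p(E,Y)$ for every Banach space $Y$ and every $S\in\Pi_s(F,Y)$. *)

theory Defs
  imports "HOL-Analysis.Analysis" "HOL-Library.Function_Algebras"
begin

section \<open>Complex vector spaces\<close>

class complex_vector = ab_group_add +
  fixes scaleC :: "complex \<Rightarrow> 'a \<Rightarrow> 'a" (infixr "*\<^sub>C" 75)
  assumes scaleC_add_right: "a *\<^sub>C (x + y) = a *\<^sub>C x + a *\<^sub>C y"
    and scaleC_add_left: "(a + b) *\<^sub>C x = a *\<^sub>C x + b *\<^sub>C x"
    and scaleC_scaleC: "a *\<^sub>C (b *\<^sub>C x) = (a * b) *\<^sub>C x"
    and scaleC_one: "1 *\<^sub>C x = x"

global_interpretation complex_vector:
  vector_space "scaleC :: complex \<Rightarrow> 'a \<Rightarrow> 'a::complex_vector"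
  by unfold_locales
    (rule scaleC_add_right scaleC_add_left scaleC_scaleC scaleC_one)+

instantiation complex :: complex_vector
begin

definition scaleC_complex :: "complex \<Rightarrow> complex \<Rightarrow> complex"
  where "scaleC_complex a x = a * x"

instance
  by standard (simp_all add: scaleC_complex_def algebra_simps)

end

instantiation "fun" :: (type, complex_vector) complex_vector
begin

definition scaleC_fun :: "complex \<Rightarrow> ('a \<Rightarrow> 'b) \<Rightarrow> 'a \<Rightarrow> 'b"
  where "scaleC_fun a f = (\<lambda>x. a *\<^sub>C f x)"

instance
  by standard
    (simp_all add: scaleC_fun_def fun_eq_iff scaleC_add_right scaleC_add_left
      scaleC_scaleC scaleC_one)

end

class complex_hausdorff_tvs = complex_vector + topological_ab_group_add + t2_space +
  assumes tendsto_scaleC_nhds: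
    "((\<lambda>p. fst p *\<^sub>C snd p) \<longlongrightarrow> a *\<^sub>C x) (nhds a \<times>\<^sub>F nhds x)"

instance complex :: complex_hausdorff_tvs
  by standard
    (auto simp: scaleC_complex_def intro!: tendsto_mult filterlim_fst filterlim_snd)


section \<open>Banach and Hilbert spaces\<close>

text \<open>
  A normed space is given by a linear subspace of some complex vector space together with a
  norm on it.  This makes the two members of an interpolation couple, their sum and their
  interpolation spaces objects of the same kind.  The values of the norm outside of the
  underlying subspace are irrelevant throughout.
\<close>

record 'a nspace =
  pts :: "'a set"
  nrm :: "'a \<Rightarrow> real"

definition normed_space :: "'a::complex_vector nspace \<Rightarrow> bool" where
  "normed_space E \<longleftrightarrow>
     complex_vector.subspace (pts E) \<and>
     (\<forall>x\<in>pts E. 0 \<le> nrm E x) \<and>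
     (\<forall>x\<in>pts E. nrm E x = 0 \<longleftrightarrow> x = 0) \<and>
     (\<forall>x\<in>pts E. \<forall>a. nrm E (a *\<^sub>C x) = cmod a * nrm E x) \<and>
     (\<forall>x\<in>pts E. \<forall>y\<in>pts E. nrm E (x + y) \<le> nrm E x + nrm E y)"

definition banach_space :: "'a::complex_vector nspace \<Rightarrow> bool" where
  "banach_space E \<longleftrightarrow>
     normed_space E \<and>
     (\<forall>x. (\<forall>n. x n \<in> pts E) \<and>
          (\<forall>e>0. \<exists>N. \<forall>m\<ge>N. \<forall>n\<ge>N. nrm E (x m - x n) < e) \<longrightarrow>
          (\<exists>l\<in>pts E. (\<lambda>n. nrm E (x n - l)) \<longlonglongrightarrow> 0))"

definition hilbert_space :: "'a::complex_vector nspace \<Rightarrow> bool" where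
  "hilbert_space H \<longleftrightarrow>
     banach_space H \<and>
     (\<exists>ip :: 'a \<Rightarrow> 'a \<Rightarrow> complex.
        (\<forall>x\<in>pts H. \<forall>y\<in>pts H. \<forall>z\<in>pts H. ip (x + y) z = ip x z + ip y z) \<and>
        (\<forall>x\<in>pts H. \<forall>y\<in>pts H. \<forall>a. ip (a *\<^sub>C x) y = a * ip x y) \<and>
        (\<forall>x\<in>pts H. \<forall>y\<in>pts H. ip y x = cnj (ip x y)) \<and>
        (\<forall>x\<in>pts H. ip x x = complex_of_real ((nrm H x)\<^sup>2)))"

definition l1 :: "(nat \<Rightarrow> complex) nspace" where
  "l1 = \<lparr>pts = {x. summable (\<lambda>k. cmod (x k))}, nrm = (\<lambda>x. \<Sum>k. cmod (x k))\<rparr>"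


section \<open>Complex interpolation\<close>

definition continuously_embedded :: "'v::complex_hausdorff_tvs nspace \<Rightarrow> bool" where
  "continuously_embedded E \<longleftrightarrow>
     (\<forall>x\<in>pts E. \<forall>U. open U \<and> x \<in> U \<longrightarrow>
        (\<exists>d>0. \<forall>y\<in>pts E. nrm E (y - x) < d \<longrightarrow> y \<in> U))"

definition interpolation_couple ::
    "'v::complex_hausdorff_tvs nspace \<Rightarrow> 'v nspace \<Rightarrow> bool" where
  "interpolation_couple F0 F1 \<longleftrightarrow>
     banach_space F0 \<and> banach_space F1 \<and>
     continuously_embedded F0 \<and> continuously_embedded F1"

definition sum_space :: "'v::complex_vector nspace \<Rightarrow> 'v nspace \<Rightarrow> 'v nspace" where
  "sum_space F0 F1 =
     \<lparr>pts = {a + b | a b. a \<in> pts F0 \<and> b \<in> pts F1},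
      nrm = (\<lambda>x. Inf {nrm F0 a + nrm F1 b | a b. a \<in> pts F0 \<and> b \<in> pts F1 \<and> x = a + b})\<rparr>"

definition strip :: "complex set" where
  "strip = {z. 0 \<le> Re z \<and> Re z \<le> 1}"

definition open_strip :: "complex set" where
  "open_strip = {z. 0 < Re z \<and> Re z < 1}"

text \<open>
  The Calderon function space: functions that are bounded and continuous on the closed strip
  and holomorphic in its interior, with values in \<open>F0 + F1\<close>, and whose restrictions to the two
  boundary lines are continuous with values in \<open>F0\<close> and \<open>F1\<close>, respectively, vanishing at
  infinity.  Values outside of the closed strip are irrelevant.
\<close>

definition calderon_functions ::
    "'v::complex_vector nspace \<Rightarrow> 'v nspace \<Rightarrow> (complex \<Rightarrow> 'v) set" where
  "calderon_functions F0 F1 = {f.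
     (\<forall>z\<in>strip. f z \<in> pts (sum_space F0 F1)) \<and>
     (\<exists>B. \<forall>z\<in>strip. nrm (sum_space F0 F1) (f z) \<le> B) \<and>
     (\<forall>z\<in>strip. ((\<lambda>w. nrm (sum_space F0 F1) (f w - f z)) \<longlongrightarrow> 0) (at z within strip)) \<and>
     (\<forall>z\<in>open_strip. \<exists>d\<in>pts (sum_space F0 F1).
        ((\<lambda>w. nrm (sum_space F0 F1) (inverse (w - z) *\<^sub>C (f w - f z) - d)) \<longlongrightarrow> 0) (at z)) \<and>
     (\<forall>t. f (Complex 0 t) \<in> pts F0) \<and>
     (\<forall>t. ((\<lambda>s. nrm F0 (f (Complex 0 s) - f (Complex 0 t))) \<longlongrightarrow> 0) (at t)) \<and>
     ((\<lambda>t. nrm F0 (f (Complex 0 t))) \<longlongrightarrow> 0) at_infinity \<and>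
     (\<forall>t. f (Complex 1 t) \<in> pts F1) \<and>
     (\<forall>t. ((\<lambda>s. nrm F1 (f (Complex 1 s) - f (Complex 1 t))) \<longlongrightarrow> 0) (at t)) \<and>
     ((\<lambda>t. nrm F1 (f (Complex 1 t))) \<longlongrightarrow> 0) at_infinity}"

definition calderon_norm ::
    "'v nspace \<Rightarrow> 'v nspace \<Rightarrow> (complex \<Rightarrow> 'v) \<Rightarrow> real" where
  "calderon_norm F0 F1 f =
     max (SUP t. nrm F0 (f (Complex 0 t))) (SUP t. nrm F1 (f (Complex 1 t)))"

definition complex_interpolation ::
    "'v::complex_vector nspace \<Rightarrow> 'v nspace \<Rightarrow> real \<Rightarrow> 'v nspace" where
  "complex_interpolation F0 F1 \<theta> =
     \<lparr>pts = {f (complex_of_real \<theta>) | f. f \<in> calderon_functions F0 F1},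
      nrm = (\<lambda>x. Inf {calderon_norm F0 F1 f | f.
                      f \<in> calderon_functions F0 F1 \<and> f (complex_of_real \<theta>) = x})\<rparr>"

definition theta_hilbert :: "real \<Rightarrow> 'v::complex_hausdorff_tvs nspace \<Rightarrow> bool" where
  "theta_hilbert \<theta> F \<longleftrightarrow>
     banach_space F \<and>
     (\<exists>F0 F1. interpolation_couple F0 F1 \<and> hilbert_space F1 \<and>
        pts F = pts (complex_interpolation F0 F1 \<theta>) \<and>
        (\<forall>x\<in>pts F. nrm F x = nrm (complex_interpolation F0 F1 \<theta>) x))"


section \<open>Summing and mixing operators\<close>

text \<open>
  Operators \<open>E \<rightarrow> F\<close> are represented by functions on the whole type; their values outside of
  \<open>pts E\<close> are irrelevant, and none of the operator classes below depends on them.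
\<close>

definition linear_map ::
    "'a::complex_vector nspace \<Rightarrow> 'b::complex_vector nspace \<Rightarrow> ('a \<Rightarrow> 'b) \<Rightarrow> bool" where
  "linear_map E F T \<longleftrightarrow>
     (\<forall>x\<in>pts E. T x \<in> pts F) \<and>
     (\<forall>x\<in>pts E. \<forall>y\<in>pts E. T (x + y) = T x + T y) \<and>
     (\<forall>x\<in>pts E. \<forall>a. T (a *\<^sub>C x) = a *\<^sub>C T x)"

definition bounded_ops ::
    "'a::complex_vector nspace \<Rightarrow> 'b::complex_vector nspace \<Rightarrow> ('a \<Rightarrow> 'b) set" where
  "bounded_ops E F =
     {T. linear_map E F T \<and> (\<exists>C. \<forall>x\<in>pts E. nrm F (T x) \<le> C * nrm E x)}"

definition scalars :: "complex nspace" where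
  "scalars = \<lparr>pts = UNIV, nrm = cmod\<rparr>"

definition dual_ball :: "'a::complex_vector nspace \<Rightarrow> ('a \<Rightarrow> complex) set" where
  "dual_ball E = {\<phi> \<in> bounded_ops E scalars. \<forall>x\<in>pts E. cmod (\<phi> x) \<le> nrm E x}"

text \<open>
  The \<open>\<ell>\<^sub>p\<close> norm of a finite family of nonnegative reals, for \<open>1 \<le> p \<le> \<infinity>\<close>.
  The empty family has norm \<open>0\<close>.
\<close>

definition lp_norm :: "ereal \<Rightarrow> nat \<Rightarrow> (nat \<Rightarrow> real) \<Rightarrow> real" where
  "lp_norm p n a =
     (if p = \<infinity> then Max (insert 0 (a ` {..<n}))
      else (\<Sum>i<n. a i powr real_of_ereal p) powr (1 / real_of_ereal p))"

text \<open>\<open>summing r p\<close> is meant for \<open>1 \<le> p \<le> r \<le> \<infinity>\<close>, and \<open>mixing _ s p\<close> for \<open>1 \<le> p \<le> s \<le> \<infinity>\<close>.\<close>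

definition summing ::
    "ereal \<Rightarrow> ereal \<Rightarrow> 'a::complex_vector nspace \<Rightarrow> 'b::complex_vector nspace \<Rightarrow> ('a \<Rightarrow> 'b) set"
  where
  "summing r p E F =
     {T \<in> bounded_ops E F. \<exists>\<rho>\<ge>0. \<forall>n x. (\<forall>i<n. x i \<in> pts E) \<longrightarrow>
        lp_norm r n (\<lambda>i. nrm F (T (x i)))
          \<le> \<rho> * (SUP \<phi>\<in>dual_ball E. lp_norm p n (\<lambda>i. cmod (\<phi> (x i))))}"

text \<open>
  A definition cannot quantify over all Banach spaces \<open>Y\<close> of all types, so the type \<open>'y\<close> of the
  vector space in which \<open>Y\<close> lives is a parameter.  A theorem with \<open>'y\<close> as a free type variable
  speaks about all Banach spaces \<open>Y\<close>.
\<close>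

definition mixing ::
    "'y::complex_vector itself \<Rightarrow> ereal \<Rightarrow> ereal \<Rightarrow>
     'a::complex_vector nspace \<Rightarrow> 'b::complex_vector nspace \<Rightarrow> ('a \<Rightarrow> 'b) set"
  where
  "mixing _ s p E F =
     {T \<in> bounded_ops E F. \<forall>(Y :: 'y nspace) S.
        banach_space Y \<and> S \<in> summing s s F Y \<longrightarrow> S \<circ> T \<in> summing p p E Y}"

end

theory Submission
  imports Defs
begin

text \<open>
  Every operator class in the theorem is by definition a subset of the bounded operators, so it
  suffices to put an arbitrary bounded \<open>T : \<ell>\<^sub>1 \<rightarrow> F\<close> into the summing and mixing classes.

  Let \<open>x\<^sub>1, \<dots>, x\<^sub>n\<close> be a family in \<open>\<ell>\<^sub>1\<close> of weak \<open>\<ell>\<^sub>2\<close> norm at most 1, cut down to its first \<open>N\<close>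
  coordinates; it is a matrix \<open>V\<close> of norm at most 1 from \<open>\<ell>\<^sub>2\<close> to \<open>\<ell>\<^sub>1\<close>.  The heart of the proof is the
  factorization (\<open>interpolation_factorization\<close>, \<open>mixed_factorization\<close>)
  \<open>T x\<^sub>i = l\<^sub>i w\<^sub>i\<close>, where \<open>\<Sum>\<^sub>i |l\<^sub>i|\<close> to the power \<open>2 / \<theta>\<close> is bounded and
  \<open>\<parallel>\<Sum>\<^sub>i a\<^sub>i w\<^sub>i\<parallel> \<le> c\<close> whenever \<open>a\<close> lies in the unit ball of \<open>\<ell>\<close> with exponent
  \<open>2 / (1 + \<theta>)\<close>, the conjugate exponent of \<open>s = 2 / (1 - \<theta>)\<close>.  The second condition says that \<open>(w\<^sub>i)\<close>
  is weakly \<open>s\<close>-summable in \<open>F\<close>.  It asks only for upper bounds on norms in \<open>F\<close>, and such bounds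
  are obtained by exhibiting Calderon functions, so the dual of an interpolation space never has to
  be computed.

  To find the factorization, lift the images of the unit vectors to Calderon functions \<open>f\<^sub>k\<close> and put
  \<open>G\<^sub>i(z) = \<Sum>\<^sub>k V\<^sub>k\<^sub>i f\<^sub>k(z)\<close>, so that \<open>G\<^sub>i(\<theta>) = T x\<^sub>i\<close>.  On the line \<open>Re z = 0\<close> nothing is known about \<open>F\<^sub>0\<close>
  and only the norm of \<open>V\<close> is used.  On the line \<open>Re z = 1\<close> the values lie in the Hilbert space \<open>F\<^sub>1\<close>, and
  Grothendieck's inequality bounds the sum of the squares \<open>\<parallel>G\<^sub>i(1 + it)\<parallel>\<^sup>2\<close> for every \<open>t\<close>
  (\<open>hilbert_schmidt_bound_in_space\<close>).  The numbers \<open>\<parallel>G\<^sub>i(1 + it)\<parallel>\<close> depend on \<open>t\<close>, so the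
  coefficients must be turned into analytic functions.  Rational functions \<open>H\<^sub>i\<close> with positive real part
  are built that dominate \<open>\<parallel>G\<^sub>i(1 + it)\<parallel>\<^sup>2\<close> on the right line, up to a polynomial
  factor, and for which \<open>\<Sum>\<^sub>i |H\<^sub>i(\<theta>)|\<close> stays bounded (\<open>strip_majorants\<close>).  The power
  \<open>H\<^sub>i\<close> to the \<open>z / 2\<close> is harmless on the left line, and dividing by it brings \<open>G\<^sub>i\<close> to bounded size on the right
  one; its value at \<open>\<theta>\<close> is \<open>l\<^sub>i\<close>.  The factor \<open>exp (z\<^sup>2)\<close> absorbs the polynomial factor and the growth caused
  by the imaginary part of the exponent.

  The factorization gives the exponents \<open>(2 / \<theta>, 2)\<close> at once.  If \<open>S\<close> is \<open>s\<close>-summing then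
  \<open>\<Sum>\<^sub>i \<parallel>S w\<^sub>i\<parallel>\<close> to the power \<open>s\<close> is bounded, and Hoelder's inequality with
  \<open>1 / 2 = \<theta> / 2 + 1 / s\<close> shows that \<open>S \<circ> T\<close> is 2-summing.  The statements with \<open>p = 1\<close> follow from those
  with \<open>p = 2\<close>, because on \<open>\<ell>\<^sub>1\<close> a family of weak \<open>\<ell>\<^sub>1\<close> norm 1 is a family of bounded weak \<open>\<ell>\<^sub>2\<close>
  norm multiplied by a sequence in \<open>\<ell>\<^sub>2\<close>: this is \<open>pietsch_weights\<close>, again a consequence of Grothendieck's
  inequality.
\<close>

section \<open>Grothendieck's inequality\<close>

lemma sum_lessThan_double:
  fixes f :: "nat \<Rightarrow> 'a::comm_monoid_add"
  shows "(\<Sum>w<2 * D. f w) = (\<Sum>w<D. f w) + (\<Sum>w<D. f (w + D))"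
proof -
  have "(\<Sum>w<2 * D. f w) = sum f {0..<D} + sum f {D..<2 * D}"
    by (simp add: lessThan_atLeast0 sum.atLeastLessThan_concat)
  also have "sum f {D..<2 * D} = (\<Sum>w = 0..<D. f (w + D))"
    using sum.shift_bounds_nat_ivl[of f 0 D D] by (simp add: mult_2)
  finally show ?thesis
    by (simp add: lessThan_atLeast0)
qed

lemma fourth_power_parallelogram:
  fixes x u :: complex
  shows "cmod (x + u) ^ 4 + cmod (x - u) ^ 4
           \<le> 2 * cmod x ^ 4 + 12 * (cmod x)\<^sup>2 * (cmod u)\<^sup>2 + 2 * cmod u ^ 4"
proof -
  define A where "A = (cmod x)\<^sup>2 + (cmod u)\<^sup>2"
  define r where "r = x \<bullet> u"
  have p: "(cmod (x + u))\<^sup>2 = A + 2 * r" and m: "(cmod (x - u))\<^sup>2 = A - 2 * r"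
    unfolding A_def r_def
    by (simp_all add: power2_norm_eq_inner inner_add_left inner_add_right inner_diff_left
        inner_diff_right inner_commute algebra_simps)
  have "r\<^sup>2 \<le> (cmod x)\<^sup>2 * (cmod u)\<^sup>2"
    unfolding r_def using Cauchy_Schwarz_ineq[of x u] by (simp add: power2_norm_eq_inner)
  moreover have "cmod (x + u) ^ 4 + cmod (x - u) ^ 4 = 2 * A\<^sup>2 + 8 * r\<^sup>2"
  proof -
    have "cmod (x + u) ^ 4 + cmod (x - u) ^ 4 = ((cmod (x + u))\<^sup>2)\<^sup>2 + ((cmod (x - u))\<^sup>2)\<^sup>2"
      by (simp flip: power_mult)
    also have "\<dots> = 2 * A\<^sup>2 + 8 * r\<^sup>2"
      unfolding p m by (simp add: power2_eq_square algebra_simps)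
    finally show ?thesis .
  qed
  moreover have "A\<^sup>2 = cmod x ^ 4 + 2 * (cmod x)\<^sup>2 * (cmod u)\<^sup>2 + cmod u ^ 4"
    unfolding A_def by (simp add: power2_sum flip: power_mult)
  ultimately show ?thesis by (simp add: algebra_simps)
qed

text \<open>
  Finitely many independent random signs, realized as functions on a finite set with counting measure.
  The induction adjoins one sign by taking two copies of the set.  The fourth moment is what makes it
  possible to truncate a random sum in \<open>grothendieck_bound_improve\<close>.
\<close>

lemma rademacher_system:
  "\<exists>(D::nat) (\<sigma>::nat \<Rightarrow> nat \<Rightarrow> complex). D > 0 \<and> (\<forall>w j. \<sigma> w j \<in> \<real>) \<and>
     (\<forall>u v. (\<Sum>w<D. (\<Sum>j<m. u j * \<sigma> w j) * (\<Sum>j<m. v j * \<sigma> w j)) = of_nat D * (\<Sum>j<m. u j * v j)) \<and>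
     (\<forall>u. (\<Sum>w<D. cmod (\<Sum>j<m. u j * \<sigma> w j) ^ 4) \<le> 3 * real D * (\<Sum>j<m. (cmod (u j))\<^sup>2)\<^sup>2)"
proof (induction m)
  case 0
  show ?case by (rule exI[of _ 1], rule exI[of _ "\<lambda>_ _. 0"]) simp
next
  case (Suc m)
  then obtain D \<sigma> where D: "D > 0" and real: "\<And>w j. \<sigma> w j \<in> \<real>"
    and two: "\<And>u v. (\<Sum>w<D. (\<Sum>j<m. u j * \<sigma> w j) * (\<Sum>j<m. v j * \<sigma> w j)) = of_nat D * (\<Sum>j<m. u j * v j)"
    and four: "\<And>u. (\<Sum>w<D. cmod (\<Sum>j<m. u j * \<sigma> w j) ^ 4) \<le> 3 * real D * (\<Sum>j<m. (cmod (u j))\<^sup>2)\<^sup>2"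
    by blast
  define \<sigma>' where "\<sigma>' w j = (if j = m then (if w < D then 1 else - 1) else \<sigma> (w mod D) j)" for w j
  have lo: "(\<Sum>j<Suc m. u j * \<sigma>' w j) = (\<Sum>j<m. u j * \<sigma> w j) + u m" if "w < D" for u w
    using that by (simp add: \<sigma>'_def)
  have hi: "(\<Sum>j<Suc m. u j * \<sigma>' (w + D) j) = (\<Sum>j<m. u j * \<sigma> w j) - u m" if "w < D" for u w
    using that by (simp add: \<sigma>'_def)
  have two': "(\<Sum>w<2 * D. (\<Sum>j<Suc m. u j * \<sigma>' w j) * (\<Sum>j<Suc m. v j * \<sigma>' w j))
      = of_nat (2 * D) * (\<Sum>j<Suc m. u j * v j)" for u v
  proof -
    let ?X = "\<lambda>w. \<Sum>j<m. u j * \<sigma> w j" and ?Y = "\<lambda>w. \<Sum>j<m. v j * \<sigma> w j"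
    have "(\<Sum>w<2 * D. (\<Sum>j<Suc m. u j * \<sigma>' w j) * (\<Sum>j<Suc m. v j * \<sigma>' w j))
        = (\<Sum>w<D. (?X w + u m) * (?Y w + v m)) + (\<Sum>w<D. (?X w - u m) * (?Y w - v m))"
      unfolding sum_lessThan_double using lo hi by simp
    also have "\<dots> = (\<Sum>w<D. 2 * (?X w * ?Y w) + 2 * (u m * v m))"
      by (simp add: algebra_simps flip: sum.distrib)
    also have "\<dots> = 2 * (\<Sum>w<D. ?X w * ?Y w) + of_nat D * (2 * (u m * v m))"
      by (simp add: sum.distrib sum_distrib_left)
    also have "\<dots> = of_nat (2 * D) * (\<Sum>j<Suc m. u j * v j)"
      by (simp add: two algebra_simps)
    finally show ?thesis .
  qed
  have second: "(\<Sum>w<D. (cmod (\<Sum>j<m. u j * \<sigma> w j))\<^sup>2) = real D * (\<Sum>j<m. (cmod (u j))\<^sup>2)" for u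
  proof -
    have c: "(\<Sum>j<m. cnj (u j) * \<sigma> w j) = cnj (\<Sum>j<m. u j * \<sigma> w j)" for w
      using real by (simp add: Reals_cnj_iff)
    have "complex_of_real (\<Sum>w<D. (cmod (\<Sum>j<m. u j * \<sigma> w j))\<^sup>2)
        = complex_of_real (real D * (\<Sum>j<m. (cmod (u j))\<^sup>2))"
      using two[of u "\<lambda>j. cnj (u j)"] by (simp only: c flip: complex_norm_square) simp
    then show ?thesis by (simp only: of_real_eq_iff)
  qed
  have four': "(\<Sum>w<2 * D. cmod (\<Sum>j<Suc m. u j * \<sigma>' w j) ^ 4)
      \<le> 3 * real (2 * D) * (\<Sum>j<Suc m. (cmod (u j))\<^sup>2)\<^sup>2" for u
  proof -
    let ?X = "\<lambda>w. \<Sum>j<m. u j * \<sigma> w j"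
    define S where "S = (\<Sum>j<m. (cmod (u j))\<^sup>2)"
    define p where "p = (cmod (u m))\<^sup>2"
    have "(\<Sum>w<2 * D. cmod (\<Sum>j<Suc m. u j * \<sigma>' w j) ^ 4)
        = (\<Sum>w<D. cmod (?X w + u m) ^ 4 + cmod (?X w - u m) ^ 4)"
      unfolding sum_lessThan_double sum.distrib using lo hi by simp
    also have "\<dots> \<le> (\<Sum>w<D. 2 * cmod (?X w) ^ 4 + 12 * (cmod (?X w))\<^sup>2 * (cmod (u m))\<^sup>2 + 2 * cmod (u m) ^ 4)"
      by (intro sum_mono fourth_power_parallelogram)
    also have "\<dots> = 2 * (\<Sum>w<D. cmod (?X w) ^ 4) + 12 * (\<Sum>w<D. (cmod (?X w))\<^sup>2) * p + 2 * real D * p\<^sup>2"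
      by (simp add: sum.distrib sum_distrib_left sum_distrib_right p_def algebra_simps flip: power_mult)
    also have "\<dots> \<le> 2 * (3 * real D * S\<^sup>2) + 12 * (real D * S) * p + 2 * real D * p\<^sup>2"
      using four[of u] by (simp add: second S_def)
    also have "\<dots> \<le> 3 * real (2 * D) * (S + p)\<^sup>2"
      using zero_le_power2[of "cmod (u m)"] unfolding p_def[symmetric]
      by (simp add: power2_eq_square algebra_simps zero_le_mult_iff)
    finally show ?thesis by (simp add: S_def p_def)
  qed
  show ?case
    using D two' four' real
    by (intro exI[of _ "2 * D"] exI[of _ \<sigma>'] conjI allI) (auto simp: \<sigma>'_def)
qed

lemma cmod_sum_mult_le_L2:
  fixes u v :: "nat \<Rightarrow> complex"
  shows "cmod (\<Sum>j<m. u j * v j) \<le> sqrt (\<Sum>j<m. (cmod (u j))\<^sup>2) * sqrt (\<Sum>j<m. (cmod (v j))\<^sup>2)"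
proof -
  have "cmod (\<Sum>j<m. u j * v j) \<le> (\<Sum>j<m. \<bar>cmod (u j)\<bar> * \<bar>cmod (v j)\<bar>)"
    by (rule order_trans[OF norm_sum]) (simp add: norm_mult)
  also have "\<dots> \<le> L2_set (\<lambda>j. cmod (u j)) {..<m} * L2_set (\<lambda>j. cmod (v j)) {..<m}"
    by (rule L2_set_mult_ineq)
  finally show ?thesis by (simp add: L2_set_def)
qed

text \<open>
  The bilinear form of the matrix \<open>V\<close>, applied to vectors in a Hilbert space instead of scalars, is
  bounded by \<open>C\<close> on the unit ball.
\<close>

definition grothendieck_bound :: "(nat \<Rightarrow> nat \<Rightarrow> complex) \<Rightarrow> nat \<Rightarrow> nat \<Rightarrow> real \<Rightarrow> bool" where
  "grothendieck_bound V N n C \<longleftrightarrow>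
     (\<forall>(m::nat) u v. (\<forall>k<N. (\<Sum>j<m. (cmod (u k j))\<^sup>2) \<le> 1) \<longrightarrow> (\<forall>i<n. (\<Sum>j<m. (cmod (v i j))\<^sup>2) \<le> 1) \<longrightarrow>
        cmod (\<Sum>k<N. \<Sum>i<n. V k i * (\<Sum>j<m. u k j * v i j)) \<le> C)"

lemma grothendieck_boundD:
  fixes u v :: "nat \<Rightarrow> nat \<Rightarrow> complex"
  assumes "grothendieck_bound V N n C"
    and "\<And>k. k < N \<Longrightarrow> (\<Sum>j<m. (cmod (u k j))\<^sup>2) \<le> 1"
    and "\<And>i. i < n \<Longrightarrow> (\<Sum>j<m. (cmod (v i j))\<^sup>2) \<le> 1"
  shows "cmod (\<Sum>k<N. \<Sum>i<n. V k i * (\<Sum>j<m. u k j * v i j)) \<le> C"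
  using assms unfolding grothendieck_bound_def by simp

lemma grothendieck_bound_scaled:
  fixes u v :: "nat \<Rightarrow> nat \<Rightarrow> complex"
  assumes "grothendieck_bound V N n C" and "0 < \<alpha>" and "0 < \<beta>"
    and "\<And>k. k < N \<Longrightarrow> (\<Sum>j<m. (cmod (u k j))\<^sup>2) \<le> \<alpha>\<^sup>2"
    and "\<And>i. i < n \<Longrightarrow> (\<Sum>j<m. (cmod (v i j))\<^sup>2) \<le> \<beta>\<^sup>2"
  shows "cmod (\<Sum>k<N. \<Sum>i<n. V k i * (\<Sum>j<m. u k j * v i j)) \<le> C * \<alpha> * \<beta>"
proof -
  have u: "(\<Sum>j<m. (cmod (u k j / of_real \<alpha>))\<^sup>2) \<le> 1" if "k < N" for k
    using assms(2) assms(4)[OF that]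
    by (simp add: norm_divide power_divide divide_le_eq flip: sum_divide_distrib)
  have v: "(\<Sum>j<m. (cmod (v i j / of_real \<beta>))\<^sup>2) \<le> 1" if "i < n" for i
    using assms(3) assms(5)[OF that]
    by (simp add: norm_divide power_divide divide_le_eq flip: sum_divide_distrib)
  have
    "cmod (\<Sum>k<N. \<Sum>i<n. V k i * (\<Sum>j<m. u k j / of_real \<alpha> * (v i j / of_real \<beta>))) \<le> C"
    by (rule grothendieck_boundD[OF assms(1), where u = "\<lambda>k j. u k j / of_real \<alpha>"
          and v = "\<lambda>i j. v i j / of_real \<beta>", OF u v])
  moreover have "(\<Sum>k<N. \<Sum>i<n. V k i * (\<Sum>j<m. u k j / of_real \<alpha> * (v i j / of_real \<beta>)))
      = (\<Sum>k<N. \<Sum>i<n. V k i * (\<Sum>j<m. u k j * v i j)) / (of_real \<alpha> * of_real \<beta>)"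
    by (simp add: sum_divide_distrib sum_distrib_left)
  ultimately show ?thesis
    using assms(2,3) by (simp add: norm_divide norm_mult divide_le_eq mult.assoc)
qed

lemma grothendieck_bound_trivial:
  "grothendieck_bound V N n (\<Sum>k<N. \<Sum>i<n. cmod (V k i))"
  unfolding grothendieck_bound_def
proof (intro allI impI)
  fix m :: nat and u v :: "nat \<Rightarrow> nat \<Rightarrow> complex"
  assume u: "\<forall>k<N. (\<Sum>j<m. (cmod (u k j))\<^sup>2) \<le> 1" and v: "\<forall>i<n. (\<Sum>j<m. (cmod (v i j))\<^sup>2) \<le> 1"
  have uv: "cmod (\<Sum>j<m. u k j * v i j) \<le> 1" if "k < N" "i < n" for k i
  proof -
    have "cmod (\<Sum>j<m. u k j * v i j)
        \<le> sqrt (\<Sum>j<m. (cmod (u k j))\<^sup>2) * sqrt (\<Sum>j<m. (cmod (v i j))\<^sup>2)"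
      by (rule cmod_sum_mult_le_L2)
    also have "\<dots> \<le> 1 * 1"
      using u v that by (intro mult_mono) (auto intro: sum_nonneg)
    finally show ?thesis by simp
  qed
  show "cmod (\<Sum>k<N. \<Sum>i<n. V k i * (\<Sum>j<m. u k j * v i j)) \<le> (\<Sum>k<N. \<Sum>i<n. cmod (V k i))"
    by (intro sum_norm_le) (simp add: norm_mult mult_left_le uv)
qed

text \<open>
  A bound that holds for all finite-dimensional Hilbert spaces improves itself.  Write the scalar
  products as expectations of products of random sums \<open>X\<^sub>k\<close> and \<open>Y\<^sub>i\<close>, and cut these at level
  \<open>\<surd>48\<close>.  The bounded parts are handled pointwise by the scalar hypothesis, at the price \<open>48 * c\<close>.
  The tails have \<open>L\<^sub>2\<close> norm at most \<open>\<surd>(3 / 48) = 1 / 4\<close> by the fourth moment bound, and since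
  random variables on a finite set are themselves vectors of a finite-dimensional Hilbert space, the
  assumed bound \<open>C\<close> applies to each of the two products with a tail.
\<close>

lemma grothendieck_bound_improve:
  assumes V: "\<And>s t. (\<And>k. cmod (s k) \<le> 1) \<Longrightarrow> (\<And>i. cmod (t i) \<le> 1) \<Longrightarrow>
      cmod (\<Sum>k<N. \<Sum>i<n. V k i * (s k * t i)) \<le> c"
    and C: "grothendieck_bound V N n C"
  shows "grothendieck_bound V N n (48 * c + C / 2)"
  unfolding grothendieck_bound_def
proof (intro allI impI)
  fix m :: nat and u v :: "nat \<Rightarrow> nat \<Rightarrow> complex"
  assume u: "\<forall>k<N. (\<Sum>j<m. (cmod (u k j))\<^sup>2) \<le> 1" and v: "\<forall>i<n. (\<Sum>j<m. (cmod (v i j))\<^sup>2) \<le> 1"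
  obtain D \<sigma> where D: "D > 0" and real: "\<And>w j. \<sigma> w j \<in> \<real>"
    and two: "\<And>u v. (\<Sum>w<D. (\<Sum>j<m. u j * \<sigma> w j) * (\<Sum>j<m. v j * \<sigma> w j)) = of_nat D * (\<Sum>j<m. u j * v j)"
    and four: "\<And>u. (\<Sum>w<D. cmod (\<Sum>j<m. u j * \<sigma> w j) ^ 4) \<le> 3 * real D * (\<Sum>j<m. (cmod (u j))\<^sup>2)\<^sup>2"
    using rademacher_system[of m] by blast
  define X where "X a w = (\<Sum>j<m. a j * \<sigma> w j)" for a w
  define M where "M = sqrt 48"
  define Lo where "Lo x = (if cmod x \<le> M then x else 0)" for x
  define Hi where "Hi x = (if cmod x \<le> M then 0 else x)" for x
  have M2: "M\<^sup>2 = 48" and M: "M > 0" by (simp_all add: M_def)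
  have split: "x * y = Lo x * Lo y + Hi x * y + Lo x * Hi y" for x y
    by (auto simp: Lo_def Hi_def)
  have XL: "(\<Sum>w<D. (cmod (X a w))\<^sup>2) \<le> (sqrt D)\<^sup>2" if "(\<Sum>j<m. (cmod (a j))\<^sup>2) \<le> 1" for a
  proof -
    have c: "(\<Sum>j<m. cnj (a j) * \<sigma> w j) = cnj (X a w)" for w
      using real by (simp add: X_def Reals_cnj_iff)
    have "complex_of_real (\<Sum>w<D. (cmod (X a w))\<^sup>2)
        = complex_of_real (real D * (\<Sum>j<m. (cmod (a j))\<^sup>2))"
      using two[of a "\<lambda>j. cnj (a j)"]
      by (simp only: c X_def[symmetric] flip: complex_norm_square) simp
    then have "(\<Sum>w<D. (cmod (X a w))\<^sup>2) = real D * (\<Sum>j<m. (cmod (a j))\<^sup>2)"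
      by (simp only: of_real_eq_iff)
    then show ?thesis using that by (simp add: mult_left_le)
  qed
  have LoL: "(\<Sum>w<D. (cmod (Lo (X a w)))\<^sup>2) \<le> (sqrt D)\<^sup>2" if "(\<Sum>j<m. (cmod (a j))\<^sup>2) \<le> 1" for a
    by (rule order_trans[OF _ XL[OF that]]) (auto intro!: sum_mono simp: Lo_def)
  have HiL: "(\<Sum>w<D. (cmod (Hi (X a w)))\<^sup>2) \<le> (sqrt D / 4)\<^sup>2" if "(\<Sum>j<m. (cmod (a j))\<^sup>2) \<le> 1" for a
  proof -
    have pt: "(cmod (Hi x))\<^sup>2 \<le> cmod x ^ 4 / 48" for x
    proof (cases "cmod x \<le> M")
      case False
      then have "M\<^sup>2 \<le> (cmod x)\<^sup>2" using M by (intro power_mono) auto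
      then have "48 * (cmod x)\<^sup>2 \<le> (cmod x)\<^sup>2 * (cmod x)\<^sup>2"
        unfolding M2 by (intro mult_right_mono) auto
      then show ?thesis using False by (simp add: Hi_def flip: power_add)
    qed (simp add: Hi_def)
    have "(\<Sum>w<D. (cmod (Hi (X a w)))\<^sup>2) \<le> (\<Sum>w<D. cmod (X a w) ^ 4) / 48"
      unfolding sum_divide_distrib by (intro sum_mono pt)
    also have "\<dots> \<le> 3 * real D * (\<Sum>j<m. (cmod (a j))\<^sup>2)\<^sup>2 / 48"
      using four[of a] by (simp add: X_def)
    also have "(\<Sum>j<m. (cmod (a j))\<^sup>2)\<^sup>2 \<le> 1"
      using that by (simp add: power_le_one sum_nonneg)
    finally show ?thesis using D by (simp add: power_divide)
  qed
  define B where "B p q = (\<Sum>k<N. \<Sum>i<n. V k i * (\<Sum>w<D. p (X (u k) w) * q (X (v i) w)))"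
    for p q :: "complex \<Rightarrow> complex"
  have "of_nat D * (\<Sum>k<N. \<Sum>i<n. V k i * (\<Sum>j<m. u k j * v i j)) = B (\<lambda>x. x) (\<lambda>x. x)"
    unfolding B_def X_def two by (simp add: sum_distrib_left mult_ac)
  also have "\<dots> = B Lo Lo + B Hi (\<lambda>x. x) + B Lo Hi"
    unfolding B_def sum.distrib[symmetric] distrib_left[symmetric] split[symmetric] ..
  finally have eq: "of_nat D * (\<Sum>k<N. \<Sum>i<n. V k i * (\<Sum>j<m. u k j * v i j)) = \<dots>" .
  have b1: "cmod (B Lo Lo) \<le> real D * (48 * c)"
  proof -
    have "cmod (\<Sum>k<N. \<Sum>i<n. V k i * (Lo (X (u k) w) * Lo (X (v i) w))) \<le> 48 * c" for w
    proof -
      have "cmod (\<Sum>k<N. \<Sum>i<n. V k i * (Lo (X (u k) w) / of_real M * (Lo (X (v i) w) / of_real M))) \<le> c"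
        using M by (intro V) (auto simp: Lo_def norm_divide)
      moreover have "(\<Sum>k<N. \<Sum>i<n. V k i * (Lo (X (u k) w) / of_real M * (Lo (X (v i) w) / of_real M)))
         = (\<Sum>k<N. \<Sum>i<n. V k i * (Lo (X (u k) w) * Lo (X (v i) w))) / of_real (M\<^sup>2)"
        by (simp add: power2_eq_square sum_divide_distrib)
      ultimately have "cmod ((\<Sum>k<N. \<Sum>i<n. V k i * (Lo (X (u k) w) * Lo (X (v i) w))) / of_real (M\<^sup>2)) \<le> c"
        by (simp only:)
      then show ?thesis by (simp add: M2 norm_divide)
    qed
    moreover have "B Lo Lo = (\<Sum>w<D. \<Sum>k<N. \<Sum>i<n. V k i * (Lo (X (u k) w) * Lo (X (v i) w)))"
    proof -
      have "B Lo Lo = (\<Sum>k<N. \<Sum>w<D. \<Sum>i<n. V k i * (Lo (X (u k) w) * Lo (X (v i) w)))"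
        unfolding B_def by (subst (2) sum.swap) (simp add: sum_distrib_left)
      also have "\<dots> = (\<Sum>w<D. \<Sum>k<N. \<Sum>i<n. V k i * (Lo (X (u k) w) * Lo (X (v i) w)))"
        by (rule sum.swap)
      finally show ?thesis .
    qed
    ultimately show ?thesis
      using sum_norm_le[of "{..<D}" "\<lambda>w. \<Sum>k<N. \<Sum>i<n. V k i * (Lo (X (u k) w) * Lo (X (v i) w))" "\<lambda>_. 48 * c"]
      by simp
  qed
  have b2: "cmod (B Hi (\<lambda>x. x)) \<le> C * (sqrt D / 4) * sqrt D"
    unfolding B_def using D u v by (intro grothendieck_bound_scaled[OF C] HiL XL) auto
  have b3: "cmod (B Lo Hi) \<le> C * sqrt D * (sqrt D / 4)"
    unfolding B_def using D u v by (intro grothendieck_bound_scaled[OF C] HiL LoL) auto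
  have "real D * cmod (\<Sum>k<N. \<Sum>i<n. V k i * (\<Sum>j<m. u k j * v i j))
      = cmod (B Lo Lo + B Hi (\<lambda>x. x) + B Lo Hi)"
    unfolding eq[symmetric] by (simp add: norm_mult)
  also have "\<dots> \<le> cmod (B Lo Lo) + cmod (B Hi (\<lambda>x. x)) + cmod (B Lo Hi)"
    by (intro order_trans[OF norm_triangle_ineq] add_mono norm_triangle_ineq order_refl)
  also have "\<dots> \<le> real D * (48 * c) + C * (sqrt D / 4) * sqrt D + C * sqrt D * (sqrt D / 4)"
    using b1 b2 b3 by linarith
  also have "\<dots> = real D * (48 * c + C / 2)"
    by (simp add: field_simps)
  finally show "cmod (\<Sum>k<N. \<Sum>i<n. V k i * (\<Sum>j<m. u k j * v i j)) \<le> 48 * c + C / 2"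
    using D by simp
qed

text \<open>
  The map that takes a bound \<open>C\<close> to \<open>48 * c + C / 2\<close> has the fixed point \<open>96 * c\<close>; iterate it from
  any finite bound.
\<close>

theorem grothendieck_inequality:
  assumes V: "\<And>s t. (\<And>k. cmod (s k) \<le> 1) \<Longrightarrow> (\<And>i. cmod (t i) \<le> 1) \<Longrightarrow>
      cmod (\<Sum>k<N. \<Sum>i<n. V k i * (s k * t i)) \<le> c"
  shows "grothendieck_bound V N n (96 * c)"
proof -
  define C0 where "C0 = (\<Sum>k<N. \<Sum>i<n. cmod (V k i))"
  have "0 \<le> c" using V[of "\<lambda>_. 0" "\<lambda>_. 0"] by simp
  have mono: "grothendieck_bound V N n C'" if "grothendieck_bound V N n C" "C \<le> C'" for C C'
    using that unfolding grothendieck_bound_def by (meson order_trans)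
  have step: "grothendieck_bound V N n (96 * c + C0 * (1/2) ^ p)" for p
  proof (induction p)
    case 0
    show ?case using mono[OF grothendieck_bound_trivial[of V N n]] \<open>0 \<le> c\<close> by (simp add: C0_def)
  next
    case (Suc p)
    show ?case by (rule mono[OF grothendieck_bound_improve[OF V Suc]]) auto
  qed
  have lim: "(\<lambda>p. 96 * c + C0 * (1/2) ^ p) \<longlonglongrightarrow> 96 * c + C0 * 0"
    by (intro tendsto_intros LIMSEQ_realpow_zero) auto
  show ?thesis
    unfolding grothendieck_bound_def
  proof (intro allI impI)
    fix m :: nat and u v :: "nat \<Rightarrow> nat \<Rightarrow> complex"
    assume uv: "\<forall>k<N. (\<Sum>j<m. (cmod (u k j))\<^sup>2) \<le> 1" "\<forall>i<n. (\<Sum>j<m. (cmod (v i j))\<^sup>2) \<le> 1"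
    have "cmod (\<Sum>k<N. \<Sum>i<n. V k i * (\<Sum>j<m. u k j * v i j)) \<le> 96 * c + C0 * 0"
      by (rule LIMSEQ_le_const[OF lim]) (use grothendieck_boundD[OF step, of u m v] uv in auto)
    then show "cmod (\<Sum>k<N. \<Sum>i<n. V k i * (\<Sum>j<m. u k j * v i j)) \<le> 96 * c" by simp
  qed
qed

section \<open>Two consequences: Hilbert--Schmidt bounds and Pietsch weights\<close>

lemma cnj_sgn_mult: "cnj (sgn z) * z = complex_of_real (cmod z)"
  using complex_norm_square[of z]
  by (cases "z = 0") (simp_all add: sgn_eq field_simps power2_eq_square)

lemma bilinear_form_le_row_norm:
  fixes V :: "nat \<Rightarrow> nat \<Rightarrow> complex"
  assumes "\<And>a. (\<And>i. cmod (a i) \<le> 1) \<Longrightarrow> (\<Sum>k<N. cmod (\<Sum>i<n. V k i * a i)) \<le> c"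
    and "\<And>k. cmod (s k) \<le> 1" and "\<And>i. cmod (t i) \<le> 1"
  shows "cmod (\<Sum>k<N. \<Sum>i<n. V k i * (s k * t i)) \<le> c"
proof -
  have "(\<Sum>k<N. \<Sum>i<n. V k i * (s k * t i)) = (\<Sum>k<N. s k * (\<Sum>i<n. V k i * t i))"
    by (simp add: sum_distrib_left mult_ac)
  also have "cmod \<dots> \<le> (\<Sum>k<N. cmod (\<Sum>i<n. V k i * t i))"
    using assms(2) by (intro sum_norm_le) (simp add: norm_mult mult_left_le_one_le)
  finally show ?thesis using assms(1)[of t, OF assms(3)] by linarith
qed

text \<open>
  The operator \<open>a \<mapsto> \<Sum>\<^sub>i a\<^sub>i (\<Sum>\<^sub>k V\<^sub>k\<^sub>i c\<^sub>k)\<close> factors through \<open>\<ell>\<^sub>1\<close>, hence is Hilbert--Schmidt.  Its squared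
  Hilbert--Schmidt norm \<open>B\<^sup>2\<close> is the form with matrix \<open>V\<^sub>k\<^sub>i b\<^sub>i\<close> at the vectors \<open>c\<^sub>k\<close> and the normalized
  columns, where \<open>b\<^sub>i\<close> is the length of the \<open>i\<close>-th column; Grothendieck's inequality bounds it by \<open>96 * B * C\<close>.
\<close>

theorem hilbert_schmidt_bound:
  fixes V c :: "nat \<Rightarrow> nat \<Rightarrow> complex"
  assumes V: "\<And>a. (\<Sum>k<N. cmod (\<Sum>i<n. V k i * a i)) \<le> sqrt (\<Sum>i<n. (cmod (a i))\<^sup>2)"
    and c: "\<And>k. k < N \<Longrightarrow> (\<Sum>m<M. (cmod (c k m))\<^sup>2) \<le> C\<^sup>2" and C: "0 < C"
  shows "(\<Sum>i<n. \<Sum>m<M. (cmod (\<Sum>k<N. V k i * c k m))\<^sup>2) \<le> (96 * C)\<^sup>2"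
proof -
  define d where "d i m = (\<Sum>k<N. V k i * c k m)" for i m
  define b where "b i = sqrt (\<Sum>m<M. (cmod (d i m))\<^sup>2)" for i
  define B where "B = sqrt (\<Sum>i<n. (b i)\<^sup>2)"
  have b2: "(b i)\<^sup>2 = (\<Sum>m<M. (cmod (d i m))\<^sup>2)" and b0: "0 \<le> b i" for i
    by (simp_all add: b_def sum_nonneg)
  have B2: "B\<^sup>2 = (\<Sum>i<n. \<Sum>m<M. (cmod (d i m))\<^sup>2)" and B0: "0 \<le> B"
    by (simp_all add: B_def sum_nonneg b2)
  \<comment> \<open>If \<open>b i = 0\<close> the quotient is 0, which is the right value since then the column vanishes.\<close>
  define v where "v i m = cnj (d i m) / of_real (b i)" for i m
  have bv: "of_real (b i) * v i m = cnj (d i m)" if "m < M" for i m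
  proof (cases "b i = 0")
    case True
    then have "(cmod (d i m))\<^sup>2 = 0"
      using b2[of i] that by (simp add: sum_nonneg_eq_0_iff)
    then show ?thesis by (simp add: True)
  qed (simp add: v_def)
  have v: "(\<Sum>m<M. (cmod (v i m))\<^sup>2) \<le> 1\<^sup>2" for i
    by (cases "b i = 0")
      (simp_all add: v_def norm_divide power_divide b2[symmetric] flip: sum_divide_distrib)
  have "grothendieck_bound (\<lambda>k i. V k i * of_real (b i)) N n (96 * B)"
  proof (rule grothendieck_inequality, rule bilinear_form_le_row_norm)
    fix a :: "nat \<Rightarrow> complex" assume a: "\<And>i. cmod (a i) \<le> 1"
    have "(\<Sum>k<N. cmod (\<Sum>i<n. V k i * of_real (b i) * a i))
        = (\<Sum>k<N. cmod (\<Sum>i<n. V k i * (of_real (b i) * a i)))"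
      by (simp add: mult.assoc)
    also have "\<dots> \<le> sqrt (\<Sum>i<n. (cmod (of_real (b i) * a i))\<^sup>2)"
      by (rule V)
    also have "\<dots> \<le> B"
      unfolding B_def
      using a b0 by (intro real_sqrt_le_mono sum_mono power_mono) (auto simp: norm_mult mult_left_le)
    finally show "(\<Sum>k<N. cmod (\<Sum>i<n. V k i * of_real (b i) * a i)) \<le> B" .
  qed
  then have "cmod (\<Sum>k<N. \<Sum>i<n. V k i * of_real (b i) * (\<Sum>m<M. c k m * v i m)) \<le> 96 * B * C * 1"
    by (rule grothendieck_bound_scaled) (use c C v in auto)
  also have "(\<Sum>k<N. \<Sum>i<n. V k i * of_real (b i) * (\<Sum>m<M. c k m * v i m)) = of_real (B\<^sup>2)"
  proof -
    have "(\<Sum>k<N. \<Sum>i<n. V k i * of_real (b i) * (\<Sum>m<M. c k m * v i m))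
        = (\<Sum>k<N. \<Sum>i<n. \<Sum>m<M. V k i * c k m * cnj (d i m))"
      by (intro sum.cong refl) (simp add: sum_distrib_left bv[symmetric] mult_ac)
    also have "\<dots> = (\<Sum>i<n. \<Sum>k<N. \<Sum>m<M. V k i * c k m * cnj (d i m))"
      by (rule sum.swap)
    also have "\<dots> = (\<Sum>i<n. \<Sum>m<M. \<Sum>k<N. V k i * c k m * cnj (d i m))"
      by (intro sum.cong refl sum.swap)
    also have "\<dots> = (\<Sum>i<n. \<Sum>m<M. d i m * cnj (d i m))"
      by (simp add: d_def sum_distrib_right)
    also have "\<dots> = of_real (B\<^sup>2)"
      by (simp only: B2 of_real_sum complex_norm_square)
    finally show ?thesis .
  qed
  finally have "B * B \<le> 96 * C * B"
    by (simp add: power2_eq_square norm_mult mult_ac)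
  then have "B \<le> 96 * C"
    using B0 C by (cases "B = 0") auto
  then show ?thesis
    using power_mono[OF _ B0, of "96 * C" 2] by (simp only: d_def B2)
qed

text \<open>
  A matrix of norm 1 from \<open>\<ell>\<^sub>\<infinity>\<close> to \<open>\<ell>\<^sub>1\<close> is 2-summing.  Choose signs and weights that turn the
  left-hand side into a value of the form in Grothendieck's inequality.
\<close>

theorem grothendieck_vector_valued:
  fixes V :: "nat \<Rightarrow> nat \<Rightarrow> complex" and a :: "nat \<Rightarrow> nat \<Rightarrow> complex"
  assumes V: "\<And>a. (\<And>i. cmod (a i) \<le> 1) \<Longrightarrow> (\<Sum>k<N. cmod (\<Sum>i<n. V k i * a i)) \<le> 1"
    and a: "\<And>i. i < n \<Longrightarrow> (\<Sum>j<m. (cmod (a j i))\<^sup>2) \<le> A\<^sup>2" and A: "0 < A"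
  shows "(\<Sum>j<m. (\<Sum>k<N. cmod (\<Sum>i<n. V k i * a j i))\<^sup>2) \<le> (96 * A)\<^sup>2"
proof -
  define r where "r j = (\<Sum>k<N. cmod (\<Sum>i<n. V k i * a j i))" for j
  define R where "R = sqrt (\<Sum>j<m. (r j)\<^sup>2)"
  have R2: "R\<^sup>2 = (\<Sum>j<m. (r j)\<^sup>2)" and R0: "0 \<le> R"
    by (simp_all add: R_def sum_nonneg)
  define u where "u k j = of_real (r j) * cnj (sgn (\<Sum>i<n. V k i * a j i))" for k j
  show ?thesis
  proof (cases "R = 0")
    case True
    then show ?thesis using R2 by (simp add: r_def)
  next
    case False
    have "grothendieck_bound V N n (96 * 1)"
      by (intro grothendieck_inequality bilinear_form_le_row_norm V)
    then have "cmod (\<Sum>k<N. \<Sum>i<n. V k i * (\<Sum>j<m. u k j * a j i)) \<le> 96 * 1 * R * A"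
    proof (rule grothendieck_bound_scaled)
      show "(\<Sum>j<m. (cmod (u k j))\<^sup>2) \<le> R\<^sup>2" for k
        unfolding R2
      proof (intro sum_mono power_mono)
        have "0 \<le> r j" for j by (simp add: r_def sum_nonneg)
        then show "cmod (u k j) \<le> r j" for j by (simp add: u_def norm_mult norm_sgn)
      qed simp
    qed (use False R0 A a in auto)
    also have "(\<Sum>k<N. \<Sum>i<n. V k i * (\<Sum>j<m. u k j * a j i)) = of_real (R\<^sup>2)"
    proof -
      have "(\<Sum>k<N. \<Sum>i<n. V k i * (\<Sum>j<m. u k j * a j i))
          = (\<Sum>k<N. \<Sum>i<n. \<Sum>j<m. u k j * (V k i * a j i))"
        by (simp add: sum_distrib_left mult_ac)
      also have "\<dots> = (\<Sum>k<N. \<Sum>j<m. \<Sum>i<n. u k j * (V k i * a j i))"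
        by (intro sum.cong refl sum.swap)
      also have "\<dots> = (\<Sum>j<m. \<Sum>k<N. \<Sum>i<n. u k j * (V k i * a j i))"
        by (rule sum.swap)
      also have "\<dots> = (\<Sum>j<m. \<Sum>k<N. of_real (r j) * of_real (cmod (\<Sum>i<n. V k i * a j i)))"
        by (simp add: u_def mult.assoc cnj_sgn_mult flip: sum_distrib_left)
      also have "\<dots> = of_real (\<Sum>j<m. (r j)\<^sup>2)"
        by (simp add: power2_eq_square r_def flip: sum_distrib_left)
      also have "\<dots> = of_real (R\<^sup>2)" by (simp only: R2)
      finally show ?thesis .
    qed
    finally have "R * R \<le> 96 * A * R"
      by (simp add: power2_eq_square norm_mult mult_ac)
    then have "R \<le> 96 * A"
      using R0 False by auto
    then have "R\<^sup>2 \<le> (96 * A)\<^sup>2"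
      using R0 by (intro power_mono)
    then show ?thesis
      unfolding R2 r_def .
  qed
qed

text \<open>
  Pietsch's domination theorem for the 2-summing operator of \<open>grothendieck_vector_valued\<close>, proved by a
  variational argument instead of a separation theorem.  With \<open>D\<^sub>i = \<Sum>\<^sub>j |a\<^sub>j\<^sub>i|\<^sup>2\<close>, the functional
  \<open>J = \<Sum>\<^sub>j \<parallel>V a\<^sub>j\<parallel>\<^sup>2 - 96\<^sup>2 ln \<Sum>\<^sub>i exp D\<^sub>i\<close> on finite families is at most 0, because
  the first sum is at most \<open>96\<^sup>2 max\<^sub>i D\<^sub>i\<close> and the logarithm is at least \<open>max\<^sub>i D\<^sub>i\<close>.  Adding a small multiple of one more vector to an almost maximal family
  cannot increase \<open>J\<close> much, and this first-order condition is the desired inequality, with weights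
  \<open>q\<^sub>i\<close> given by the gradient of the logarithm; these form a probability vector.  The error is absorbed
  by adding \<open>1 / n\<close> to each weight.
\<close>

theorem pietsch_weights:
  fixes V :: "nat \<Rightarrow> nat \<Rightarrow> complex"
  assumes V: "\<And>a. (\<And>i. cmod (a i) \<le> 1) \<Longrightarrow> (\<Sum>k<N. cmod (\<Sum>i<n. V k i * a i)) \<le> 1"
  shows "\<exists>b. (\<forall>i<n. 0 < b i) \<and> (\<Sum>i<n. (b i)\<^sup>2) \<le> 2 \<and>
    (\<forall>a. (\<Sum>k<N. cmod (\<Sum>i<n. V k i * a i)) \<le> 96 * sqrt (\<Sum>i<n. (b i * cmod (a i))\<^sup>2))"
proof (cases "n = 0")
  case False
  define \<nu> where "\<nu> a = (\<Sum>k<N. cmod (\<Sum>i<n. V k i * a i))" for a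
  define D where "D m a i = (\<Sum>j<m. (cmod (a j i))\<^sup>2)" for m and a :: "nat \<Rightarrow> nat \<Rightarrow> complex" and i
  define J where "J m a = (\<Sum>j<m. (\<nu> (a j))\<^sup>2) - 96\<^sup>2 * ln (\<Sum>i<n. exp (D m a i))" for m a
  have pos: "0 < (\<Sum>i<n. exp (D m a i))" for m a
    using False by (intro sum_pos) auto
  have J0: "J m a \<le> 0" for m a
  proof -
    define E where "E = ln (\<Sum>i<n. exp (D m a i))"
    have DE: "D m a i \<le> E" if "i < n" for i
    proof -
      have "exp (D m a i) \<le> (\<Sum>i<n. exp (D m a i))"
        using that by (intro member_le_sum) auto
      then have "ln (exp (D m a i)) \<le> E"
        unfolding E_def by (subst ln_le_cancel_iff) (use pos in auto)
      then show ?thesis by simp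
    qed
    have E0: "0 \<le> E"
    proof -
      have "0 \<le> D m a 0" by (simp add: D_def sum_nonneg)
      then show ?thesis using DE[of 0] False by linarith
    qed
    have bound: "(\<Sum>j<m. (\<nu> (a j))\<^sup>2) \<le> 96\<^sup>2 * (E + e)" if "e > 0" for e
    proof -
      have "(\<Sum>j<m. (\<Sum>k<N. cmod (\<Sum>i<n. V k i * a j i))\<^sup>2) \<le> (96 * sqrt (E + e))\<^sup>2"
      proof (rule grothendieck_vector_valued[OF V])
        show "(\<Sum>j<m. (cmod (a j i))\<^sup>2) \<le> (sqrt (E + e))\<^sup>2" if "i < n" for i
          using DE[OF that] E0 \<open>e > 0\<close> by (simp add: D_def)
        show "0 < sqrt (E + e)" using E0 that by simp
      qed
      then show ?thesis using E0 that by (simp add: \<nu>_def power_mult_distrib)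
    qed
    have "(\<Sum>j<m. (\<nu> (a j))\<^sup>2) / 96\<^sup>2 \<le> E + e" if "e > 0" for e
      using bound[OF that] by (simp add: divide_le_eq mult.commute)
    then have "(\<Sum>j<m. (\<nu> (a j))\<^sup>2) / 96\<^sup>2 \<le> E"
      by (rule field_le_epsilon)
    then show ?thesis by (simp add: J_def E_def)
  qed
  \<comment> \<open>The step size: the error of the first-order expansion is \<open>2 * 96\<^sup>2 * \<tau>\<close>, half of it from the almost maximal
    family and half from the second-order term, and it has to be at most \<open>96\<^sup>2 / n\<close>.\<close>
  define \<tau> where "\<tau> = 1 / (2 * real n)"
  have \<tau>: "0 < \<tau>" "\<tau> \<le> 1" using False by (auto simp: \<tau>_def)
  define S where "S = (SUP (m, a) \<in> UNIV. J m a)"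
  have bdd: "bdd_above ((\<lambda>(m, a). J m a) ` UNIV)"
    using J0 by (auto intro!: bdd_aboveI[of _ 0])
  have "S - 96\<^sup>2 * \<tau>\<^sup>2 < S" using \<tau> by simp
  then obtain m a where ma: "S - 96\<^sup>2 * \<tau>\<^sup>2 < J m a"
    unfolding S_def by (subst (asm) less_cSUP_iff) (use bdd in auto)
  define q where "q i = exp (D m a i) / (\<Sum>i<n. exp (D m a i))" for i
  have q0: "0 \<le> q i" for i using pos by (simp add: q_def less_imp_le)
  have q1: "(\<Sum>i<n. q i) = 1"
    using pos[of m a] by (simp add: q_def flip: sum_divide_distrib)
  define b where "b i = sqrt (q i + 1 / real n)" for i
  have b2: "(b i)\<^sup>2 = q i + 1 / real n" for i using q0[of i] by (simp add: b_def)
  have unit: "(\<nu> x)\<^sup>2 \<le> 96\<^sup>2 * ((\<Sum>i<n. q i * (cmod (x i))\<^sup>2) + 1 / real n)" if x: "\<And>i. i < n \<Longrightarrow> cmod (x i) \<le> 1" for x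
  proof -
    define a' where "a' j = (if j = m then (\<lambda>i. of_real (sqrt \<tau>) * x i) else a j)" for j
    have \<nu>': "(\<nu> (a' m))\<^sup>2 = \<tau> * (\<nu> x)\<^sup>2"
      using \<tau> by (simp add: a'_def \<nu>_def mult.left_commute norm_mult power_mult_distrib flip: sum_distrib_left)
    have D': "D (Suc m) a' i = D m a i + \<tau> * (cmod (x i))\<^sup>2" for i
      using \<tau> by (simp add: D_def a'_def norm_mult power_mult_distrib)
    have "J (Suc m) a' \<le> S"
      unfolding S_def using cSUP_upper[OF _ bdd, of "(Suc m, a')"] by simp
    then have "J (Suc m) a' - J m a \<le> 96\<^sup>2 * \<tau>\<^sup>2" using ma by linarith
    moreover have "(\<Sum>j<Suc m. (\<nu> (a' j))\<^sup>2) = (\<Sum>j<m. (\<nu> (a j))\<^sup>2) + \<tau> * (\<nu> x)\<^sup>2"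
      by (simp add: \<nu>') (simp add: a'_def)
    ultimately have 1: "\<tau> * (\<nu> x)\<^sup>2 \<le> 96\<^sup>2 * \<tau>\<^sup>2
        + 96\<^sup>2 * (ln (\<Sum>i<n. exp (D (Suc m) a' i)) - ln (\<Sum>i<n. exp (D m a i)))"
      unfolding J_def by (simp add: algebra_simps)
    have "ln (\<Sum>i<n. exp (D (Suc m) a' i)) - ln (\<Sum>i<n. exp (D m a i))
        = ln ((\<Sum>i<n. exp (D (Suc m) a' i)) / (\<Sum>i<n. exp (D m a i)))"
      by (rule ln_divide_pos[OF pos pos, symmetric])
    also have "\<dots> \<le> ln (1 + \<tau> * (\<Sum>i<n. q i * (cmod (x i))\<^sup>2) + \<tau>\<^sup>2)"
    proof -
      have "(\<Sum>i<n. exp (D (Suc m) a' i)) / (\<Sum>i<n. exp (D m a i))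
          = (\<Sum>i<n. q i * exp (\<tau> * (cmod (x i))\<^sup>2))"
        by (simp add: D' q_def exp_add sum_divide_distrib)
      also have "\<dots> \<le> (\<Sum>i<n. q i * (1 + \<tau> * (cmod (x i))\<^sup>2 + \<tau>\<^sup>2))"
      proof (intro sum_mono mult_left_mono q0)
        fix i assume "i \<in> {..<n}"
        then have "(cmod (x i))\<^sup>2 \<le> 1" using x by (simp add: power_le_one)
        then have y: "\<tau> * (cmod (x i))\<^sup>2 \<le> \<tau>" using \<tau> by (simp add: mult_left_le)
        have "exp (\<tau> * (cmod (x i))\<^sup>2) \<le> 1 + \<tau> * (cmod (x i))\<^sup>2 + (\<tau> * (cmod (x i))\<^sup>2)\<^sup>2"
          using \<tau> by (intro exp_bound order_trans[OF y]) auto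
        also have "(\<tau> * (cmod (x i))\<^sup>2)\<^sup>2 \<le> \<tau>\<^sup>2"
          using y \<tau> by (intro power_mono) auto
        finally show "exp (\<tau> * (cmod (x i))\<^sup>2) \<le> 1 + \<tau> * (cmod (x i))\<^sup>2 + \<tau>\<^sup>2" by simp
      qed
      also have "\<dots> = 1 + \<tau> * (\<Sum>i<n. q i * (cmod (x i))\<^sup>2) + \<tau>\<^sup>2"
      proof -
        have "(\<Sum>i<n. q i * (1 + \<tau> * (cmod (x i))\<^sup>2 + \<tau>\<^sup>2))
            = (\<Sum>i<n. q i) + (\<Sum>i<n. \<tau> * (q i * (cmod (x i))\<^sup>2)) + (\<Sum>i<n. q i) * \<tau>\<^sup>2"
          by (simp add: algebra_simps sum.distrib sum_distrib_left sum_distrib_right)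
        then show ?thesis by (simp only: q1 sum_distrib_left mult_1)
      qed
      finally show ?thesis
        using pos by (intro ln_mono) auto
    qed
    also have "\<dots> \<le> \<tau> * (\<Sum>i<n. q i * (cmod (x i))\<^sup>2) + \<tau>\<^sup>2"
    proof -
      have "0 \<le> \<tau> * (\<Sum>i<n. q i * (cmod (x i))\<^sup>2)"
        using \<tau> q0 by (intro mult_nonneg_nonneg sum_nonneg) auto
      then show ?thesis
        using ln_add_one_self_le_self[of "\<tau> * (\<Sum>i<n. q i * (cmod (x i))\<^sup>2) + \<tau>\<^sup>2"]
        by (simp add: add.assoc)
    qed
    finally have "\<tau> * (\<nu> x)\<^sup>2 \<le> 96\<^sup>2 * \<tau>\<^sup>2 + 96\<^sup>2 * (\<tau> * (\<Sum>i<n. q i * (cmod (x i))\<^sup>2) + \<tau>\<^sup>2)"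
      by (intro order_trans[OF 1] add_left_mono mult_left_mono) auto
    also have "\<dots> = \<tau> * (96\<^sup>2 * ((\<Sum>i<n. q i * (cmod (x i))\<^sup>2) + 2 * \<tau>))"
      by (simp add: algebra_simps power2_eq_square)
    finally have "(\<nu> x)\<^sup>2 \<le> 96\<^sup>2 * ((\<Sum>i<n. q i * (cmod (x i))\<^sup>2) + 2 * \<tau>)"
      using \<tau>(1) by (subst (asm) mult_le_cancel_left_pos)
    moreover have "2 * \<tau> = 1 / real n" by (simp add: \<tau>_def)
    ultimately show ?thesis by simp
  qed
  have main: "\<nu> x \<le> 96 * sqrt (\<Sum>i<n. (b i * cmod (x i))\<^sup>2)" for x
  proof -
    define A where "A = Max ((\<lambda>i. cmod (x i)) ` {..<n})"
    have A: "cmod (x i) \<le> A" if "i < n" for i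
      unfolding A_def using that by (intro Max_ge) auto
    have A0: "0 \<le> A" using A[of 0] False norm_ge_zero order_trans by blast
    have "A \<in> (\<lambda>i. cmod (x i)) ` {..<n}"
      unfolding A_def using False by (intro Max_in) auto
    then obtain l where l: "l < n" "cmod (x l) = A" by auto
    show ?thesis
    proof (cases "A = 0")
      case True
      then have "x i = 0" if "i < n" for i using A[OF that] by simp
      then show ?thesis by (simp add: \<nu>_def sum_nonneg)
    next
      case False
      then have A1: "0 < A" using A0 by simp
      define y where "y i = x i / of_real A" for i
      have "\<nu> x = A * \<nu> y"
        using A1 by (simp add: \<nu>_def y_def norm_divide flip: sum_divide_distrib)
      then have "(\<nu> x)\<^sup>2 = A\<^sup>2 * (\<nu> y)\<^sup>2" by (simp add: power_mult_distrib)
      also have "\<dots> \<le> A\<^sup>2 * (96\<^sup>2 * ((\<Sum>i<n. q i * (cmod (y i))\<^sup>2) + 1 / real n))"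
        using A A1 by (intro mult_left_mono unit) (auto simp: y_def norm_divide)
      also have "\<dots> = 96\<^sup>2 * ((\<Sum>i<n. q i * (cmod (x i))\<^sup>2) + 1 / real n * A\<^sup>2)"
        using A1 by (simp add: y_def norm_divide power_divide algebra_simps flip: sum_divide_distrib)
      also have "\<dots> \<le> 96\<^sup>2 * ((\<Sum>i<n. q i * (cmod (x i))\<^sup>2) + (\<Sum>i<n. 1 / real n * (cmod (x i))\<^sup>2))"
        using l member_le_sum[of l "{..<n}" "\<lambda>i. 1 / real n * (cmod (x i))\<^sup>2"] by simp
      also have "\<dots> = (96 * sqrt (\<Sum>i<n. (b i * cmod (x i))\<^sup>2))\<^sup>2"
        by (simp add: power_mult_distrib b2 sum_nonneg distrib_right sum.distrib q0)
      finally show ?thesis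
        by (rule power2_le_imp_le) (simp add: sum_nonneg)
    qed
  qed
  show ?thesis
  proof (intro exI[of _ b] conjI allI impI)
    show "0 < b i" for i using q0[of i] False by (auto simp: b_def intro: add_nonneg_pos)
    show "(\<Sum>i<n. (b i)\<^sup>2) \<le> 2" using False by (simp add: b2 sum.distrib q1)
  qed (use main in \<open>simp add: \<nu>_def\<close>)
qed simp

section \<open>Seminormed spaces and Calderon functions\<close>

text \<open>
  This covers the sum of an interpolation couple without an appeal to the topology of the ambient space,
  on which the definiteness of its norm rests.
\<close>

definition seminormed :: "'a::complex_vector nspace \<Rightarrow> bool" where
  "seminormed E \<longleftrightarrow>
     complex_vector.subspace (pts E) \<and>
     (\<forall>x\<in>pts E. 0 \<le> nrm E x) \<and>
     (\<forall>x\<in>pts E. \<forall>a. nrm E (a *\<^sub>C x) = cmod a * nrm E x) \<and>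
     (\<forall>x\<in>pts E. \<forall>y\<in>pts E. nrm E (x + y) \<le> nrm E x + nrm E y)"

lemma normed_imp_seminormed: "normed_space E \<Longrightarrow> seminormed E"
  by (auto simp: normed_space_def seminormed_def)

lemma banach_imp_seminormed: "banach_space E \<Longrightarrow> seminormed E"
  by (auto simp: banach_space_def normed_imp_seminormed)

context
  fixes E :: "'a::complex_vector nspace"
  assumes E: "seminormed E"
begin

lemma pts_subspace: "complex_vector.subspace (pts E)"
  using E by (simp add: seminormed_def)

lemma pts_zero: "0 \<in> pts E"
  by (rule complex_vector.subspace_0[OF pts_subspace])

lemma pts_add: "x \<in> pts E \<Longrightarrow> y \<in> pts E \<Longrightarrow> x + y \<in> pts E"
  by (rule complex_vector.subspace_add[OF pts_subspace])

lemma pts_diff: "x \<in> pts E \<Longrightarrow> y \<in> pts E \<Longrightarrow> x - y \<in> pts E"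
  by (rule complex_vector.subspace_diff[OF pts_subspace])

lemma pts_scale: "x \<in> pts E \<Longrightarrow> a *\<^sub>C x \<in> pts E"
  by (rule complex_vector.subspace_scale[OF pts_subspace])

lemma pts_sum: "(\<And>i. i \<in> A \<Longrightarrow> x i \<in> pts E) \<Longrightarrow> sum x A \<in> pts E"
  by (rule complex_vector.subspace_sum[OF pts_subspace])

lemma nrm_nonneg: "x \<in> pts E \<Longrightarrow> 0 \<le> nrm E x"
  using E by (simp add: seminormed_def)

lemma nrm_scale: "x \<in> pts E \<Longrightarrow> nrm E (a *\<^sub>C x) = cmod a * nrm E x"
  using E by (simp add: seminormed_def)

lemma nrm_triangle: "x \<in> pts E \<Longrightarrow> y \<in> pts E \<Longrightarrow> nrm E (x + y) \<le> nrm E x + nrm E y"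
  using E by (simp add: seminormed_def)

lemma nrm_zero: "nrm E 0 = 0"
  using nrm_scale[OF pts_zero, of 0] by simp

lemma nrm_triangle_diff:
  assumes "x \<in> pts E" "y \<in> pts E"
  shows "nrm E x \<le> nrm E y + nrm E (x - y)"
  using nrm_triangle[OF assms(2) pts_diff[OF assms]] by simp

lemma nrm_minus_commute:
  assumes "x \<in> pts E" "y \<in> pts E"
  shows "nrm E (x - y) = nrm E (y - x)"
  using nrm_scale[OF pts_diff[OF assms], of "- 1"] by simp

lemma abs_nrm_diff:
  assumes "x \<in> pts E" "y \<in> pts E"
  shows "\<bar>nrm E x - nrm E y\<bar> \<le> nrm E (x - y)"
  using nrm_triangle_diff[OF assms] nrm_triangle_diff[OF assms(2,1)] nrm_minus_commute[OF assms]
  by simp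

lemma nrm_sum:
  assumes "\<And>i. i \<in> A \<Longrightarrow> x i \<in> pts E"
  shows "nrm E (sum x A) \<le> (\<Sum>i\<in>A. nrm E (x i))"
  using assms
proof (induction A rule: infinite_finite_induct)
  case (insert i A)
  then have "nrm E (x i + sum x A) \<le> nrm E (x i) + nrm E (sum x A)"
    by (intro nrm_triangle pts_sum) auto
  then show ?case using insert by force
qed (simp_all add: nrm_zero)

lemma nrm_sum_scale:
  assumes "\<And>i. i \<in> A \<Longrightarrow> x i \<in> pts E"
  shows "nrm E (\<Sum>i\<in>A. c i *\<^sub>C x i) \<le> (\<Sum>i\<in>A. cmod (c i) * nrm E (x i))"
proof -
  have "nrm E (\<Sum>i\<in>A. c i *\<^sub>C x i) \<le> (\<Sum>i\<in>A. nrm E (c i *\<^sub>C x i))"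
    using assms by (intro nrm_sum pts_scale)
  also have "\<dots> = (\<Sum>i\<in>A. cmod (c i) * nrm E (x i))"
    using assms by (intro sum.cong refl nrm_scale)
  finally show ?thesis .
qed

lemma tendsto_nrm:
  assumes "((\<lambda>w. nrm E (f w - x)) \<longlongrightarrow> 0) G" and "eventually (\<lambda>w. f w \<in> pts E) G" and "x \<in> pts E"
  shows "((\<lambda>w. nrm E (f w)) \<longlongrightarrow> nrm E x) G"
proof -
  have "((\<lambda>w. nrm E (f w) - nrm E x) \<longlongrightarrow> 0) G"
  proof (rule Lim_null_comparison[OF _ assms(1)])
    show "\<forall>\<^sub>F w in G. norm (nrm E (f w) - nrm E x) \<le> nrm E (f w - x)"
      using assms(2) by eventually_elim (simp add: abs_nrm_diff assms(3))
  qed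
  then show ?thesis by (simp add: LIM_zero_iff)
qed

lemma tendsto_nrm_zero_add:
  assumes "((\<lambda>w. nrm E (f w)) \<longlongrightarrow> 0) G" and "((\<lambda>w. nrm E (g w)) \<longlongrightarrow> 0) G"
    and "eventually (\<lambda>w. f w \<in> pts E) G" and "eventually (\<lambda>w. g w \<in> pts E) G"
  shows "((\<lambda>w. nrm E (f w + g w)) \<longlongrightarrow> 0) G"
proof (rule Lim_null_comparison)
  show "\<forall>\<^sub>F w in G. norm (nrm E (f w + g w)) \<le> nrm E (f w) + nrm E (g w)"
    using assms(3,4)
    by eventually_elim (simp add: nrm_triangle nrm_nonneg pts_add)
  show "((\<lambda>w. nrm E (f w) + nrm E (g w)) \<longlongrightarrow> 0) G"
    using tendsto_add[OF assms(1,2)] by simp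
qed

lemma tendsto_nrm_zero_scale:
  assumes "((\<lambda>w. cmod (c w) * nrm E (f w)) \<longlongrightarrow> 0) G" and "eventually (\<lambda>w. f w \<in> pts E) G"
  shows "((\<lambda>w. nrm E (c w *\<^sub>C f w)) \<longlongrightarrow> 0) G"
  by (rule Lim_transform_eventually[OF assms(1)])
    (use assms(2) in \<open>eventually_elim, simp add: nrm_scale\<close>)

text \<open>
  Continuity of scalar multiplication, phrased for convergence in the given norm; it yields continuity and
  the product rule for scalar multiples of Calderon functions.
\<close>

lemma tendsto_nrm_scale_diff:
  assumes f: "((\<lambda>w. nrm E (f w - x)) \<longlongrightarrow> 0) G" and ev: "eventually (\<lambda>w. f w \<in> pts E) G"
    and x: "x \<in> pts E" and c: "(c \<longlongrightarrow> a) G"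
  shows "((\<lambda>w. nrm E (c w *\<^sub>C f w - a *\<^sub>C x)) \<longlongrightarrow> 0) G"
proof -
  have 1: "((\<lambda>w. nrm E (c w *\<^sub>C (f w - x))) \<longlongrightarrow> 0) G"
  proof (rule tendsto_nrm_zero_scale)
    show "((\<lambda>w. cmod (c w) * nrm E (f w - x)) \<longlongrightarrow> 0) G"
      using tendsto_mult[OF tendsto_norm[OF c] f] by simp
  qed (use ev x in \<open>auto elim: eventually_mono intro: pts_diff\<close>)
  have 2: "((\<lambda>w. nrm E ((c w - a) *\<^sub>C x)) \<longlongrightarrow> 0) G"
    by (rule tendsto_nrm_zero_scale)
      (use tendsto_mult[OF tendsto_norm_zero[OF LIM_zero[OF c]] tendsto_const[of "nrm E x"]] x in auto)
  have "((\<lambda>w. nrm E (c w *\<^sub>C (f w - x) + (c w - a) *\<^sub>C x)) \<longlongrightarrow> 0) G"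
    by (intro tendsto_nrm_zero_add[OF 1 2] eventually_mono[OF ev] always_eventually allI
        pts_scale pts_diff x)
  then show ?thesis
    by (simp add: complex_vector.scale_right_diff_distrib complex_vector.scale_left_diff_distrib)
qed

lemma tendsto_nrm_add_diff:
  assumes "((\<lambda>w. nrm E (f w - x)) \<longlongrightarrow> 0) G" and "eventually (\<lambda>w. f w \<in> pts E) G" and "x \<in> pts E"
    and "((\<lambda>w. nrm E (g w - y)) \<longlongrightarrow> 0) G" and "eventually (\<lambda>w. g w \<in> pts E) G" and "y \<in> pts E"
  shows "((\<lambda>w. nrm E ((f w + g w) - (x + y))) \<longlongrightarrow> 0) G"
proof -
  have "((\<lambda>w. nrm E ((f w - x) + (g w - y))) \<longlongrightarrow> 0) G"
    by (rule tendsto_nrm_zero_add[OF assms(1,4)])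
      (use assms in \<open>auto elim: eventually_mono intro: pts_diff\<close>)
  then show ?thesis by (simp add: algebra_simps)
qed

end

lemma seminormed_sum_space:
  assumes F0: "seminormed F0" and F1: "seminormed F1"
  shows "seminormed (sum_space F0 F1)"
proof -
  let ?P = "\<lambda>x. {nrm F0 a + nrm F1 b | a b. a \<in> pts F0 \<and> b \<in> pts F1 \<and> x = a + b}"
  have nn: "0 \<le> r" if "r \<in> ?P x" for r x
    using that nrm_nonneg[OF F0] nrm_nonneg[OF F1] by (auto intro: add_nonneg_nonneg)
  have bdd: "bdd_below (?P x)" for x
    by (rule bdd_belowI[of _ 0]) (rule nn)
  have ne: "?P x \<noteq> {}" if "x \<in> pts (sum_space F0 F1)" for x
    using that by (auto simp: sum_space_def)
  have nrm: "nrm (sum_space F0 F1) x = Inf (?P x)" for x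
    by (simp add: sum_space_def)
  have sub: "complex_vector.subspace (pts (sum_space F0 F1))"
    using complex_vector.subspace_sums[OF pts_subspace[OF F0] pts_subspace[OF F1]]
    by (simp add: sum_space_def)
  have le: "nrm (sum_space F0 F1) (a *\<^sub>C x) \<le> cmod a * nrm (sum_space F0 F1) x"
    if x: "x \<in> pts (sum_space F0 F1)" for a x
  proof (cases "a = 0")
    case True
    have "0 \<in> ?P 0"
      using pts_zero[OF F0] pts_zero[OF F1] nrm_zero[OF F0] nrm_zero[OF F1] by force
    then have "Inf (?P 0) \<le> 0" using bdd by (rule cInf_lower)
    then show ?thesis using True by (simp add: nrm)
  next
    case False
    have "nrm (sum_space F0 F1) (a *\<^sub>C x) / cmod a \<le> Inf (?P x)"
    proof (rule cInf_greatest[OF ne[OF x]])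
      fix r assume "r \<in> ?P x"
      then obtain u v where uv: "u \<in> pts F0" "v \<in> pts F1" "x = u + v" "r = nrm F0 u + nrm F1 v"
        by auto
      have "cmod a * r \<in> ?P (a *\<^sub>C x)"
        using uv pts_scale[OF F0, of u a] pts_scale[OF F1, of v a]
          nrm_scale[OF F0, of u a] nrm_scale[OF F1, of v a]
        by (force simp: distrib_left scaleC_add_right)
      then have "nrm (sum_space F0 F1) (a *\<^sub>C x) \<le> cmod a * r"
        unfolding nrm using bdd by (rule cInf_lower)
      then show "nrm (sum_space F0 F1) (a *\<^sub>C x) / cmod a \<le> r"
        using False by (simp add: divide_le_eq mult.commute)
    qed
    then show ?thesis using False by (simp add: nrm divide_le_eq mult.commute)
  qed
  have "nrm (sum_space F0 F1) (a *\<^sub>C x) = cmod a * nrm (sum_space F0 F1) x"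
    if x: "x \<in> pts (sum_space F0 F1)" for a x
  proof (cases "a = 0")
    case True
    have "0 \<le> Inf (?P 0)"
      by (rule cInf_greatest[OF ne nn]) (simp add: complex_vector.subspace_0[OF sub])
    then show ?thesis using le[OF x, of a] True by (simp add: nrm)
  next
    case False
    have "nrm (sum_space F0 F1) (inverse a *\<^sub>C a *\<^sub>C x)
        \<le> cmod (inverse a) * nrm (sum_space F0 F1) (a *\<^sub>C x)"
      by (intro le complex_vector.subspace_scale[OF sub] x)
    then have "cmod a * nrm (sum_space F0 F1) x \<le> nrm (sum_space F0 F1) (a *\<^sub>C x)"
      using False by (simp add: scaleC_scaleC scaleC_one norm_inverse norm_divide field_simps)
    then show ?thesis using le[OF x, of a] by simp
  qed
  moreover have "nrm (sum_space F0 F1) (x + y) \<le> nrm (sum_space F0 F1) x + nrm (sum_space F0 F1) y"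
    if x: "x \<in> pts (sum_space F0 F1)" and y: "y \<in> pts (sum_space F0 F1)" for x y
  proof -
    have *: "nrm (sum_space F0 F1) (x + y) \<le> r + s" if r: "r \<in> ?P x" and s: "s \<in> ?P y" for r s
    proof -
      obtain u v where uv: "u \<in> pts F0" "v \<in> pts F1" "x = u + v" "r = nrm F0 u + nrm F1 v"
        using r by auto
      obtain u' v' where uv': "u' \<in> pts F0" "v' \<in> pts F1" "y = u' + v'" "s = nrm F0 u' + nrm F1 v'"
        using s by auto
      have "nrm F0 (u + u') + nrm F1 (v + v') \<in> ?P (x + y)"
        using uv uv' pts_add[OF F0, of u u'] pts_add[OF F1, of v v'] by (force simp: algebra_simps)
      then have "nrm (sum_space F0 F1) (x + y) \<le> nrm F0 (u + u') + nrm F1 (v + v')"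
        unfolding nrm using bdd by (rule cInf_lower)
      then show ?thesis
        using nrm_triangle[OF F0, of u u'] nrm_triangle[OF F1, of v v'] uv uv' by simp
    qed
    have "nrm (sum_space F0 F1) (x + y) - s \<le> nrm (sum_space F0 F1) x" if s: "s \<in> ?P y" for s
      unfolding nrm[of x] using *[OF _ s] by (intro cInf_greatest[OF ne[OF x]]) (simp add: diff_le_eq)
    then have "nrm (sum_space F0 F1) (x + y) - nrm (sum_space F0 F1) x \<le> nrm (sum_space F0 F1) y"
      unfolding nrm[of y] by (intro cInf_greatest[OF ne[OF y]]) (simp add: algebra_simps)
    then show ?thesis by simp
  qed
  moreover have "0 \<le> nrm (sum_space F0 F1) x" if x: "x \<in> pts (sum_space F0 F1)" for x
    unfolding nrm by (rule cInf_greatest[OF ne[OF x] nn])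
  ultimately show ?thesis
    using sub by (simp add: seminormed_def)
qed

text \<open>
  The supremum in the Calderon norm is taken over the reals, where it carries information only for
  bounded functions.  Continuity and decay at infinity provide the bound.
\<close>

lemma calderon_boundary_bdd:
  assumes E: "seminormed E"
    and pts: "\<And>t. g t \<in> pts E"
    and cont: "\<And>t::real. ((\<lambda>s. nrm E (g s - g t)) \<longlongrightarrow> 0) (at t)"
    and lim: "((\<lambda>t. nrm E (g t)) \<longlongrightarrow> 0) at_infinity"
  shows "bdd_above (range (\<lambda>t. nrm E (g t)))"
proof -
  have c: "continuous_on UNIV (\<lambda>t. nrm E (g t))"
    using tendsto_nrm[OF E cont] pts by (simp add: continuous_on_def)
  obtain R where R: "\<And>t. R \<le> norm t \<Longrightarrow> nrm E (g t) < 1"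
    using order_tendstoD(2)[OF lim, of 1] by (auto simp: eventually_at_infinity)
  have "compact ((\<lambda>t. nrm E (g t)) ` cball 0 R)"
    by (intro compact_continuous_image continuous_on_subset[OF c]) auto
  then obtain B where B: "\<And>t. t \<in> cball 0 R \<Longrightarrow> nrm E (g t) \<le> B"
    using bounded_imp_bdd_above[OF compact_imp_bounded] by (fastforce simp: bdd_above_def)
  have "nrm E (g t) \<le> max B 1" for t
    using R[of t] B[of t] by (cases "R \<le> norm t") (auto simp: dist_norm)
  then show ?thesis by (auto intro: bdd_aboveI[of _ "max B 1"])
qed

lemma strip_boundary: "Complex 0 t \<in> strip" "Complex 1 t \<in> strip"
  by (simp_all add: strip_def)

lemma calderon_add:
  assumes F0: "seminormed F0" and F1: "seminormed F1"
    and f: "f \<in> calderon_functions F0 F1" and g: "g \<in> calderon_functions F0 F1"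
  shows "(\<lambda>z. f z + g z) \<in> calderon_functions F0 F1"
proof -
  let ?S = "sum_space F0 F1"
  note S = seminormed_sum_space[OF F0 F1]
  have ev: "\<forall>\<^sub>F w in at z. f w \<in> pts ?S \<and> g w \<in> pts ?S" if "z \<in> open_strip" for z
  proof -
    have "open open_strip"
      unfolding open_strip_def
      by (intro open_Collect_conj open_Collect_less continuous_intros)
    then have "\<forall>\<^sub>F w in at z. w \<in> open_strip"
      using that by (rule eventually_at_in_open')
    then show ?thesis
      by eventually_elim (use f g in \<open>auto simp: calderon_functions_def open_strip_def strip_def\<close>)
  qed
  show ?thesis
    unfolding calderon_functions_def
  proof (safe, goal_cases)
    case (1 z)
    then show ?case using f g by (intro pts_add[OF S]) (auto simp: calderon_functions_def)
  next
    case 2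
    obtain A where A: "\<And>z. z \<in> strip \<Longrightarrow> nrm ?S (f z) \<le> A"
      using f by (auto simp: calderon_functions_def)
    obtain B where B: "\<And>z. z \<in> strip \<Longrightarrow> nrm ?S (g z) \<le> B"
      using g by (auto simp: calderon_functions_def)
    have "nrm ?S (f z + g z) \<le> A + B" if "z \<in> strip" for z
      using nrm_triangle[OF S, of "f z" "g z"] f g that A[OF that] B[OF that]
      by (force simp: calderon_functions_def)
    then show ?case by blast
  next
    case (3 z)
    then show ?case
      using f g
      by (intro tendsto_nrm_add_diff[OF S]) (auto simp: calderon_functions_def eventually_at_filter)
  next
    case (4 z)
    obtain d where d: "d \<in> pts ?S"
      "((\<lambda>w. nrm ?S (inverse (w - z) *\<^sub>C (f w - f z) - d)) \<longlongrightarrow> 0) (at z)"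
      using f 4 by (auto simp: calderon_functions_def)
    obtain e where e: "e \<in> pts ?S"
      "((\<lambda>w. nrm ?S (inverse (w - z) *\<^sub>C (g w - g z) - e)) \<longlongrightarrow> 0) (at z)"
      using g 4 by (auto simp: calderon_functions_def)
    have z: "f z \<in> pts ?S" "g z \<in> pts ?S"
      using f g 4 by (auto simp: calderon_functions_def open_strip_def strip_def)
    have "((\<lambda>w. nrm ?S (inverse (w - z) *\<^sub>C (f w - f z) + inverse (w - z) *\<^sub>C (g w - g z) - (d + e))) \<longlongrightarrow> 0) (at z)"
      by (rule tendsto_nrm_add_diff[OF S d(2) _ d(1) e(2) _ e(1)])
        (use ev[OF 4] in \<open>eventually_elim, simp add: pts_scale[OF S] pts_diff[OF S] z\<close>)+
    then show ?case
      by (intro bexI[of _ "d + e"] pts_add[OF S] d e)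
        (simp add: algebra_simps flip: scaleC_add_right)
  next
    case (5 t)
    then show ?case using f g by (intro pts_add[OF F0]) (auto simp: calderon_functions_def)
  next
    case (6 t)
    then show ?case using f g by (intro tendsto_nrm_add_diff[OF F0]) (auto simp: calderon_functions_def)
  next
    case 7
    then show ?case using f g by (intro tendsto_nrm_zero_add[OF F0]) (auto simp: calderon_functions_def)
  next
    case (8 t)
    then show ?case using f g by (intro pts_add[OF F1]) (auto simp: calderon_functions_def)
  next
    case (9 t)
    then show ?case using f g by (intro tendsto_nrm_add_diff[OF F1]) (auto simp: calderon_functions_def)
  next
    case 10
    then show ?case using f g by (intro tendsto_nrm_zero_add[OF F1]) (auto simp: calderon_functions_def)
  qed
qed

lemma calderon_zero:
  assumes F0: "seminormed F0" and F1: "seminormed F1"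
  shows "(\<lambda>z. 0) \<in> calderon_functions F0 F1"
  using pts_zero[OF F0] pts_zero[OF F1] pts_zero[OF seminormed_sum_space[OF F0 F1]]
    nrm_zero[OF F0] nrm_zero[OF F1] nrm_zero[OF seminormed_sum_space[OF F0 F1]]
  by (auto simp: calderon_functions_def intro!: exI[of _ 0] bexI[of _ 0])

lemma calderon_sum:
  assumes F0: "seminormed F0" and F1: "seminormed F1"
    and "\<And>i. i \<in> A \<Longrightarrow> f i \<in> calderon_functions F0 F1"
  shows "(\<lambda>z. \<Sum>i\<in>A. f i z) \<in> calderon_functions F0 F1"
  using assms(3)
  by (induction A rule: infinite_finite_induct)
    (simp_all add: calderon_zero[OF F0 F1] calderon_add[OF F0 F1])

text \<open>
  Calderon functions form a module over the bounded analytic functions on the strip.  This is how all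
  new Calderon functions below arise.
\<close>

lemma calderon_scale:
  assumes F0: "seminormed F0" and F1: "seminormed F1"
    and f: "f \<in> calderon_functions F0 F1"
    and c: "continuous_on strip c" and holo: "c holomorphic_on open_strip"
    and bdd: "bounded (c ` strip)"
  shows "(\<lambda>z. c z *\<^sub>C f z) \<in> calderon_functions F0 F1"
proof -
  let ?S = "sum_space F0 F1"
  note S = seminormed_sum_space[OF F0 F1]
  have "open open_strip"
    unfolding open_strip_def by (intro open_Collect_conj open_Collect_less continuous_intros)
  obtain K where K: "\<And>z. z \<in> strip \<Longrightarrow> cmod (c z) \<le> K"
    using bdd by (auto simp: bounded_iff)
  have f_in: "f z \<in> pts ?S" if "z \<in> strip" for z
    using f that by (auto simp: calderon_functions_def)
  have line: "((\<lambda>s. c (Complex x s)) \<longlongrightarrow> c (Complex x t)) (at t)" if "x \<in> {0, 1}" for x t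
  proof -
    have "continuous_on UNIV (\<lambda>s. c (Complex x s))"
      using that
      by (intro continuous_on_compose2[OF c] continuous_intros) (auto simp: strip_def)
    then show ?thesis by (simp add: continuous_on_def)
  qed
  have vanish: "((\<lambda>t. cmod (c (Complex x t)) * h t) \<longlongrightarrow> 0) at_infinity"
    if "(h \<longlongrightarrow> 0) at_infinity" "x \<in> {0, 1}" for x and h :: "real \<Rightarrow> real"
  proof (rule Lim_null_comparison)
    show "\<forall>\<^sub>F t in at_infinity. norm (cmod (c (Complex x t)) * h t) \<le> K * \<bar>h t\<bar>"
      using K that(2) by (intro always_eventually allI) (auto simp: abs_mult strip_def intro!: mult_right_mono)
    show "((\<lambda>t. K * \<bar>h t\<bar>) \<longlongrightarrow> 0) at_infinity"
      using tendsto_mult[OF tendsto_const tendsto_rabs[OF that(1)], of K] by simp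
  qed
  show ?thesis
    unfolding calderon_functions_def
  proof (safe, goal_cases)
    case (1 z)
    then show ?case by (intro pts_scale[OF S] f_in)
  next
    case 2
    obtain A where A: "\<And>z. z \<in> strip \<Longrightarrow> nrm ?S (f z) \<le> A"
      using f by (auto simp: calderon_functions_def)
    have "nrm ?S (c z *\<^sub>C f z) \<le> K * A" if "z \<in> strip" for z
    proof -
      have "0 \<le> K" using K[OF that] norm_ge_zero order_trans by blast
      then show ?thesis
        using A[OF that] K[OF that] nrm_nonneg[OF S f_in[OF that]]
        by (simp add: nrm_scale[OF S f_in[OF that]] mult_mono)
    qed
    then show ?case by blast
  next
    case (3 z)
    then show ?case
      using f c
      by (intro tendsto_nrm_scale_diff[OF S])
        (auto simp: calderon_functions_def eventually_at_filter continuous_on_def)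
  next
    case (4 z)
    then have zs: "z \<in> strip" by (simp add: open_strip_def strip_def)
    obtain d where d: "d \<in> pts ?S"
      "((\<lambda>w. nrm ?S (inverse (w - z) *\<^sub>C (f w - f z) - d)) \<longlongrightarrow> 0) (at z)"
      using f 4 by (auto simp: calderon_functions_def)
    have ev: "\<forall>\<^sub>F w in at z. w \<in> strip"
      using eventually_at_in_open'[OF \<open>open open_strip\<close> 4]
      by eventually_elim (simp add: open_strip_def strip_def)
    obtain e where e: "(c has_field_derivative e) (at z)"
      using holo 4 \<open>open open_strip\<close> by (auto simp: holomorphic_on_open)
    then have ce: "((\<lambda>w. inverse (w - z) * (c w - c z)) \<longlongrightarrow> e) (at z)"
      by (simp add: has_field_derivative_iff divide_inverse mult.commute)
    have cc: "(c \<longlongrightarrow> c z) (at z)"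
      using DERIV_isCont[OF e] by (simp add: isCont_def)
    have m1: "((\<lambda>w. nrm ?S (c w *\<^sub>C (inverse (w - z) *\<^sub>C (f w - f z)) - c z *\<^sub>C d)) \<longlongrightarrow> 0) (at z)"
      by (rule tendsto_nrm_scale_diff[OF S d(2) _ d(1) cc])
        (use ev in \<open>eventually_elim, simp add: pts_scale[OF S] pts_diff[OF S] f_in zs\<close>)
    have m2: "((\<lambda>w. nrm ?S ((inverse (w - z) * (c w - c z)) *\<^sub>C f z - e *\<^sub>C f z)) \<longlongrightarrow> 0) (at z)"
      by (rule tendsto_nrm_scale_diff[OF S _ _ _ ce]) (simp_all add: nrm_zero[OF S] f_in zs)
    have "((\<lambda>w. nrm ?S ((c w *\<^sub>C (inverse (w - z) *\<^sub>C (f w - f z))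
         + (inverse (w - z) * (c w - c z)) *\<^sub>C f z) - (c z *\<^sub>C d + e *\<^sub>C f z))) \<longlongrightarrow> 0) (at z)"
    proof (rule tendsto_nrm_add_diff[OF S m1 _ _ m2])
      show "\<forall>\<^sub>F w in at z. c w *\<^sub>C (inverse (w - z) *\<^sub>C (f w - f z)) \<in> pts ?S"
        using ev by eventually_elim (intro pts_scale[OF S] pts_diff[OF S] f_in zs)
    qed (use zs d in \<open>simp_all add: pts_scale[OF S] f_in\<close>)
    moreover have "c w *\<^sub>C (inverse (w - z) *\<^sub>C (f w - f z)) + (inverse (w - z) * (c w - c z)) *\<^sub>C f z
        = inverse (w - z) *\<^sub>C (c w *\<^sub>C f w - c z *\<^sub>C f z)" for w
      by (simp add: complex_vector.scale_right_diff_distrib complex_vector.scale_left_diff_distrib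
          scaleC_scaleC algebra_simps)
    ultimately show ?case
      by (intro bexI[of _ "c z *\<^sub>C d + e *\<^sub>C f z"] pts_add[OF S] pts_scale[OF S] d f_in zs) simp
  next
    case (5 t)
    then show ?case using f by (intro pts_scale[OF F0]) (auto simp: calderon_functions_def)
  next
    case (6 t)
    then show ?case using f line[of 0]
      by (intro tendsto_nrm_scale_diff[OF F0]) (auto simp: calderon_functions_def)
  next
    case 7
    then show ?case using f
      by (intro tendsto_nrm_zero_scale[OF F0] vanish) (auto simp: calderon_functions_def)
  next
    case (8 t)
    then show ?case using f by (intro pts_scale[OF F1]) (auto simp: calderon_functions_def)
  next
    case (9 t)
    then show ?case using f line[of 1]
      by (intro tendsto_nrm_scale_diff[OF F1]) (auto simp: calderon_functions_def)
  next
    case 10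
    then show ?case using f
      by (intro tendsto_nrm_zero_scale[OF F1] vanish) (auto simp: calderon_functions_def)
  qed
qed

lemma calderon_norm_bounds:
  assumes F0: "seminormed F0" and F1: "seminormed F1" and f: "f \<in> calderon_functions F0 F1"
  shows "nrm F0 (f (Complex 0 t)) \<le> calderon_norm F0 F1 f"
    and "nrm F1 (f (Complex 1 t)) \<le> calderon_norm F0 F1 f"
proof -
  have "bdd_above (range (\<lambda>t. nrm F0 (f (Complex 0 t))))" "bdd_above (range (\<lambda>t. nrm F1 (f (Complex 1 t))))"
    using f by (auto intro!: calderon_boundary_bdd F0 F1 simp: calderon_functions_def)
  then have "nrm F0 (f (Complex 0 t)) \<le> (SUP t. nrm F0 (f (Complex 0 t)))"
    "nrm F1 (f (Complex 1 t)) \<le> (SUP t. nrm F1 (f (Complex 1 t)))"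
    by (auto intro: cSUP_upper)
  then show "nrm F0 (f (Complex 0 t)) \<le> calderon_norm F0 F1 f"
    and "nrm F1 (f (Complex 1 t)) \<le> calderon_norm F0 F1 f"
    by (auto simp: calderon_norm_def)
qed

lemma calderon_norm_nonneg:
  assumes F0: "seminormed F0" and F1: "seminormed F1" and f: "f \<in> calderon_functions F0 F1"
  shows "0 \<le> calderon_norm F0 F1 f"
proof -
  have "0 \<le> nrm F0 (f (Complex 0 0))"
    using f by (intro nrm_nonneg[OF F0]) (auto simp: calderon_functions_def)
  then show ?thesis using calderon_norm_bounds(1)[OF assms, of 0] by linarith
qed

lemma complex_interpolation_nrm_le:
  assumes F0: "seminormed F0" and F1: "seminormed F1" and f: "f \<in> calderon_functions F0 F1"
    and "\<And>t. nrm F0 (f (Complex 0 t)) \<le> C" and "\<And>t. nrm F1 (f (Complex 1 t)) \<le> C"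
  shows "nrm (complex_interpolation F0 F1 \<theta>) (f (of_real \<theta>)) \<le> C"
proof -
  have "nrm (complex_interpolation F0 F1 \<theta>) (f (of_real \<theta>)) \<le> calderon_norm F0 F1 f"
    unfolding complex_interpolation_def
    using calderon_norm_nonneg[OF F0 F1] f
    by (auto intro!: cInf_lower bdd_belowI[of _ 0])
  also have "\<dots> \<le> C"
    unfolding calderon_norm_def using assms(4,5) by (auto intro: cSUP_least)
  finally show ?thesis .
qed

lemma complex_interpolation_lift:
  assumes F0: "seminormed F0" and F1: "seminormed F1"
    and x: "x \<in> pts (complex_interpolation F0 F1 \<theta>)" and C: "nrm (complex_interpolation F0 F1 \<theta>) x < C"
  obtains f where "f \<in> calderon_functions F0 F1" and "f (of_real \<theta>) = x"
    and "\<And>t. nrm F0 (f (Complex 0 t)) \<le> C" and "\<And>t. nrm F1 (f (Complex 1 t)) \<le> C"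
proof -
  let ?A = "{calderon_norm F0 F1 f | f. f \<in> calderon_functions F0 F1 \<and> f (of_real \<theta>) = x}"
  have "?A \<noteq> {}" using x by (auto simp: complex_interpolation_def)
  moreover have "Inf ?A < C" using C by (simp add: complex_interpolation_def)
  ultimately have "\<exists>r\<in>?A. r < C" by (rule cInf_lessD)
  then obtain f where "f \<in> calderon_functions F0 F1" "f (of_real \<theta>) = x" "calderon_norm F0 F1 f < C"
    by auto
  then show ?thesis
    by (intro that[of f])
      (auto intro!: order_trans[OF calderon_norm_bounds(1)[OF F0 F1]]
        order_trans[OF calderon_norm_bounds(2)[OF F0 F1]])
qed

section \<open>Analytic majorants on the strip\<close>

text \<open>
  A telescoping comparison: \<open>\<delta> / q\<^sup>2 \<le> 1 / p - 1 / q\<close> for consecutive points \<open>q = p + \<delta>\<close>.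
\<close>

lemma grid_weights_sum:
  fixes \<delta> :: real
  assumes "0 < \<delta>"
  shows "(\<Sum>j\<in>{- int J..int J}. \<delta> / (1 + \<bar>of_int j\<bar> * \<delta>)\<^sup>2) \<le> \<delta> + 2"
proof -
  have "(\<Sum>j\<in>{- int J..int J}. \<delta> / (1 + \<bar>of_int j\<bar> * \<delta>)\<^sup>2) \<le> \<delta> + 2 * (1 - 1 / (1 + real J * \<delta>))"
  proof (induction J)
    case (Suc J)
    define p q where "p = 1 + real J * \<delta>" and "q = 1 + real (Suc J) * \<delta>"
    have p: "0 < p" and q: "q = p + \<delta>"
      using assms by (auto simp: p_def q_def algebra_simps intro: add_pos_nonneg)
    have "{- int (Suc J)..int (Suc J)} = insert (- int (Suc J)) (insert (int (Suc J)) {- int J..int J})"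
      by auto
    then have "(\<Sum>j\<in>{- int (Suc J)..int (Suc J)}. \<delta> / (1 + \<bar>of_int j\<bar> * \<delta>)\<^sup>2)
        = 2 * (\<delta> / q\<^sup>2) + (\<Sum>j\<in>{- int J..int J}. \<delta> / (1 + \<bar>of_int j\<bar> * \<delta>)\<^sup>2)"
      by (simp add: q_def add.commute)
    also have "\<dots> \<le> 2 * (\<delta> / q\<^sup>2) + (\<delta> + 2 * (1 - 1 / p))"
      using Suc.IH by (simp add: p_def)
    also have "\<delta> / q\<^sup>2 \<le> 1 / p - 1 / q"
    proof -
      have "\<delta> / q\<^sup>2 \<le> \<delta> / (p * q)"
        unfolding power2_eq_square using assms p q by (intro divide_left_mono mult_right_mono) auto
      also have "\<dots> = 1 / p - 1 / q"
        using p q assms by (simp add: field_simps)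
      finally show ?thesis .
    qed
    finally show ?case by (simp add: q_def)
  qed simp
  also have "\<dots> \<le> \<delta> + 2"
    using assms by simp
  finally show ?thesis .
qed

text \<open>
  Uniform continuity together with decay at infinity: above level \<open>\<epsilon>\<close> finitely many samples determine
  the functions up to \<open>\<epsilon>\<close>.
\<close>

lemma uniform_grid:
  fixes h :: "'i \<Rightarrow> real \<Rightarrow> real"
  assumes fin: "finite I" and \<epsilon>: "0 < \<epsilon>"
    and cont: "\<And>i. i \<in> I \<Longrightarrow> continuous_on UNIV (h i)"
    and lim: "\<And>i. i \<in> I \<Longrightarrow> (h i \<longlongrightarrow> 0) at_infinity"
  obtains \<delta> J where "0 < \<delta>" and "\<delta> \<le> 1"
    and "\<And>i t. i \<in> I \<Longrightarrow> \<epsilon> < h i t \<Longrightarrow>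
      \<exists>j\<in>{- int J..int J}. \<bar>t - of_int j * \<delta>\<bar> \<le> \<delta> \<and> h i t \<le> h i (of_int j * \<delta>) + \<epsilon>"
proof -
  have "\<forall>\<^sub>F t in at_infinity. \<forall>i\<in>I. h i t < \<epsilon>"
    using fin order_tendstoD(2)[OF lim \<epsilon>] by (intro eventually_ball_finite) auto
  then obtain R where R: "\<And>t i. R \<le> norm t \<Longrightarrow> i \<in> I \<Longrightarrow> h i t < \<epsilon>"
    by (auto simp: eventually_at_infinity)
  define K where "K = {- \<bar>R\<bar> - 1..\<bar>R\<bar> + 1}"
  have "\<forall>\<^sub>F \<delta> in at_right 0. \<forall>i\<in>I. \<forall>s\<in>K. \<forall>t\<in>K. \<bar>t - s\<bar> \<le> \<delta> \<longrightarrow> h i t \<le> h i s + \<epsilon>"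
  proof (rule eventually_ball_finite[OF fin], rule ballI)
    fix i assume i: "i \<in> I"
    have "uniformly_continuous_on K (h i)"
      unfolding K_def
      by (intro compact_uniformly_continuous continuous_on_subset[OF cont[OF i]]) auto
    then obtain d where d: "0 < d" "\<And>s t. s \<in> K \<Longrightarrow> t \<in> K \<Longrightarrow> dist t s < d \<Longrightarrow> dist (h i t) (h i s) < \<epsilon>"
      using \<epsilon> unfolding uniformly_continuous_on_def by blast
    have "h i t \<le> h i s + \<epsilon>" if "\<delta> < d" "s \<in> K" "t \<in> K" "\<bar>t - s\<bar> \<le> \<delta>" for \<delta> s t
      using d(2)[OF that(2,3)] that by (simp add: dist_real_def)
    then show "\<forall>\<^sub>F \<delta> in at_right 0. \<forall>s\<in>K. \<forall>t\<in>K. \<bar>t - s\<bar> \<le> \<delta> \<longrightarrow> h i t \<le> h i s + \<epsilon>"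
      using d(1) by (auto simp: eventually_at_right_field)
  qed
  moreover have "\<forall>\<^sub>F \<delta> in at_right (0::real). \<delta> \<le> 1"
    unfolding eventually_at_right_field by (rule exI[of _ 1]) simp
  moreover have "\<forall>\<^sub>F \<delta> in at_right (0::real). 0 < \<delta>"
    by (rule eventually_at_right_less)
  ultimately have "\<forall>\<^sub>F \<delta> in at_right (0::real). 0 < \<delta> \<and> \<delta> \<le> 1 \<and>
      (\<forall>i\<in>I. \<forall>s\<in>K. \<forall>t\<in>K. \<bar>t - s\<bar> \<le> \<delta> \<longrightarrow> h i t \<le> h i s + \<epsilon>)"
    by eventually_elim auto
  then obtain \<delta> where \<delta>: "0 < \<delta>" "\<delta> \<le> 1"
    and uc: "\<And>i s t. i \<in> I \<Longrightarrow> s \<in> K \<Longrightarrow> t \<in> K \<Longrightarrow> \<bar>t - s\<bar> \<le> \<delta> \<Longrightarrow> h i t \<le> h i s + \<epsilon>"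
    using eventually_happens[of _ "at_right (0::real)"] trivial_limit_at_right_real by blast
  show thesis
  proof (rule that[OF \<delta>])
    fix i t assume i: "i \<in> I" and t: "\<epsilon> < h i t"
    have tR: "\<bar>t\<bar> < \<bar>R\<bar>" using R[of t i] i t by (cases "R \<le> \<bar>t\<bar>") auto
    define j where "j = \<lfloor>t / \<delta>\<rfloor>"
    have "of_int j \<le> t / \<delta>" "t / \<delta> < of_int j + 1" by (simp_all add: j_def)
    then have j: "of_int j * \<delta> \<le> t" "t < of_int j * \<delta> + \<delta>"
      using \<delta> by (simp_all add: field_simps)
    then have near: "\<bar>t - of_int j * \<delta>\<bar> \<le> \<delta>" by simp
    have "\<bar>t / \<delta>\<bar> \<le> \<bar>R\<bar> / \<delta>" using tR \<delta> by (simp add: divide_right_mono)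
    then have "\<bar>real_of_int j\<bar> \<le> \<bar>R\<bar> / \<delta> + 1"
      using \<open>of_int j \<le> t / \<delta>\<close> \<open>t / \<delta> < of_int j + 1\<close> by linarith
    also have "\<dots> \<le> real (nat \<lceil>\<bar>R\<bar> / \<delta> + 1\<rceil>)" by (rule real_nat_ceiling_ge)
    finally have "j \<in> {- int (nat \<lceil>\<bar>R\<bar> / \<delta> + 1\<rceil>)..int (nat \<lceil>\<bar>R\<bar> / \<delta> + 1\<rceil>)}"
      by (simp only: atLeastAtMost_iff) linarith
    moreover have "h i t \<le> h i (of_int j * \<delta>) + \<epsilon>"
      using tR j \<delta> near by (intro uc i) (auto simp: K_def)
    ultimately show "\<exists>j\<in>{- int (nat \<lceil>\<bar>R\<bar> / \<delta> + 1\<rceil>)..int (nat \<lceil>\<bar>R\<bar> / \<delta> + 1\<rceil>)}.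
        \<bar>t - of_int j * \<delta>\<bar> \<le> \<delta> \<and> h i t \<le> h i (of_int j * \<delta>) + \<epsilon>"
      using near by blast
  qed
qed

text \<open>
  The functions \<open>H\<^sub>i\<close> replace Poisson integrals of the boundary data \<open>h\<^sub>i\<close> on the line \<open>Re z = 1\<close>.
  The kernel \<open>2\<delta> / (\<delta> + 1 - z + i\<tau>)\<close> has positive real part on the strip, its real part is at least 1 at
  the boundary points \<open>1 + it\<close> with \<open>|t - \<tau>| \<le> \<delta>\<close>, and it has size at most \<open>2\<delta> / (1 - \<theta>)\<close> at
  \<open>\<theta>\<close>.  Summing it over a grid of mesh \<open>\<delta>\<close> with the sampled values of \<open>h\<^sub>i\<close> as coefficients dominates \<open>h\<^sub>i\<close>.
  At \<open>\<theta>\<close> this sum need not stay bounded as the grid grows, the kernel decaying only like \<open>1 / |\<tau>|\<close>; the weights \<open>\<omega>\<^sub>j = 1 / (1 + |j\<delta>|)\<^sup>2\<close> make it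
  bounded and cost the factor \<open>(2 + |t|)\<^sup>2\<close>.
\<close>

theorem strip_majorants:
  fixes h :: "nat \<Rightarrow> real \<Rightarrow> real"
  assumes cont: "\<And>i. i < n \<Longrightarrow> continuous_on UNIV (h i)"
    and lim: "\<And>i. i < n \<Longrightarrow> (h i \<longlongrightarrow> 0) at_infinity"
    and nonneg: "\<And>i t. i < n \<Longrightarrow> 0 \<le> h i t"
    and B: "\<And>t. (\<Sum>i<n. h i t) \<le> B"
    and \<theta>: "0 < \<theta>" "\<theta> < 1"
  obtains H :: "nat \<Rightarrow> complex \<Rightarrow> complex" and e :: real
  where "\<And>i. i < n \<Longrightarrow> continuous_on strip (H i)" and "\<And>i. i < n \<Longrightarrow> H i holomorphic_on open_strip"
    and "0 < e" and "\<And>i z. i < n \<Longrightarrow> z \<in> strip \<Longrightarrow> e \<le> Re (H i z)"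
    and "\<And>i t. i < n \<Longrightarrow> h i t \<le> (2 + \<bar>t\<bar>)\<^sup>2 * Re (H i (Complex 1 t))"
    and "(\<Sum>i<n. cmod (H i (of_real \<theta>))) \<le> 1 + 6 * B / (1 - \<theta>)"
proof -
  \<comment> \<open>The constant term of each \<open>H i\<close> keeps its real part away from 0; together they contribute at most 1.\<close>
  define \<epsilon> where "\<epsilon> = 1 / (1 + real n)"
  have \<epsilon>: "0 < \<epsilon>" "real n * \<epsilon> \<le> 1" by (simp_all add: \<epsilon>_def)
  obtain \<delta> J where \<delta>: "0 < \<delta>" "\<delta> \<le> 1"
    and grid: "\<And>i t. i < n \<Longrightarrow> \<epsilon> < h i t \<Longrightarrow>
      \<exists>j\<in>{- int J..int J}. \<bar>t - of_int j * \<delta>\<bar> \<le> \<delta> \<and> h i t \<le> h i (of_int j * \<delta>) + \<epsilon>"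
    using uniform_grid[of "{..<n}" \<epsilon> h] \<epsilon> cont lim by (auto simp: lessThan_iff)
  let ?J = "{- int J..int J}"
  define d where "d j z = of_real (1 + \<delta>) - z + \<i> * of_real (of_int j * \<delta>)" for j :: int and z
  define \<omega> where "\<omega> j = 1 / (1 + \<bar>of_int j\<bar> * \<delta>)\<^sup>2" for j :: int
  define H where "H i z = of_real \<epsilon> + (\<Sum>j\<in>?J. of_real (\<omega> j * h i (of_int j * \<delta>) * (2 * \<delta>)) / d j z)" for i z
  have pos: "0 < 1 + \<bar>of_int j\<bar> * \<delta>" for j :: int
    using \<delta> by (intro add_pos_nonneg) auto
  have \<omega>: "0 < \<omega> j" for j
    unfolding \<omega>_def by (intro divide_pos_pos zero_less_power pos) simp
  have Re_d: "Re (d j z) = 1 + \<delta> - Re z" and Im_d: "Im (d j z) = of_int j * \<delta> - Im z" for j z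
    by (simp_all add: d_def)
  have d0: "d j z \<noteq> 0" if "z \<in> strip" for j z
  proof
    assume "d j z = 0"
    then have "Re (d j z) = 0" by simp
    then show False using that \<delta> by (simp add: Re_d strip_def)
  qed
  have Re_quot: "Re (of_real c / w) = c * (Re w / (cmod w)\<^sup>2)" for c w
    by (simp add: Re_divide cmod_power2)
  have term_nonneg: "0 \<le> Re (of_real (\<omega> j * h i (of_int j * \<delta>) * (2 * \<delta>)) / d j z)"
    if "i < n" "z \<in> strip" for i j z
    unfolding Re_quot using that \<delta> nonneg[OF that(1)] \<omega>[of j]
    by (intro mult_nonneg_nonneg divide_nonneg_nonneg) (auto simp: Re_d strip_def less_imp_le)
  show thesis
  proof (rule that[of H \<epsilon>])
    fix i assume i: "i < n"
    show "continuous_on strip (H i)"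
      unfolding H_def using d0 by (intro continuous_intros) (auto simp: d_def intro!: continuous_intros)
    show "H i holomorphic_on open_strip"
      unfolding H_def using d0
      by (intro holomorphic_intros) (auto simp: d_def open_strip_def strip_def intro!: holomorphic_intros)
    show le: "\<epsilon> \<le> Re (H i z)" if "z \<in> strip" for z
      using term_nonneg[OF i that] by (simp add: H_def sum_nonneg)
    fix t :: real
    have one: "1 \<le> (2 + \<bar>t\<bar>)\<^sup>2" by (simp add: one_le_power)
    show "h i t \<le> (2 + \<bar>t\<bar>)\<^sup>2 * Re (H i (Complex 1 t))"
    proof (cases "h i t \<le> \<epsilon>")
      case True
      also have "\<epsilon> \<le> (2 + \<bar>t\<bar>)\<^sup>2 * \<epsilon>" using one \<epsilon> by simp
      also have "\<dots> \<le> (2 + \<bar>t\<bar>)\<^sup>2 * Re (H i (Complex 1 t))"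
        by (intro mult_left_mono le strip_boundary) auto
      finally show ?thesis .
    next
      case False
      then obtain j where j: "j \<in> ?J" "\<bar>t - of_int j * \<delta>\<bar> \<le> \<delta>" "h i t \<le> h i (of_int j * \<delta>) + \<epsilon>"
        using grid[OF i, of t] by auto
      define hj where "hj = h i (of_int j * \<delta>)"
      have hj: "0 \<le> hj" using nonneg[OF i] by (simp add: hj_def)
      have "(cmod (d j (Complex 1 t)))\<^sup>2 = \<delta>\<^sup>2 + (of_int j * \<delta> - t)\<^sup>2"
        by (simp add: cmod_power2 Re_d Im_d)
      also have "(of_int j * \<delta> - t)\<^sup>2 \<le> \<delta>\<^sup>2"
        using j(2) by (intro abs_le_square_iff[THEN iffD1]) auto
      finally have "(cmod (d j (Complex 1 t)))\<^sup>2 \<le> 2 * \<delta> * \<delta>" by (simp add: power2_eq_square)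
      moreover have "0 < (cmod (d j (Complex 1 t)))\<^sup>2"
        using d0[OF strip_boundary(2)] by simp
      ultimately have kernel: "1 \<le> 2 * \<delta> * (\<delta> / (cmod (d j (Complex 1 t)))\<^sup>2)"
        by (simp add: field_simps)
      have "\<omega> j * hj \<le> \<omega> j * hj * (2 * \<delta> * (\<delta> / (cmod (d j (Complex 1 t)))\<^sup>2))"
        using mult_left_mono[OF kernel, of "\<omega> j * hj"] hj less_imp_le[OF \<omega>[of j]] by simp
      also have "\<dots> = Re (of_real (\<omega> j * hj * (2 * \<delta>)) / d j (Complex 1 t))"
        unfolding Re_quot by (simp add: Re_d)
      also have "\<dots> \<le> Re (\<Sum>j\<in>?J. of_real (\<omega> j * h i (of_int j * \<delta>) * (2 * \<delta>)) / d j (Complex 1 t))"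
        unfolding hj_def Re_sum
        by (rule member_le_sum[OF j(1)]) (use term_nonneg[OF i strip_boundary(2)] in auto)
      finally have ReH: "\<epsilon> + \<omega> j * hj \<le> Re (H i (Complex 1 t))"
        by (simp add: H_def)
      have "\<bar>of_int j\<bar> * \<delta> = \<bar>of_int j * \<delta>\<bar>" using \<delta> by (simp add: abs_mult)
      then have "1 + \<bar>of_int j\<bar> * \<delta> \<le> 2 + \<bar>t\<bar>" using j(2) \<delta> by linarith
      then have "(1 + \<bar>of_int j\<bar> * \<delta>)\<^sup>2 \<le> (2 + \<bar>t\<bar>)\<^sup>2"
        using pos[of j] by (intro power_mono) auto
      then have "1 \<le> (2 + \<bar>t\<bar>)\<^sup>2 * \<omega> j"
        using zero_less_power[OF pos[of j], of 2] by (simp add: \<omega>_def le_divide_eq)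
      then have "hj \<le> (2 + \<bar>t\<bar>)\<^sup>2 * \<omega> j * hj" using hj by (simp add: mult_le_cancel_right1)
      moreover have "\<epsilon> \<le> (2 + \<bar>t\<bar>)\<^sup>2 * \<epsilon>" using one \<epsilon> by simp
      ultimately have "h i t \<le> (2 + \<bar>t\<bar>)\<^sup>2 * (\<epsilon> + \<omega> j * hj)"
        using j(3) by (simp add: hj_def algebra_simps)
      also have "\<dots> \<le> (2 + \<bar>t\<bar>)\<^sup>2 * Re (H i (Complex 1 t))"
        using ReH by (intro mult_left_mono) auto
      finally show ?thesis .
    qed
  next
    have \<theta>s: "of_real \<theta> \<in> strip" using \<theta> by (simp add: strip_def)
    have "cmod (H i (of_real \<theta>)) \<le> \<epsilon> + (\<Sum>j\<in>?J. 2 / (1 - \<theta>) * (\<delta> * \<omega> j) * h i (of_int j * \<delta>))" if i: "i < n" for i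
    proof -
      have "cmod (of_real (\<omega> j * h i (of_int j * \<delta>) * (2 * \<delta>)) / d j (of_real \<theta>))
          \<le> 2 / (1 - \<theta>) * (\<delta> * \<omega> j) * h i (of_int j * \<delta>)" for j
      proof -
        have "1 - \<theta> \<le> Re (d j (of_real \<theta>))" using \<delta> by (simp add: Re_d)
        also have "\<dots> \<le> cmod (d j (of_real \<theta>))" by (rule complex_Re_le_cmod)
        finally have *: "1 - \<theta> \<le> cmod (d j (of_real \<theta>))" .
        have "cmod (of_real (\<omega> j * h i (of_int j * \<delta>) * (2 * \<delta>)) / d j (of_real \<theta>))
            = (\<omega> j * h i (of_int j * \<delta>) * (2 * \<delta>)) / cmod (d j (of_real \<theta>))"
          using \<omega>[of j] nonneg[OF i] \<delta> by (simp add: norm_divide norm_mult)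
        also have "\<dots> \<le> (\<omega> j * h i (of_int j * \<delta>) * (2 * \<delta>)) / (1 - \<theta>)"
          using * \<theta> \<omega>[of j] nonneg[OF i] \<delta> by (intro divide_left_mono mult_nonneg_nonneg mult_pos_pos) auto
        finally show ?thesis by (simp add: algebra_simps)
      qed
      then show ?thesis
        unfolding H_def
        using \<epsilon> by (intro order_trans[OF norm_triangle_ineq] add_mono sum_norm_le) auto
    qed
    then have "(\<Sum>i<n. cmod (H i (of_real \<theta>)))
        \<le> (\<Sum>i<n. \<epsilon> + (\<Sum>j\<in>?J. 2 / (1 - \<theta>) * (\<delta> * \<omega> j) * h i (of_int j * \<delta>)))"
      by (intro sum_mono) auto
    also have "\<dots> = real n * \<epsilon> + (\<Sum>j\<in>?J. 2 / (1 - \<theta>) * (\<delta> * \<omega> j) * (\<Sum>i<n. h i (of_int j * \<delta>)))"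
      unfolding sum.distrib by (subst sum.swap) (simp add: sum_distrib_left)
    also have "\<dots> \<le> 1 + (\<Sum>j\<in>?J. 2 / (1 - \<theta>) * (\<delta> * \<omega> j) * B)"
      using \<epsilon> \<delta> \<theta> by (intro add_mono sum_mono mult_left_mono B mult_nonneg_nonneg) (auto simp: \<omega> less_imp_le)
    also have "\<dots> = 1 + 2 / (1 - \<theta>) * B * (\<Sum>j\<in>?J. \<delta> / (1 + \<bar>of_int j\<bar> * \<delta>)\<^sup>2)"
      by (simp add: \<omega>_def sum_distrib_left mult_ac)
    also have "\<dots> \<le> 1 + 2 / (1 - \<theta>) * B * 3"
    proof -
      have "0 \<le> B" using order_trans[OF sum_nonneg B[of 0]] nonneg by auto
      moreover have "(\<Sum>j\<in>?J. \<delta> / (1 + \<bar>of_int j\<bar> * \<delta>)\<^sup>2) \<le> 3"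
        using grid_weights_sum[OF \<delta>(1), of J] \<delta> by linarith
      ultimately show ?thesis using \<theta> by (intro add_left_mono mult_left_mono) auto
    qed
    finally show "(\<Sum>i<n. cmod (H i (of_real \<theta>))) \<le> 1 + 6 * B / (1 - \<theta>)"
      by (simp add: mult_ac)
  qed (rule \<epsilon>)
qed

section \<open>Coordinates in Hilbert space\<close>

text \<open>
  The inner product that the definition of a Hilbert space asserts to exist, as a predicate, so that it can
  be fixed once.
\<close>

definition inner_product_on :: "'a::complex_vector nspace \<Rightarrow> ('a \<Rightarrow> 'a \<Rightarrow> complex) \<Rightarrow> bool" where
  "inner_product_on H ip \<longleftrightarrow>
     (\<forall>x\<in>pts H. \<forall>y\<in>pts H. \<forall>z\<in>pts H. ip (x + y) z = ip x z + ip y z) \<and>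
     (\<forall>x\<in>pts H. \<forall>y\<in>pts H. \<forall>a. ip (a *\<^sub>C x) y = a * ip x y) \<and>
     (\<forall>x\<in>pts H. \<forall>y\<in>pts H. ip y x = cnj (ip x y)) \<and>
     (\<forall>x\<in>pts H. ip x x = complex_of_real ((nrm H x)\<^sup>2))"

lemma ip_sum_left:
  assumes H: "seminormed H" and ip: "inner_product_on H ip"
    and "\<And>m. m \<in> A \<Longrightarrow> e m \<in> pts H" and y: "y \<in> pts H"
  shows "ip (\<Sum>m\<in>A. c m *\<^sub>C e m) y = (\<Sum>m\<in>A. c m * ip (e m) y)"
proof -
  have ip0: "ip 0 y = 0"
  proof -
    have "ip (0 *\<^sub>C 0) y = 0 * ip 0 y"
      using ip pts_zero[OF H] y unfolding inner_product_on_def by blast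
    then show ?thesis by simp
  qed
  show ?thesis
    using assms(3)
  proof (induction A rule: infinite_finite_induct)
    case (insert m A)
    then have "ip (c m *\<^sub>C e m + (\<Sum>m\<in>A. c m *\<^sub>C e m)) y = ip (c m *\<^sub>C e m) y + ip (\<Sum>m\<in>A. c m *\<^sub>C e m) y"
      using ip y pts_scale[OF H] pts_sum[OF H, of A "\<lambda>m. c m *\<^sub>C e m"]
      unfolding inner_product_on_def by blast
    moreover have "ip (c m *\<^sub>C e m) y = c m * ip (e m) y"
      using ip y insert.prems unfolding inner_product_on_def by blast
    ultimately show ?case using insert by simp
  qed (simp_all add: ip0)
qed

lemma ip_sum_right:
  assumes H: "seminormed H" and ip: "inner_product_on H ip"
    and e: "\<And>m. m \<in> A \<Longrightarrow> e m \<in> pts H" and y: "y \<in> pts H"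
  shows "ip y (\<Sum>m\<in>A. c m *\<^sub>C e m) = (\<Sum>m\<in>A. cnj (c m) * ip y (e m))"
proof -
  have swap: "ip y x = cnj (ip x y)" if "x \<in> pts H" for x
    using ip y that unfolding inner_product_on_def by blast
  have "(\<Sum>m\<in>A. c m *\<^sub>C e m) \<in> pts H"
    using e by (intro pts_sum[OF H] pts_scale[OF H])
  then have "ip y (\<Sum>m\<in>A. c m *\<^sub>C e m) = cnj (ip (\<Sum>m\<in>A. c m *\<^sub>C e m) y)"
    by (rule swap)
  also have "\<dots> = (\<Sum>m\<in>A. cnj (c m) * ip y (e m))"
    using e by (subst ip_sum_left[OF H ip _ y]) (auto simp: swap)
  finally show ?thesis .
qed

text \<open>
  Gram--Schmidt, one vector at a time.  A vector that already lies in the span adds no basis vector.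
\<close>

lemma orthonormal_expansion:
  fixes N :: nat
  assumes H: "normed_space H" and ip: "inner_product_on H ip"
    and "\<And>k. k < N \<Longrightarrow> h k \<in> pts H"
  shows "\<exists>M e c. (\<forall>m<M. e m \<in> pts H) \<and> (\<forall>m<M. \<forall>l<M. ip (e m) (e l) = (if m = l then 1 else 0)) \<and>
    (\<forall>k<N. h k = (\<Sum>m<(M::nat). c k m *\<^sub>C e m))"
  using assms(3)
proof (induction N)
  case 0
  show ?case by (rule exI[of _ 0]) simp
next
  case (Suc N)
  note S = normed_imp_seminormed[OF H]
  obtain M e c where e: "\<And>m. m < M \<Longrightarrow> e m \<in> pts H"
    and orth: "\<And>m l. m < M \<Longrightarrow> l < M \<Longrightarrow> ip (e m) (e l) = (if m = l then 1 else 0)"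
    and c: "\<And>k. k < N \<Longrightarrow> h k = (\<Sum>m<(M::nat). c k m *\<^sub>C e m)"
    using Suc.IH Suc.prems by (metis less_SucI)
  have hN: "h N \<in> pts H" using Suc.prems by simp
  define p where "p m = ip (h N) (e m)" for m
  define r where "r = h N - (\<Sum>m<M. p m *\<^sub>C e m)"
  have proj: "(\<Sum>m<M. p m *\<^sub>C e m) \<in> pts H" using e by (intro pts_sum[OF S] pts_scale[OF S]) auto
  then have r: "r \<in> pts H" unfolding r_def using hN by (intro pts_diff[OF S])
  have r_orth: "ip r (e l) = 0" if l: "l < M" for l
  proof -
    have "r + (\<Sum>m<M. p m *\<^sub>C e m) = h N" by (simp add: r_def)
    then have "ip (h N) (e l) = ip r (e l) + ip (\<Sum>m<M. p m *\<^sub>C e m) (e l)"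
      using ip r proj e[OF l] unfolding inner_product_on_def by metis
    also have "ip (\<Sum>m<M. p m *\<^sub>C e m) (e l) = (\<Sum>m<M. p m * ip (e m) (e l))"
      using e l by (intro ip_sum_left[OF S ip]) auto
    also have "\<dots> = (\<Sum>m<M. if m = l then p l else 0)"
      using l by (intro sum.cong) (auto simp: orth)
    also have "\<dots> = p l" using l by simp
    finally show ?thesis by (simp add: p_def)
  qed
  show ?case
  proof (cases "r = 0")
    case True
    then have "h N = (\<Sum>m<M. p m *\<^sub>C e m)" by (simp add: r_def)
    then show ?thesis
      using e orth c
      by (intro exI[of _ M] exI[of _ e] exI[of _ "\<lambda>k. if k = N then p else c k"])
        (auto simp: less_Suc_eq)
  next
    case False
    have "nrm H r \<noteq> 0" using H r False by (simp add: normed_space_def)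
    then have nr: "0 < nrm H r" using nrm_nonneg[OF S r] by simp
    define u where "u = inverse (of_real (nrm H r)) *\<^sub>C r"
    define e' where "e' m = (if m = M then u else e m)" for m
    define c' where "c' k m = (if k = N then (if m = M then of_real (nrm H r) else p m)
      else (if m = M then 0 else c k m))" for k m
    have u: "u \<in> pts H" unfolding u_def by (intro pts_scale[OF S] r)
    have lin: "ip (a *\<^sub>C x) y = a * ip x y" and sw: "ip y x = cnj (ip x y)"
      if "x \<in> pts H" "y \<in> pts H" for a x y
      using ip that unfolding inner_product_on_def by blast+
    have u_orth: "ip u (e l) = 0" if "l < M" for l
      unfolding u_def using lin[OF r e[OF that]] r_orth[OF that] by simp
    have "ip u u = 1"
    proof -
      have "ip u u = inverse (of_real (nrm H r)) * cnj (ip u r)"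
        unfolding u_def using lin[OF r u] sw[OF u r] by (simp add: u_def)
      also have "ip u r = inverse (of_real (nrm H r)) * ip r r"
        unfolding u_def by (rule lin[OF r r])
      also have "ip r r = of_real ((nrm H r)\<^sup>2)"
        using ip r unfolding inner_product_on_def by blast
      finally show ?thesis using nr by (simp add: power2_eq_square field_simps)
    qed
    moreover have "ip (e l) u = 0" if "l < M" for l
      using sw[OF u e[OF that]] u_orth[OF that] by simp
    ultimately have orth': "ip (e' m) (e' l) = (if m = l then 1 else 0)" if "m < Suc M" "l < Suc M" for m l
      using that orth u_orth by (auto simp: e'_def less_Suc_eq)
    have "h k = (\<Sum>m<Suc M. c' k m *\<^sub>C e' m)" if "k < Suc N" for k
    proof (cases "k = N")
      case True
      have "of_real (nrm H r) *\<^sub>C u = r"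
        using nr by (simp add: u_def scaleC_scaleC scaleC_one)
      then have "h N = of_real (nrm H r) *\<^sub>C u + (\<Sum>m<M. p m *\<^sub>C e m)"
        by (simp add: r_def)
      then show ?thesis using True by (simp add: c'_def e'_def add.commute)
    next
      case False
      then show ?thesis using that c[of k] by (simp add: c'_def e'_def)
    qed
    then show ?thesis
      using e u orth'
      by (intro exI[of _ "Suc M"] exI[of _ e'] exI[of _ c']) (auto simp: e'_def)
  qed
qed

lemma hilbert_coordinates:
  fixes N :: nat
  assumes H: "hilbert_space H" and h: "\<And>k. k < N \<Longrightarrow> h k \<in> pts H"
  obtains M and c :: "nat \<Rightarrow> nat \<Rightarrow> complex"
  where "\<And>a. (nrm H (\<Sum>k<N. a k *\<^sub>C h k))\<^sup>2 = (\<Sum>m<M. (cmod (\<Sum>k<N. a k * c k m))\<^sup>2)"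
proof -
  obtain ip where ip: "inner_product_on H ip"
    using H unfolding hilbert_space_def inner_product_on_def by blast
  have N: "normed_space H" using H by (simp add: hilbert_space_def banach_space_def)
  note S = normed_imp_seminormed[OF N]
  obtain M e c where e: "\<And>m. m < M \<Longrightarrow> e m \<in> pts H"
    and orth: "\<And>m l. m < M \<Longrightarrow> l < M \<Longrightarrow> ip (e m) (e l) = (if m = l then 1 else 0)"
    and c: "\<And>k. k < N \<Longrightarrow> h k = (\<Sum>m<(M::nat). c k m *\<^sub>C e m)"
    using orthonormal_expansion[OF N ip, of N h] h by blast
  show thesis
  proof (rule that)
    fix a :: "nat \<Rightarrow> complex"
    define b where "b m = (\<Sum>k<N. a k * c k m)" for m
    have "(\<Sum>k<N. a k *\<^sub>C h k) = (\<Sum>k<N. \<Sum>m<M. (a k * c k m) *\<^sub>C e m)"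
      by (simp add: c complex_vector.scale_sum_right scaleC_scaleC)
    also have "\<dots> = (\<Sum>m<M. b m *\<^sub>C e m)"
      by (subst sum.swap) (simp add: b_def complex_vector.scale_sum_left)
    finally have eq: "(\<Sum>k<N. a k *\<^sub>C h k) = (\<Sum>m<M. b m *\<^sub>C e m)" .
    have x: "(\<Sum>m<M. b m *\<^sub>C e m) \<in> pts H" using e by (intro pts_sum[OF S] pts_scale[OF S]) auto
    have "of_real ((nrm H (\<Sum>m<M. b m *\<^sub>C e m))\<^sup>2) = ip (\<Sum>m<M. b m *\<^sub>C e m) (\<Sum>m<M. b m *\<^sub>C e m)"
      using ip x unfolding inner_product_on_def by metis
    also have "\<dots> = (\<Sum>m<M. b m * ip (e m) (\<Sum>m<M. b m *\<^sub>C e m))"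
      using e x by (intro ip_sum_left[OF S ip]) auto
    also have "\<dots> = (\<Sum>m<M. b m * (\<Sum>l<M. cnj (b l) * ip (e m) (e l)))"
      using e by (intro sum.cong refl arg_cong2[where f = "(*)"] ip_sum_right[OF S ip]) auto
    also have "\<dots> = (\<Sum>m<M. b m * (\<Sum>l<M. if l = m then cnj (b m) else 0))"
      by (intro sum.cong refl arg_cong2[where f = "(*)"]) (auto simp: orth)
    also have "\<dots> = of_real (\<Sum>m<M. (cmod (b m))\<^sup>2)"
      by (simp add: complex_norm_square del: of_real_power)
    finally show "(nrm H (\<Sum>k<N. a k *\<^sub>C h k))\<^sup>2 = (\<Sum>m<M. (cmod (\<Sum>k<N. a k * c k m))\<^sup>2)"
      unfolding eq b_def[symmetric] by (simp only: of_real_eq_iff)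
  qed
qed

text \<open>
  Only finitely many vectors are involved, so the coordinate version \<open>hilbert_schmidt_bound\<close> applies.
\<close>

theorem hilbert_schmidt_bound_in_space:
  fixes V :: "nat \<Rightarrow> nat \<Rightarrow> complex"
  assumes H: "hilbert_space H" and h: "\<And>k. k < N \<Longrightarrow> h k \<in> pts H"
    and C: "0 < C" "\<And>k. k < N \<Longrightarrow> nrm H (h k) \<le> C"
    and V: "\<And>a. (\<Sum>k<N. cmod (\<Sum>i<n. V k i * a i)) \<le> sqrt (\<Sum>i<n. (cmod (a i))\<^sup>2)"
  shows "(\<Sum>i<n. (nrm H (\<Sum>k<N. V k i *\<^sub>C h k))\<^sup>2) \<le> (96 * C)\<^sup>2"
proof -
  have S: "seminormed H" using H by (simp add: hilbert_space_def banach_imp_seminormed)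
  obtain M and c :: "nat \<Rightarrow> nat \<Rightarrow> complex"
    where c: "\<And>a. (nrm H (\<Sum>k<N. a k *\<^sub>C h k))\<^sup>2 = (\<Sum>m<M. (cmod (\<Sum>k<N. a k * c k m))\<^sup>2)"
    using hilbert_coordinates[of H N h] H h by blast
  have "(\<Sum>m<M. (cmod (c k m))\<^sup>2) \<le> C\<^sup>2" if k: "k < N" for k
  proof -
    define a where "a l = (if l = k then 1 else 0 :: complex)" for l
    have "(\<Sum>l<N. a l * c l m) = (\<Sum>l<N. if l = k then c k m else 0)" for m
      by (intro sum.cong) (auto simp: a_def)
    then have "(\<Sum>l<N. a l * c l m) = c k m" for m using k by simp
    moreover have "(\<Sum>l<N. a l *\<^sub>C h l) = (\<Sum>l<N. if l = k then h k else 0)"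
      by (intro sum.cong) (auto simp: a_def scaleC_one)
    then have "(\<Sum>l<N. a l *\<^sub>C h l) = h k" using k by simp
    ultimately have "(nrm H (h k))\<^sup>2 = (\<Sum>m<M. (cmod (c k m))\<^sup>2)"
      using c[of a] by simp
    then show ?thesis
      using power_mono[OF C(2)[OF k] nrm_nonneg[OF S h[OF k]], of 2] by simp
  qed
  then show ?thesis
    unfolding c using hilbert_schmidt_bound[where c = c and M = M, OF V _ C(1)] by simp
qed

section \<open>Factorization of interpolated families\<close>

lemma calderon_boundary_values:
  assumes F0: "seminormed F0" and F1: "seminormed F1" and f: "f \<in> calderon_functions F0 F1"
  shows "f (Complex 0 t) \<in> pts F0" and "f (Complex 1 t) \<in> pts F1"
    and "continuous_on UNIV (\<lambda>t. nrm F1 (f (Complex 1 t)))"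
    and "((\<lambda>t. nrm F1 (f (Complex 1 t))) \<longlongrightarrow> 0) at_infinity"
proof -
  show "f (Complex 0 t) \<in> pts F0" and pts: "f (Complex 1 t) \<in> pts F1" for t
    using f by (auto simp: calderon_functions_def)
  have "((\<lambda>s. nrm F1 (f (Complex 1 s) - f (Complex 1 t))) \<longlongrightarrow> 0) (at t)" for t
    using f by (auto simp: calderon_functions_def)
  from tendsto_nrm[OF F1 this] show "continuous_on UNIV (\<lambda>t. nrm F1 (f (Complex 1 t)))"
    using pts by (simp add: continuous_on_def)
  show "((\<lambda>t. nrm F1 (f (Complex 1 t))) \<longlongrightarrow> 0) at_infinity"
    using f by (auto simp: calderon_functions_def)
qed

lemma abs_minus_square_le: "\<bar>t\<bar> - t\<^sup>2 \<le> (1::real)"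
  and double_abs_minus_square_le: "2 * \<bar>t\<bar> - t\<^sup>2 \<le> (1::real)"
proof -
  have "(\<bar>t\<bar> - 1)\<^sup>2 = t\<^sup>2 - 2 * \<bar>t\<bar> + 1" by (simp add: power2_diff)
  then show "2 * \<bar>t\<bar> - t\<^sup>2 \<le> (1::real)" using zero_le_power2[of "\<bar>t\<bar> - 1"] by linarith
  then show "\<bar>t\<bar> - t\<^sup>2 \<le> (1::real)" by linarith
qed

text \<open>
  The scalar factor of \<open>G\<^sub>i\<close> in the Calderon function that witnesses the factorization: the quotient of
  \<open>sgn a |a|\<close> to the power \<open>(1 + z) / (1 + \<theta>)\<close> by \<open>H\<close> to the power \<open>z / 2\<close>, times
  \<open>exp (z\<^sup>2 - \<theta>\<^sup>2)\<close>.  Written as one exponential it is visibly analytic; \<open>sgn a\<close> covers the case \<open>a = 0\<close>.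
\<close>

definition weight_function :: "real \<Rightarrow> (complex \<Rightarrow> complex) \<Rightarrow> complex \<Rightarrow> complex \<Rightarrow> complex" where
  "weight_function \<theta> H a z =
     sgn a * exp (z\<^sup>2 - of_real (\<theta>\<^sup>2) + (1 + z) / of_real (1 + \<theta>) * of_real (ln (cmod a))
       - z / 2 * Ln (H z))"

lemma weight_function_at:
  assumes "0 < \<theta>"
  shows "weight_function \<theta> H a (of_real \<theta>) = a / exp (of_real \<theta> / 2 * Ln (H (of_real \<theta>)))"
proof (cases "a = 0")
  case False
  have "complex_of_real (1 + \<theta>) \<noteq> 0" using assms by (simp only: of_real_eq_0_iff)
  then have "(1 + complex_of_real \<theta>) / of_real (1 + \<theta>) = 1" by simp
  then have "weight_function \<theta> H a (of_real \<theta>) = sgn a * of_real (exp (ln (cmod a)))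
      / exp (of_real \<theta> / 2 * Ln (H (of_real \<theta>)))"
    by (simp add: weight_function_def exp_diff exp_of_real)
  also have "sgn a * of_real (exp (ln (cmod a))) = a"
    using False by (simp add: sgn_eq)
  finally show ?thesis .
qed (simp add: weight_function_def)

text \<open>
  The argument of \<open>H\<close> is at most \<open>\<pi> / 2 \<le> 2\<close> in absolute value, so taking the power \<open>z / 2\<close> costs at most
  the factor \<open>exp |Im z|\<close>, which the Gaussian factor controls.
\<close>

lemma cmod_weight_function_le:
  assumes H: "0 < Re (H z)" and \<theta>: "0 < \<theta>" and a: "a \<noteq> 0"
  shows "cmod (weight_function \<theta> H a z) \<le>
    exp ((Re z)\<^sup>2 - (Im z)\<^sup>2 + \<bar>Im z\<bar>) * cmod a powr ((1 + Re z) / (1 + \<theta>))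
      * cmod (H z) powr (- (Re z / 2))"
proof -
  have Hz: "H z \<noteq> 0" using H by auto
  have "\<bar>Im (Ln (H z))\<bar> \<le> 2"
    using Re_Ln_pos_lt_imp[OF H] pi_half_less_two by linarith
  then have "\<bar>Im z * Im (Ln (H z))\<bar> \<le> \<bar>Im z\<bar> * 2"
    unfolding abs_mult by (intro mult_left_mono) auto
  then have im: "Im z * Im (Ln (H z)) / 2 \<le> \<bar>Im z\<bar>" by linarith
  have "Re (z\<^sup>2 - of_real (\<theta>\<^sup>2) + (1 + z) / of_real (1 + \<theta>) * of_real (ln (cmod a)) - z / 2 * Ln (H z))
      = (Re z)\<^sup>2 - (Im z)\<^sup>2 - \<theta>\<^sup>2 + (1 + Re z) / (1 + \<theta>) * ln (cmod a)
        - (Re z / 2) * ln (cmod (H z)) + Im z * Im (Ln (H z)) / 2"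
  proof -
    have "Re (z / 2 * Ln (H z)) = Re z / 2 * ln (cmod (H z)) - Im z * Im (Ln (H z)) / 2"
      using Hz by simp
    moreover have "Re ((1 + z) / of_real (1 + \<theta>) * of_real (ln (cmod a)))
        = (1 + Re z) / (1 + \<theta>) * ln (cmod a)"
    proof -
      have "Re (w * of_real r) = Re w * r" for w r by simp
      then show ?thesis by (simp only: Re_divide_of_real plus_complex.simps one_complex.simps)
    qed
    moreover have "Re (z\<^sup>2 - of_real (\<theta>\<^sup>2)) = (Re z)\<^sup>2 - (Im z)\<^sup>2 - \<theta>\<^sup>2"
      by (simp only: minus_complex.simps Re_power2 Re_complex_of_real)
    ultimately show ?thesis
      unfolding minus_complex.simps plus_complex.simps by linarith
  qed
  also have "\<dots> \<le> ((Re z)\<^sup>2 - (Im z)\<^sup>2 + \<bar>Im z\<bar>) + (1 + Re z) / (1 + \<theta>) * ln (cmod a)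
        + - (Re z / 2) * ln (cmod (H z))"
    using im zero_le_power2[of \<theta>] by linarith
  finally show ?thesis
    using a Hz by (simp add: weight_function_def norm_mult norm_sgn powr_def flip: exp_add)
qed

lemma weight_function_regular:
  assumes c: "continuous_on strip H" and holo: "H holomorphic_on open_strip"
    and e: "0 < e" "\<And>z. z \<in> strip \<Longrightarrow> e \<le> Re (H z)" and \<theta>: "0 < \<theta>"
  shows "continuous_on strip (weight_function \<theta> H a)"
    and "weight_function \<theta> H a holomorphic_on open_strip"
    and "bounded (weight_function \<theta> H a ` strip)"
proof -
  have pos: "0 < Re (H z)" if "z \<in> strip" for z using e(1) e(2)[OF that] by linarith
  have nn: "H z \<notin> \<real>\<^sub>\<le>\<^sub>0" if "z \<in> strip" for z
    using pos[OF that] by (auto simp: complex_nonpos_Reals_iff)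
  have sub: "open_strip \<subseteq> strip" by (auto simp: open_strip_def strip_def)
  have \<theta>1: "1 + complex_of_real \<theta> \<noteq> 0"
    using \<theta> by (simp add: complex_eq_iff)
  show "continuous_on strip (weight_function \<theta> H a)"
    unfolding weight_function_def using nn \<theta>1 by (intro continuous_intros c) auto
  show "weight_function \<theta> H a holomorphic_on open_strip"
    unfolding weight_function_def using nn sub \<theta>1
    by (intro holomorphic_intros holo) auto
  have prod_le: "x * y \<le> c * w" if "0 \<le> x" "x \<le> c" "y \<le> w" "0 \<le> w" for x y c w :: real
    using mult_left_mono[OF that(3,1)] mult_right_mono[OF that(2,4)] by linarith
  have "cmod (weight_function \<theta> H a z) \<le> exp 2 * (exp (2 * \<bar>ln (cmod a)\<bar>) * exp \<bar>ln e\<bar>)"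
    if z: "z \<in> strip" for z
  proof (cases "a = 0")
    case False
    have x: "0 \<le> Re z" "Re z \<le> 1" using z by (auto simp: strip_def)
    have "(Re z)\<^sup>2 \<le> 1" using x by (simp add: power_le_one)
    then have 1: "(Re z)\<^sup>2 - (Im z)\<^sup>2 + \<bar>Im z\<bar> \<le> 2"
      using abs_minus_square_le[of "Im z"] by linarith
    have "(1 + Re z) / (1 + \<theta>) \<le> 2" using x \<theta> by (simp add: divide_le_eq)
    moreover have "0 \<le> (1 + Re z) / (1 + \<theta>)" using x \<theta> by simp
    ultimately have "(1 + Re z) / (1 + \<theta>) * ln (cmod a) \<le> 2 * \<bar>ln (cmod a)\<bar>"
      by (intro prod_le) auto
    then have 2: "cmod a powr ((1 + Re z) / (1 + \<theta>)) \<le> exp (2 * \<bar>ln (cmod a)\<bar>)"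
      using False by (simp add: powr_def)
    have "e \<le> cmod (H z)" using e(2)[OF z] complex_Re_le_cmod order_trans by blast
    then have "ln e \<le> ln (cmod (H z))" using e(1) by (intro ln_mono) auto
    then have "- ln (cmod (H z)) \<le> \<bar>ln e\<bar>" by linarith
    then have "(Re z / 2) * (- ln (cmod (H z))) \<le> 1 * \<bar>ln e\<bar>"
      using x by (intro prod_le) auto
    then have 3: "cmod (H z) powr (- (Re z / 2)) \<le> exp \<bar>ln e\<bar>"
      using pos[OF z] by (auto simp: powr_def)
    have "cmod (weight_function \<theta> H a z) \<le>
      exp ((Re z)\<^sup>2 - (Im z)\<^sup>2 + \<bar>Im z\<bar>) * (cmod a powr ((1 + Re z) / (1 + \<theta>))
        * cmod (H z) powr (- (Re z / 2)))"
      using cmod_weight_function_le[where H = H and z = z, OF pos[OF z] \<theta> False] by (simp only: mult.assoc)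
    also have "\<dots> \<le> exp 2 * (exp (2 * \<bar>ln (cmod a)\<bar>) * exp \<bar>ln e\<bar>)"
      using 1 2 3 by (intro mult_mono) auto
    finally show ?thesis .
  qed (simp add: weight_function_def)
  then show "bounded (weight_function \<theta> H a ` strip)"
    unfolding bounded_iff by blast
qed

text \<open>
  On \<open>Re z = 0\<close> the exponent \<open>z / 2\<close> is purely imaginary, so the size of \<open>H\<close> does not enter, and the weights are
  square-summable when \<open>a\<close> is in the unit ball of \<open>\<ell>\<close> with exponent \<open>2 / (1 + \<theta>)\<close>.
\<close>

lemma weight_function_left:
  assumes H: "0 < Re (H (Complex 0 t))" and \<theta>: "0 < \<theta>"
  shows "cmod (weight_function \<theta> H a (Complex 0 t)) \<le> exp 1 * cmod a powr (1 / (1 + \<theta>))"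
proof (cases "a = 0")
  case False
  have "cmod (weight_function \<theta> H a (Complex 0 t)) \<le> exp (\<bar>t\<bar> - t\<^sup>2) * cmod a powr (1 / (1 + \<theta>))"
    using cmod_weight_function_le[where H = H and z = "Complex 0 t", OF H \<theta> False] H by (auto split: if_splits)
  also have "\<dots> \<le> exp 1 * cmod a powr (1 / (1 + \<theta>))"
    using abs_minus_square_le[of t] by (intro mult_right_mono) auto
  finally show ?thesis .
qed (simp add: weight_function_def)

text \<open>
  On \<open>Re z = 1\<close> the denominator is of size \<open>\<surd>|H|\<close>, which cancels \<open>x\<close>, the norm of \<open>G\<^sub>i\<close> on that line.
  The factor \<open>(2 + |t|) exp |t|\<close> that remains is absorbed by \<open>exp (- t\<^sup>2)\<close>.
\<close>

lemma weight_function_right: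
  assumes H: "0 < Re (H (Complex 1 t))" and \<theta>: "0 < \<theta>"
    and x: "0 \<le> x" "x\<^sup>2 \<le> (2 + \<bar>t\<bar>)\<^sup>2 * Re (H (Complex 1 t))"
  shows "cmod (weight_function \<theta> H a (Complex 1 t)) * x \<le> 2 * exp 2 * cmod a powr (2 / (1 + \<theta>))"
proof (cases "a = 0")
  case False
  define m where "m = cmod (H (Complex 1 t))"
  have "Re (H (Complex 1 t)) \<le> m" unfolding m_def by (rule complex_Re_le_cmod)
  then have m: "0 < m" and "(2 + \<bar>t\<bar>)\<^sup>2 * Re (H (Complex 1 t)) \<le> (2 + \<bar>t\<bar>)\<^sup>2 * m"
    using H by (auto intro: mult_left_mono)
  then have "x\<^sup>2 \<le> ((2 + \<bar>t\<bar>) * sqrt m)\<^sup>2"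
    using x by (simp add: power_mult_distrib)
  then have xle: "x \<le> (2 + \<bar>t\<bar>) * sqrt m"
    using m by (intro power2_le_imp_le[of x]) auto
  have "m powr (- (1 / 2)) * sqrt m = 1"
    using m by (simp add: powr_minus powr_half_sqrt)
  then have "cmod (weight_function \<theta> H a (Complex 1 t)) * x
      \<le> (exp (1 - t\<^sup>2 + \<bar>t\<bar>) * cmod a powr (2 / (1 + \<theta>)) * m powr (- (1 / 2))) * ((2 + \<bar>t\<bar>) * sqrt m)"
    using cmod_weight_function_le[where H = H and z = "Complex 1 t", OF H \<theta> False] xle x by (intro mult_mono) (auto simp: m_def)
  also have "\<dots> = exp (1 - t\<^sup>2 + \<bar>t\<bar>) * (2 + \<bar>t\<bar>) * cmod a powr (2 / (1 + \<theta>)) * (m powr (- (1 / 2)) * sqrt m)"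
    by (simp only: mult_ac)
  also have "\<dots> = exp (1 - t\<^sup>2 + \<bar>t\<bar>) * (2 + \<bar>t\<bar>) * cmod a powr (2 / (1 + \<theta>))"
    using \<open>m powr (- (1 / 2)) * sqrt m = 1\<close> by simp
  also have "\<dots> \<le> 2 * exp 2 * cmod a powr (2 / (1 + \<theta>))"
  proof (intro mult_right_mono)
    have "2 + \<bar>t\<bar> \<le> 2 * exp \<bar>t\<bar>" using exp_ge_add_one_self[of "\<bar>t\<bar>"] abs_ge_zero[of t] by linarith
    then have "exp (1 - t\<^sup>2 + \<bar>t\<bar>) * (2 + \<bar>t\<bar>) \<le> exp (1 - t\<^sup>2 + \<bar>t\<bar>) * (2 * exp \<bar>t\<bar>)"
      by (intro mult_left_mono) auto
    also have "\<dots> = 2 * exp (1 + (2 * \<bar>t\<bar> - t\<^sup>2))" by (simp add: algebra_simps flip: exp_add)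
    also have "\<dots> \<le> 2 * exp 2" using double_abs_minus_square_le[of t] by simp
    finally show "exp (1 - t\<^sup>2 + \<bar>t\<bar>) * (2 + \<bar>t\<bar>) \<le> 2 * exp 2" .
  qed simp
  finally show ?thesis .
qed (simp add: weight_function_def)

text \<open>
  With \<open>l\<^sub>i\<close> the value at \<open>\<theta>\<close> of \<open>H\<^sub>i\<close> to the power \<open>z / 2\<close>, the sum \<open>\<Sum>\<^sub>i |l\<^sub>i|\<close> to the power \<open>2 / \<theta>\<close>
  is \<open>\<Sum>\<^sub>i |H\<^sub>i(\<theta>)|\<close>.  The function \<open>\<Phi> = \<Sum>\<^sub>i g\<^sub>i G\<^sub>i\<close>, with \<open>g\<^sub>i\<close> the weight function of
  \<open>a\<^sub>i\<close> and \<open>H\<^sub>i\<close>, takes the value \<open>\<Sum>\<^sub>i (a\<^sub>i / l\<^sub>i) G\<^sub>i(\<theta>)\<close> at \<open>\<theta>\<close>.  On the left line its norm is bounded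
  because \<open>V\<close> is bounded from \<open>\<ell>\<^sub>2\<close> to \<open>\<ell>\<^sub>1\<close>, on the right line by the triangle inequality.
\<close>

theorem interpolation_factorization:
  fixes V :: "nat \<Rightarrow> nat \<Rightarrow> complex" and f :: "nat \<Rightarrow> complex \<Rightarrow> 'v::complex_hausdorff_tvs"
  assumes F0: "seminormed F0" and H1: "hilbert_space F1" and \<theta>: "0 < \<theta>" "\<theta> < 1"
    and f: "\<And>k. k < N \<Longrightarrow> f k \<in> calderon_functions F0 F1" and C: "0 < C"
    and f0: "\<And>k t. k < N \<Longrightarrow> nrm F0 (f k (Complex 0 t)) \<le> C"
    and f1: "\<And>k t. k < N \<Longrightarrow> nrm F1 (f k (Complex 1 t)) \<le> C"
    and V: "\<And>a. (\<Sum>k<N. cmod (\<Sum>i<n. V k i * a i)) \<le> sqrt (\<Sum>i<n. (cmod (a i))\<^sup>2)"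
  obtains l :: "nat \<Rightarrow> complex" where "\<And>i. l i \<noteq> 0"
    and "(\<Sum>i<n. cmod (l i) powr (2 / \<theta>)) \<le> 1 + 6 * (96 * C)\<^sup>2 / (1 - \<theta>)"
    and "\<And>a. (\<Sum>i<n. cmod (a i) powr (2 / (1 + \<theta>))) \<le> 1 \<Longrightarrow>
      nrm (complex_interpolation F0 F1 \<theta>) (\<Sum>i<n. (a i / l i) *\<^sub>C (\<Sum>k<N. V k i *\<^sub>C f k (of_real \<theta>)))
        \<le> exp 1 * C + 2 * exp 2"
proof -
  have F1: "seminormed F1" using H1 by (simp add: hilbert_space_def banach_imp_seminormed)
  define G where "G i z = (\<Sum>k<N. V k i *\<^sub>C f k z)" for i z
  have G: "G i \<in> calderon_functions F0 F1" for i
    unfolding G_def using f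
    by (intro calderon_sum[OF F0 F1] calderon_scale[OF F0 F1]) (auto simp: bounded_iff)
  note Gb = calderon_boundary_values[OF F0 F1 G]
  define h where "h i t = (nrm F1 (G i (Complex 1 t)))\<^sup>2" for i t
  obtain H :: "nat \<Rightarrow> complex \<Rightarrow> complex" and e :: real
    where Hc: "\<And>i. i < n \<Longrightarrow> continuous_on strip (H i)"
    and Hh: "\<And>i. i < n \<Longrightarrow> H i holomorphic_on open_strip"
    and e: "0 < e" "\<And>i z. i < n \<Longrightarrow> z \<in> strip \<Longrightarrow> e \<le> Re (H i z)"
    and maj: "\<And>i t. i < n \<Longrightarrow> h i t \<le> (2 + \<bar>t\<bar>)\<^sup>2 * Re (H i (Complex 1 t))"
    and Hsum: "(\<Sum>i<n. cmod (H i (of_real \<theta>))) \<le> 1 + 6 * (96 * C)\<^sup>2 / (1 - \<theta>)"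
  proof (rule strip_majorants[of n h "(96 * C)\<^sup>2" \<theta>])
    show "continuous_on UNIV (h i)" for i
      unfolding h_def by (intro continuous_intros Gb)
    show "(h i \<longlongrightarrow> 0) at_infinity" for i
      unfolding h_def using tendsto_power[OF Gb(4)[of i], of 2] by simp
    show "(\<Sum>i<n. h i t) \<le> (96 * C)\<^sup>2" for t
      unfolding h_def G_def
      using f by (intro hilbert_schmidt_bound_in_space[OF H1 _ C f1 V] calderon_boundary_values[OF F0 F1])
  qed (use \<theta> in \<open>auto simp: h_def\<close>)
  have Hpos: "0 < Re (H i z)" if "i < n" "z \<in> strip" for i z
    using e(1) e(2)[OF that] by linarith
  define l where "l i = exp (of_real \<theta> / 2 * Ln (H i (of_real \<theta>)))" for i
  have \<theta>s: "of_real \<theta> \<in> strip" using \<theta> by (simp add: strip_def)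
  show thesis
  proof (rule that[of l])
    show "l i \<noteq> 0" for i by (simp add: l_def)
    have "cmod (l i) powr (2 / \<theta>) = cmod (H i (of_real \<theta>))" if "i < n" for i
    proof -
      have "H i (of_real \<theta>) \<noteq> 0" using Hpos[OF that \<theta>s] by auto
      then show ?thesis using \<theta> by (simp add: l_def powr_def)
    qed
    then show "(\<Sum>i<n. cmod (l i) powr (2 / \<theta>)) \<le> 1 + 6 * (96 * C)\<^sup>2 / (1 - \<theta>)"
      using Hsum by simp
  next
    fix a :: "nat \<Rightarrow> complex" assume a: "(\<Sum>i<n. cmod (a i) powr (2 / (1 + \<theta>))) \<le> 1"
    define g where "g i = weight_function \<theta> (H i) (a i)" for i
    define \<Phi> where "\<Phi> z = (\<Sum>i<n. g i z *\<^sub>C G i z)" for z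
    have "\<Phi> \<in> calderon_functions F0 F1"
      unfolding \<Phi>_def g_def
    proof (intro calderon_sum[OF F0 F1] calderon_scale[OF F0 F1] G)
      fix i assume "i \<in> {..<n}"
      then have i: "i < n" by simp
      note reg = weight_function_regular[OF Hc[OF i] Hh[OF i] e(1) e(2)[OF i] \<theta>(1)]
      show "continuous_on strip (weight_function \<theta> (H i) (a i))"
        "weight_function \<theta> (H i) (a i) holomorphic_on open_strip"
        "bounded (weight_function \<theta> (H i) (a i) ` strip)"
        by (intro reg; assumption)+
    qed
    moreover have "nrm F0 (\<Phi> (Complex 0 t)) \<le> exp 1 * C + 2 * exp 2" for t
    proof -
      let ?z = "Complex 0 t"
      have "\<Phi> ?z = (\<Sum>i<n. \<Sum>k<N. (V k i * g i ?z) *\<^sub>C f k ?z)"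
        by (simp add: \<Phi>_def G_def complex_vector.scale_sum_right scaleC_scaleC mult.commute)
      also have "\<dots> = (\<Sum>k<N. (\<Sum>i<n. V k i * g i ?z) *\<^sub>C f k ?z)"
        by (subst sum.swap) (simp add: complex_vector.scale_sum_left)
      also have "nrm F0 \<dots> \<le> (\<Sum>k<N. cmod (\<Sum>i<n. V k i * g i ?z) * nrm F0 (f k ?z))"
        using f by (intro nrm_sum_scale[OF F0] calderon_boundary_values[OF F0 F1]) auto
      also have "\<dots> \<le> (\<Sum>k<N. cmod (\<Sum>i<n. V k i * g i ?z) * C)"
        using f0 by (intro sum_mono mult_left_mono) auto
      also have "\<dots> \<le> sqrt (\<Sum>i<n. (cmod (g i ?z))\<^sup>2) * C"
        unfolding sum_distrib_right[symmetric] using V C by (intro mult_right_mono) auto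
      also have "\<dots> \<le> exp 1 * C"
      proof (intro mult_right_mono)
        have "(cmod (g i ?z))\<^sup>2 \<le> (exp 1)\<^sup>2 * cmod (a i) powr (2 / (1 + \<theta>))" if "i < n" for i
        proof -
          have "(cmod (g i ?z))\<^sup>2 \<le> (exp 1 * cmod (a i) powr (1 / (1 + \<theta>)))\<^sup>2"
            unfolding g_def
            by (intro power_mono weight_function_left \<theta> Hpos[OF that] strip_boundary) auto
          also have "\<dots> = (exp 1)\<^sup>2 * cmod (a i) powr (2 / (1 + \<theta>))"
            by (simp add: power_mult_distrib power2_eq_square flip: powr_add)
          finally show ?thesis .
        qed
        then have "(\<Sum>i<n. (cmod (g i ?z))\<^sup>2) \<le> (exp 1)\<^sup>2 * (\<Sum>i<n. cmod (a i) powr (2 / (1 + \<theta>)))"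
          unfolding sum_distrib_left by (intro sum_mono) auto
        also have "\<dots> \<le> (exp 1)\<^sup>2" using a by (intro mult_left_le) auto
        finally show "sqrt (\<Sum>i<n. (cmod (g i ?z))\<^sup>2) \<le> exp 1"
          by (intro real_le_lsqrt) (auto intro: sum_nonneg)
      qed (use C in auto)
      finally show ?thesis by (simp add: add_increasing2)
    qed
    moreover have "nrm F1 (\<Phi> (Complex 1 t)) \<le> exp 1 * C + 2 * exp 2" for t
    proof -
      let ?z = "Complex 1 t"
      have "nrm F1 (\<Phi> ?z) \<le> (\<Sum>i<n. cmod (g i ?z) * nrm F1 (G i ?z))"
        unfolding \<Phi>_def by (intro nrm_sum_scale[OF F1] Gb)
      also have "\<dots> \<le> (\<Sum>i<n. 2 * exp 2 * cmod (a i) powr (2 / (1 + \<theta>)))"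
        unfolding g_def
        using Hpos[OF _ strip_boundary(2)] \<theta> maj nrm_nonneg[OF F1 Gb(2)]
        by (intro sum_mono weight_function_right) (auto simp: h_def)
      also have "\<dots> \<le> 2 * exp 2"
        unfolding sum_distrib_left[symmetric] using a by (intro mult_left_le) auto
      finally show ?thesis using C by (simp add: add_increasing)
    qed
    ultimately have "nrm (complex_interpolation F0 F1 \<theta>) (\<Phi> (of_real \<theta>)) \<le> exp 1 * C + 2 * exp 2"
      by (rule complex_interpolation_nrm_le[OF F0 F1])
    then show "nrm (complex_interpolation F0 F1 \<theta>) (\<Sum>i<n. (a i / l i) *\<^sub>C (\<Sum>k<N. V k i *\<^sub>C f k (of_real \<theta>)))
        \<le> exp 1 * C + 2 * exp 2"
      by (simp add: \<Phi>_def g_def G_def l_def weight_function_at[OF \<theta>(1)])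
  qed
qed

section \<open>The space of absolutely summable sequences\<close>

text \<open>
  A crude form of Young's inequality.  It replaces Hoelder's inequality wherever both sums have already been
  normalized, since the constants do not matter.
\<close>

lemma powr_product_le_add:
  fixes u v :: real
  assumes "0 \<le> u" "0 \<le> v" "0 \<le> \<alpha>" "\<alpha> \<le> 1"
  shows "u powr \<alpha> * v powr (1 - \<alpha>) \<le> u + v"
proof -
  define m where "m = max u v"
  have "u powr \<alpha> * v powr (1 - \<alpha>) \<le> m powr \<alpha> * m powr (1 - \<alpha>)"
    using assms by (intro mult_mono powr_mono2) (auto simp: m_def)
  also have "\<dots> = m"
    using assms by (simp add: m_def flip: powr_add)
  also have "m \<le> u + v" using assms by (simp add: m_def)
  finally show ?thesis .
qed

definition coord :: "nat \<Rightarrow> nat \<Rightarrow> complex" where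
  "coord k = (\<lambda>j. if j = k then 1 else 0)"

lemma summable_pts_l1: "x \<in> pts l1 \<longleftrightarrow> summable (\<lambda>k. cmod (x k))"
  by (simp add: l1_def)

lemma nrm_l1: "nrm l1 x = (\<Sum>k. cmod (x k))"
  by (simp add: l1_def)

lemma seminormed_l1: "seminormed l1"
proof -
  have add: "summable (\<lambda>k. cmod (x k + y k))"
    if "summable (\<lambda>k. cmod (x k))" "summable (\<lambda>k. cmod (y k))" for x y :: "nat \<Rightarrow> complex"
    by (rule summable_comparison_test[OF _ summable_add[OF that]]) (auto intro: norm_triangle_ineq)
  have tri: "(\<Sum>k. cmod (x k + y k)) \<le> (\<Sum>k. cmod (x k)) + (\<Sum>k. cmod (y k))"
    if "summable (\<lambda>k. cmod (x k))" "summable (\<lambda>k. cmod (y k))" for x y :: "nat \<Rightarrow> complex"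
    unfolding suminf_add[OF that]
    by (intro suminf_le norm_triangle_ineq add summable_add that)
  show ?thesis
    unfolding seminormed_def complex_vector.subspace_def
    by (auto simp: summable_pts_l1 nrm_l1 scaleC_fun_def scaleC_complex_def norm_mult
        intro!: add tri suminf_nonneg suminf_mult summable_mult)
qed

lemma coord_l1: "coord k \<in> pts l1" "nrm l1 (coord k) = 1"
proof -
  have "(\<lambda>j. cmod (coord k j)) sums (\<Sum>j\<in>{k}. cmod (coord k j))"
    by (rule sums_finite) (auto simp: coord_def)
  then have "(\<lambda>j. cmod (coord k j)) sums 1" by (simp add: coord_def)
  then show "coord k \<in> pts l1" "nrm l1 (coord k) = 1"
    by (auto simp: summable_pts_l1 nrm_l1 sums_iff)
qed

lemma l1_truncate:
  assumes x: "x \<in> pts l1"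
  shows "(\<lambda>N. nrm l1 ((\<Sum>k<N. x k *\<^sub>C coord k) - x)) \<longlonglongrightarrow> 0"
proof -
  have s: "summable (\<lambda>k. cmod (x k))" using x by (simp add: summable_pts_l1)
  have "nrm l1 ((\<Sum>k<N. x k *\<^sub>C coord k) - x) = (\<Sum>k. cmod (x k)) - (\<Sum>k<N. cmod (x k))" for N
  proof -
    have val: "((\<Sum>k<N. x k *\<^sub>C coord k) - x) j = (if j < N then 0 else - x j)" for j
    proof -
      have "(\<Sum>k<N. x k *\<^sub>C coord k) j = (\<Sum>k<N. (x k *\<^sub>C coord k) j)"
        by (induction N) auto
      also have "\<dots> = (\<Sum>k<N. if k = j then x j else 0)"
        by (intro sum.cong) (auto simp: scaleC_fun_def scaleC_complex_def coord_def)
      finally show ?thesis by simp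
    qed
    have "(\<lambda>j. cmod (x j) - (if j < N then cmod (x j) else 0)) sums
        ((\<Sum>k. cmod (x k)) - (\<Sum>j\<in>{..<N}. if j < N then cmod (x j) else 0))"
      by (intro sums_diff summable_sums s sums_finite) auto
    moreover have "(\<lambda>j. cmod (x j) - (if j < N then cmod (x j) else 0))
        = (\<lambda>j. cmod (((\<Sum>k<N. x k *\<^sub>C coord k) - x) j))"
      unfolding val by auto
    ultimately show ?thesis by (simp add: nrm_l1 sums_iff)
  qed
  then show ?thesis
    using tendsto_diff[OF tendsto_const[of "\<Sum>k. cmod (x k)"] summable_LIMSEQ[OF s]] by simp
qed

lemma linear_map_sum:
  assumes E: "seminormed E" and F: "seminormed F" and T: "linear_map E F T"
    and "\<And>i. i \<in> A \<Longrightarrow> x i \<in> pts E"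
  shows "T (\<Sum>i\<in>A. c i *\<^sub>C x i) = (\<Sum>i\<in>A. c i *\<^sub>C T (x i))"
  using assms(4)
proof (induction A rule: infinite_finite_induct)
  case (insert i A)
  then have "T (c i *\<^sub>C x i + (\<Sum>i\<in>A. c i *\<^sub>C x i)) = T (c i *\<^sub>C x i) + T (\<Sum>i\<in>A. c i *\<^sub>C x i)"
    using T pts_scale[OF E] pts_sum[OF E, of A "\<lambda>i. c i *\<^sub>C x i"]
    unfolding linear_map_def by blast
  moreover have "T (c i *\<^sub>C x i) = c i *\<^sub>C T (x i)"
    using T insert.prems unfolding linear_map_def by blast
  ultimately show ?case using insert by simp
next
  case empty
  have "T (0 *\<^sub>C 0) = 0 *\<^sub>C T 0"
    using T pts_zero[OF E] unfolding linear_map_def by blast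
  then show ?case by simp
next
  case (infinite A)
  have "T (0 *\<^sub>C 0) = 0 *\<^sub>C T 0"
    using T pts_zero[OF E] unfolding linear_map_def by blast
  then show ?case using infinite by simp
qed

lemma bounded_ops_bound:
  assumes "T \<in> bounded_ops E F" and E: "seminormed E"
  obtains C where "0 < C" and "\<And>x. x \<in> pts E \<Longrightarrow> nrm F (T x) \<le> C * nrm E x"
proof -
  obtain C where C: "\<And>x. x \<in> pts E \<Longrightarrow> nrm F (T x) \<le> C * nrm E x"
    using assms(1) by (auto simp: bounded_ops_def)
  have "nrm F (T x) \<le> max C 1 * nrm E x" if "x \<in> pts E" for x
    by (rule order_trans[OF C[OF that]]) (intro mult_right_mono nrm_nonneg[OF E that], simp)
  then show thesis by (intro that[of "max C 1"]) auto
qed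

lemma bounded_ops_compose:
  assumes E: "seminormed E" and F: "seminormed F"
    and T: "T \<in> bounded_ops E F" and S: "S \<in> bounded_ops F Y"
  shows "S \<circ> T \<in> bounded_ops E Y"
proof -
  obtain C where C: "0 < C" "\<And>x. x \<in> pts E \<Longrightarrow> nrm F (T x) \<le> C * nrm E x"
    using bounded_ops_bound[OF T E] by blast
  obtain D where D: "0 < D" "\<And>x. x \<in> pts F \<Longrightarrow> nrm Y (S x) \<le> D * nrm F x"
    using bounded_ops_bound[OF S F] by blast
  have Tl: "linear_map E F T" and Sl: "linear_map F Y S"
    using T S by (auto simp: bounded_ops_def)
  have "nrm Y (S (T x)) \<le> D * C * nrm E x" if x: "x \<in> pts E" for x
  proof -
    have "nrm Y (S (T x)) \<le> D * nrm F (T x)" using D Tl x by (simp add: linear_map_def)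
    also have "\<dots> \<le> D * (C * nrm E x)" using C(2)[OF x] D(1) by (intro mult_left_mono) auto
    finally show ?thesis by (simp add: mult.assoc)
  qed
  then show ?thesis
    using Tl Sl by (auto simp: bounded_ops_def linear_map_def)
qed

lemma lp_norm_real:
  "lp_norm (ereal p) n a = (\<Sum>i<n. a i powr p) powr (1 / p)"
  by (simp add: lp_norm_def)

lemma lp_norm_one:
  assumes "\<And>i. i < n \<Longrightarrow> 0 \<le> a i"
  shows "lp_norm (ereal 1) n a = (\<Sum>i<n. a i)"
proof -
  have "0 \<le> sum a {..<n}" using assms by (intro sum_nonneg) auto
  then show ?thesis using assms by (simp add: lp_norm_def)
qed

lemma lp_norm_two:
  assumes "\<And>i. i < n \<Longrightarrow> 0 \<le> a i"
  shows "lp_norm (ereal 2) n a = sqrt (\<Sum>i<n. (a i)\<^sup>2)"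
  using assms by (simp add: lp_norm_def sum_nonneg powr_half_sqrt)

lemma lp_norm_mono:
  assumes "0 < p" and "\<And>i. i < n \<Longrightarrow> 0 \<le> a i" and "\<And>i. i < n \<Longrightarrow> a i \<le> b i"
  shows "lp_norm (ereal p) n a \<le> lp_norm (ereal p) n b"
  unfolding lp_norm_real using assms by (intro powr_mono2 sum_mono sum_nonneg) auto

definition weak_norm :: "ereal \<Rightarrow> nat \<Rightarrow> (nat \<Rightarrow> 'a) \<Rightarrow> 'a::complex_vector nspace \<Rightarrow> real" where
  "weak_norm p n x E = (SUP \<phi>\<in>dual_ball E. lp_norm p n (\<lambda>i. cmod (\<phi> (x i))))"

text \<open>
  The supremum over the dual ball is bounded above because each functional is dominated by the norm.
\<close>

lemma weak_norm_upper:
  assumes p: "0 < p" and x: "\<And>i. i < n \<Longrightarrow> x i \<in> pts E" and \<phi>: "\<phi> \<in> dual_ball E"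
  shows "lp_norm (ereal p) n (\<lambda>i. cmod (\<phi> (x i))) \<le> weak_norm (ereal p) n x E"
  unfolding weak_norm_def
proof (rule cSUP_upper[OF \<phi>])
  have "lp_norm (ereal p) n (\<lambda>i. cmod (\<psi> (x i))) \<le> lp_norm (ereal p) n (\<lambda>i. nrm E (x i))"
    if "\<psi> \<in> dual_ball E" for \<psi>
    using that x p by (intro lp_norm_mono) (auto simp: dual_ball_def)
  then show "bdd_above ((\<lambda>\<phi>. lp_norm (ereal p) n (\<lambda>i. cmod (\<phi> (x i)))) ` dual_ball E)"
    by (rule bdd_aboveI2)
qed

lemma dual_ball_zero: "seminormed E \<Longrightarrow> (\<lambda>_. 0) \<in> dual_ball E"
  by (auto simp: dual_ball_def bounded_ops_def linear_map_def scalars_def nrm_nonneg intro: exI[of _ 0])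

lemma weak_norm_le:
  assumes "seminormed E" and "\<And>\<phi>. \<phi> \<in> dual_ball E \<Longrightarrow> lp_norm p n (\<lambda>i. cmod (\<phi> (x i))) \<le> c"
  shows "weak_norm p n x E \<le> c"
  unfolding weak_norm_def using assms dual_ball_zero by (intro cSUP_least) auto

lemma l1_dual_ball:
  assumes "\<And>k. cmod (\<epsilon> k) \<le> 1"
  shows "(\<lambda>y. \<Sum>k<N. \<epsilon> k * y k) \<in> dual_ball l1"
proof -
  have le: "cmod (\<Sum>k<N. \<epsilon> k * y k) \<le> nrm l1 y" if "y \<in> pts l1" for y
  proof -
    have "cmod (\<Sum>k<N. \<epsilon> k * y k) \<le> (\<Sum>k<N. cmod (y k))"
      using assms by (intro sum_norm_le) (simp add: norm_mult mult_left_le_one_le)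
    also have "\<dots> \<le> nrm l1 y"
      using that by (auto simp: nrm_l1 summable_pts_l1 intro: sum_le_suminf)
    finally show ?thesis .
  qed
  then have "\<exists>C. \<forall>y\<in>pts l1. cmod (\<Sum>k<N. \<epsilon> k * y k) \<le> C * nrm l1 y"
    by (intro exI[of _ 1]) auto
  then show ?thesis
    using le
    by (auto simp: dual_ball_def bounded_ops_def linear_map_def scalars_def scaleC_fun_def
        scaleC_complex_def algebra_simps sum.distrib sum_distrib_left)
qed

text \<open>
  Choosing the signs \<open>\<epsilon>\<^sub>k\<close> of the coordinates turns the \<open>\<ell>\<^sub>1\<close> norm of \<open>\<Sum>\<^sub>i a\<^sub>i x\<^sub>i\<close> into the value of a single
  functional from the dual ball; \<open>b\<^sub>i\<close> is its value at \<open>x\<^sub>i\<close>.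
\<close>

lemma l1_weak_norm_test:
  fixes x :: "nat \<Rightarrow> nat \<Rightarrow> complex"
  assumes p: "0 < p" and x: "\<And>i. i < n \<Longrightarrow> x i \<in> pts l1"
  obtains b where "(\<Sum>k<N. cmod (\<Sum>i<n. x i k * a i)) \<le> (\<Sum>i<n. cmod (b i) * cmod (a i))"
    and "lp_norm (ereal p) n (\<lambda>i. cmod (b i)) \<le> weak_norm (ereal p) n x l1"
proof -
  define \<epsilon> where "\<epsilon> k = cnj (sgn (\<Sum>i<n. x i k * a i))" for k
  define b where "b i = (\<Sum>k<N. \<epsilon> k * x i k)" for i
  have "of_real (\<Sum>k<N. cmod (\<Sum>i<n. x i k * a i)) = (\<Sum>k<N. \<epsilon> k * (\<Sum>i<n. x i k * a i))"
    by (simp add: \<epsilon>_def cnj_sgn_mult)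
  also have "\<dots> = (\<Sum>k<N. \<Sum>i<n. \<epsilon> k * x i k * a i)"
    by (simp add: sum_distrib_left mult.assoc)
  also have "\<dots> = (\<Sum>i<n. b i * a i)"
    by (subst sum.swap) (simp add: b_def sum_distrib_right)
  finally have eq: "of_real (\<Sum>k<N. cmod (\<Sum>i<n. x i k * a i)) = (\<Sum>i<n. b i * a i)" .
  show thesis
  proof (rule that[of b])
    have "(\<Sum>k<N. cmod (\<Sum>i<n. x i k * a i)) = cmod (\<Sum>i<n. b i * a i)"
      unfolding eq[symmetric] norm_of_real by (simp add: sum_nonneg)
    also have "\<dots> \<le> (\<Sum>i<n. cmod (b i) * cmod (a i))"
      by (intro sum_norm_le) (simp add: norm_mult)
    finally show "(\<Sum>k<N. cmod (\<Sum>i<n. x i k * a i)) \<le> (\<Sum>i<n. cmod (b i) * cmod (a i))" .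
    show "lp_norm (ereal p) n (\<lambda>i. cmod (b i)) \<le> weak_norm (ereal p) n x l1"
      unfolding b_def using p x
      by (intro weak_norm_upper l1_dual_ball) (auto simp: \<epsilon>_def norm_sgn)
  qed
qed

section \<open>Summing and mixing operators\<close>

text \<open>
  The matrix \<open>V\<close> stands for the family of its columns in the first \<open>N\<close> coordinates of \<open>\<ell>\<^sub>1\<close>; that this family has weak
  \<open>\<ell>\<^sub>2\<close> norm at most 1 means that \<open>V\<close> has norm at most 1 as an operator from \<open>\<ell>\<^sub>2\<close> to \<open>\<ell>\<^sub>1\<close>.
\<close>

definition normalized2 :: "(nat \<Rightarrow> nat \<Rightarrow> complex) \<Rightarrow> nat \<Rightarrow> nat \<Rightarrow> bool" where
  "normalized2 V N n \<longleftrightarrow>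
     (\<forall>a. (\<Sum>k<N. cmod (\<Sum>i<n. V k i * a i)) \<le> sqrt (\<Sum>i<n. (cmod (a i))\<^sup>2))"

text \<open>
  The analogue of \<open>normalized2\<close> for the weak \<open>\<ell>\<^sub>1\<close> norm: an operator from \<open>\<ell>\<^sub>\<infinity>\<close> to \<open>\<ell>\<^sub>1\<close>.
\<close>

definition normalized1 :: "(nat \<Rightarrow> nat \<Rightarrow> complex) \<Rightarrow> nat \<Rightarrow> nat \<Rightarrow> bool" where
  "normalized1 V N n \<longleftrightarrow>
     (\<forall>a. (\<forall>i. cmod (a i) \<le> 1) \<longrightarrow> (\<Sum>k<N. cmod (\<Sum>i<n. V k i * a i)) \<le> 1)"

lemma normalized2_of_weak_norm:
  fixes x :: "nat \<Rightarrow> nat \<Rightarrow> complex"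
  assumes x: "\<And>i. i < n \<Longrightarrow> x i \<in> pts l1" and W: "weak_norm 2 n x l1 \<le> W" "0 < W"
  shows "normalized2 (\<lambda>k i. x i k / of_real W) N n"
  unfolding normalized2_def
proof
  fix a :: "nat \<Rightarrow> complex"
  obtain b where b: "(\<Sum>k<N. cmod (\<Sum>i<n. x i k * a i)) \<le> (\<Sum>i<n. cmod (b i) * cmod (a i))"
    and b2: "lp_norm (ereal 2) n (\<lambda>i. cmod (b i)) \<le> weak_norm (ereal 2) n x l1"
    using l1_weak_norm_test[where p = 2 and n = n and x = x and N = N and a = a] x by auto
  have "sqrt (\<Sum>i<n. (cmod (b i))\<^sup>2) \<le> W"
    using b2 W(1) by (simp add: lp_norm_two)
  moreover have "(\<Sum>i<n. cmod (b i) * cmod (a i))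
      \<le> sqrt (\<Sum>i<n. (cmod (b i))\<^sup>2) * sqrt (\<Sum>i<n. (cmod (a i))\<^sup>2)"
    using L2_set_mult_ineq[of "\<lambda>i. cmod (b i)" "\<lambda>i. cmod (a i)" "{..<n}"] by (simp add: L2_set_def)
  ultimately have "(\<Sum>k<N. cmod (\<Sum>i<n. x i k * a i)) \<le> W * sqrt (\<Sum>i<n. (cmod (a i))\<^sup>2)"
    using b mult_right_mono[of "sqrt (\<Sum>i<n. (cmod (b i))\<^sup>2)" W "sqrt (\<Sum>i<n. (cmod (a i))\<^sup>2)"]
    by (simp add: sum_nonneg)
  then show "(\<Sum>k<N. cmod (\<Sum>i<n. x i k / of_real W * a i)) \<le> sqrt (\<Sum>i<n. (cmod (a i))\<^sup>2)"
    using W(2) by (simp add: norm_divide divide_le_eq mult.commute flip: sum_divide_distrib)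
qed

lemma normalized1_of_weak_norm:
  fixes x :: "nat \<Rightarrow> nat \<Rightarrow> complex"
  assumes x: "\<And>i. i < n \<Longrightarrow> x i \<in> pts l1" and W: "weak_norm 1 n x l1 \<le> W" "0 < W"
  shows "normalized1 (\<lambda>k i. x i k / of_real W) N n"
  unfolding normalized1_def
proof (intro allI impI)
  fix a :: "nat \<Rightarrow> complex" assume a: "\<forall>i. cmod (a i) \<le> 1"
  obtain b where b: "(\<Sum>k<N. cmod (\<Sum>i<n. x i k * a i)) \<le> (\<Sum>i<n. cmod (b i) * cmod (a i))"
    and b1: "lp_norm (ereal 1) n (\<lambda>i. cmod (b i)) \<le> weak_norm (ereal 1) n x l1"
    using l1_weak_norm_test[where p = 1 and n = n and x = x and N = N and a = a] x by auto
  have "(\<Sum>i<n. cmod (b i)) \<le> W"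
    using b1 W(1) by (simp add: lp_norm_one one_ereal_def)
  moreover have "(\<Sum>i<n. cmod (b i) * cmod (a i)) \<le> (\<Sum>i<n. cmod (b i))"
    using a by (intro sum_mono mult_left_le) auto
  ultimately have "(\<Sum>k<N. cmod (\<Sum>i<n. x i k * a i)) \<le> W" using b by simp
  then show "(\<Sum>k<N. cmod (\<Sum>i<n. x i k / of_real W * a i)) \<le> 1"
    using W(2) by (simp add: norm_divide divide_le_eq flip: sum_divide_distrib)
qed

text \<open>
  The summing property of \<open>U\<close>, tested on finitely supported families normalized in the sense of \<open>P\<close>.
\<close>

definition power_bound ::
    "((nat \<Rightarrow> nat \<Rightarrow> complex) \<Rightarrow> nat \<Rightarrow> nat \<Rightarrow> bool) \<Rightarrow> real \<Rightarrow>
     'b::complex_vector nspace \<Rightarrow> ((nat \<Rightarrow> complex) \<Rightarrow> 'b) \<Rightarrow> bool" where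
  "power_bound P r Z U \<longleftrightarrow>
     (\<exists>c. \<forall>V N n. P V N n \<longrightarrow> (\<Sum>i<n. nrm Z (\<Sum>k<N. V k i *\<^sub>C U (coord k)) powr r) \<le> c)"

text \<open>
  Divide a family by any number above its weak norm, cut it down to finitely many coordinates and let
  their number grow.  Using a number strictly above the weak norm avoids a division by 0.
\<close>

lemma summing_of_power_bound:
  fixes U :: "(nat \<Rightarrow> complex) \<Rightarrow> 'b::complex_vector"
  assumes Z: "seminormed Z" and U: "U \<in> bounded_ops l1 Z" and r: "0 < r"
    and P: "\<And>n x W N. (\<And>i. i < n \<Longrightarrow> x i \<in> pts l1) \<Longrightarrow> weak_norm p n x l1 \<le> W \<Longrightarrow> 0 < W \<Longrightarrow>
      P (\<lambda>k i. x i k / of_real W) N n"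
    and wn: "\<And>n x. (\<And>i. i < n \<Longrightarrow> x i \<in> pts l1) \<Longrightarrow> 0 \<le> weak_norm p n x l1"
    and pb: "power_bound P r Z U"
  shows "U \<in> summing (ereal r) p l1 Z"
proof -
  obtain c0 where c0: "\<And>V N n. P V N n \<Longrightarrow> (\<Sum>i<n. nrm Z (\<Sum>k<N. V k i *\<^sub>C U (coord k)) powr r) \<le> c0"
    using pb unfolding power_bound_def by blast
  define c where "c = max c0 0"
  have c: "0 \<le> c" "\<And>V N n. P V N n \<Longrightarrow> (\<Sum>i<n. nrm Z (\<Sum>k<N. V k i *\<^sub>C U (coord k)) powr r) \<le> c"
    using c0 by (auto simp: c_def le_max_iff_disj)
  have Ul: "linear_map l1 Z U" using U by (simp add: bounded_ops_def)
  then have Upts: "U x \<in> pts Z" if "x \<in> pts l1" for x using that by (simp add: linear_map_def)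
  obtain D where D: "0 < D" "\<And>x. x \<in> pts l1 \<Longrightarrow> nrm Z (U x) \<le> D * nrm l1 x"
    using bounded_ops_bound[OF U seminormed_l1] by blast
  have main: "lp_norm (ereal r) n (\<lambda>i. nrm Z (U (x i))) \<le> c powr (1 / r) * W"
    if x: "\<And>i. i < n \<Longrightarrow> x i \<in> pts l1" and W: "weak_norm p n x l1 \<le> W" "0 < W" for n x W
  proof -
    define T where "T N i = (\<Sum>k<N. x i k *\<^sub>C coord k)" for N i
    have T: "T N i \<in> pts l1" for N i
      unfolding T_def by (intro pts_sum[OF seminormed_l1] pts_scale[OF seminormed_l1] coord_l1)
    have UT: "U (T N i) = (\<Sum>k<N. x i k *\<^sub>C U (coord k))" for N i
      unfolding T_def by (intro linear_map_sum[OF seminormed_l1 Z Ul] coord_l1)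
    have bound: "(\<Sum>i<n. nrm Z (U (T N i)) powr r) \<le> c * W powr r" for N
    proof -
      have eq: "(\<Sum>k<N. (x i k / of_real W) *\<^sub>C U (coord k)) = inverse (of_real W) *\<^sub>C U (T N i)" for i
        unfolding UT complex_vector.scale_sum_right
        by (simp add: scaleC_scaleC divide_inverse mult.commute)
      have nn: "nrm Z (inverse (of_real W) *\<^sub>C U (T N i)) = nrm Z (U (T N i)) / W" for i
        using W(2) by (simp add: nrm_scale[OF Z Upts[OF T]] norm_inverse divide_inverse mult.commute)
      have "(\<Sum>i<n. (nrm Z (U (T N i)) / W) powr r) \<le> c"
        using c(2)[OF P[of n x W N, OF x W]] unfolding eq nn .
      then show ?thesis
        using W(2) by (simp add: powr_divide nrm_nonneg[OF Z Upts[OF T]] divide_le_eq flip: sum_divide_distrib)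
    qed
    have lim: "(\<lambda>N. nrm Z (U (T N i))) \<longlonglongrightarrow> nrm Z (U (x i))" if i: "i < n" for i
    proof (rule tendsto_nrm[OF Z])
      show "(\<lambda>N. nrm Z (U (T N i) - U (x i))) \<longlonglongrightarrow> 0"
      proof (rule Lim_null_comparison)
        have eq: "U (T N i) - U (x i) = U (T N i - x i)" for N
        proof -
          have "U ((T N i - x i) + x i) = U (T N i - x i) + U (x i)"
            using Ul x[OF i] pts_diff[OF seminormed_l1 T x[OF i]] unfolding linear_map_def by blast
          then show ?thesis by simp
        qed
        have "norm (nrm Z (U (T N i) - U (x i))) \<le> D * nrm l1 (T N i - x i)" for N
          unfolding eq using D(2) nrm_nonneg[OF Z Upts] pts_diff[OF seminormed_l1 T x[OF i]] by simp
        then show "\<forall>\<^sub>F N in sequentially. norm (nrm Z (U (T N i) - U (x i))) \<le> D * nrm l1 (T N i - x i)"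
          by simp
        show "(\<lambda>N. D * nrm l1 (T N i - x i)) \<longlonglongrightarrow> 0"
          using tendsto_mult[OF tendsto_const l1_truncate[OF x[OF i]], of D] by (simp add: T_def)
      qed
    qed (use T Upts x i in auto)
    have "(\<lambda>N. \<Sum>i<n. nrm Z (U (T N i)) powr r) \<longlonglongrightarrow> (\<Sum>i<n. nrm Z (U (x i)) powr r)"
      using r lim by (intro tendsto_sum tendsto_powr') (auto simp: nrm_nonneg[OF Z Upts[OF T]])
    then have "(\<Sum>i<n. nrm Z (U (x i)) powr r) \<le> c * W powr r"
      by (rule LIMSEQ_le_const2) (use bound in auto)
    then have "lp_norm (ereal r) n (\<lambda>i. nrm Z (U (x i))) \<le> (c * W powr r) powr (1 / r)"
      unfolding lp_norm_real using r by (intro powr_mono2 sum_nonneg) auto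
    also have "\<dots> = c powr (1 / r) * W"
      using c(1) W(2) r by (simp add: powr_mult powr_powr)
    finally show ?thesis .
  qed
  have "lp_norm (ereal r) n (\<lambda>i. nrm Z (U (x i))) \<le> c powr (1 / r) * weak_norm p n x l1"
    if x: "\<And>i. i < n \<Longrightarrow> x i \<in> pts l1" for n x
  proof (rule field_le_epsilon)
    fix e :: real assume e: "0 < e"
    define K where "K = c powr (1 / r) + 1"
    have K: "0 < K" "c powr (1 / r) \<le> K" by (simp_all add: K_def add_nonneg_pos)
    have "lp_norm (ereal r) n (\<lambda>i. nrm Z (U (x i))) \<le> c powr (1 / r) * (weak_norm p n x l1 + e / K)"
      using e K wn[OF x] by (intro main x) (auto intro: add_nonneg_pos)
    also have "\<dots> \<le> c powr (1 / r) * weak_norm p n x l1 + e"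
      using e K mult_right_mono[OF K(2), of "e / K"] by (simp add: distrib_left)
    finally show "lp_norm (ereal r) n (\<lambda>i. nrm Z (U (x i))) \<le> c powr (1 / r) * weak_norm p n x l1 + e" .
  qed
  then show ?thesis
    using U by (auto simp: summing_def weak_norm_def intro!: exI[of _ "c powr (1 / r)"])
qed

lemma weak_norm_nonneg:
  assumes p: "0 < p" and E: "seminormed E" and x: "\<And>i. i < n \<Longrightarrow> x i \<in> pts E"
  shows "0 \<le> weak_norm (ereal p) n x E"
  using weak_norm_upper[OF p x dual_ball_zero[OF E]] by (simp add: lp_norm_real)

lemma summing_two:
  assumes "seminormed Z" "U \<in> bounded_ops l1 Z" "0 < r" "power_bound normalized2 r Z U"
  shows "U \<in> summing (ereal r) 2 l1 Z"
  using assms weak_norm_nonneg[of 2, OF _ seminormed_l1]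
  by (intro summing_of_power_bound[where P = normalized2] normalized2_of_weak_norm) auto

lemma summing_one:
  assumes "seminormed Z" "U \<in> bounded_ops l1 Z" "0 < r" "power_bound normalized1 r Z U"
  shows "U \<in> summing (ereal r) 1 l1 Z"
  using assms weak_norm_nonneg[of 1, OF _ seminormed_l1]
  by (intro summing_of_power_bound[where P = normalized1] normalized1_of_weak_norm)
    (auto simp: one_ereal_def[symmetric])

text \<open>
  \<open>pietsch_weights\<close> writes a family of weak \<open>\<ell>\<^sub>1\<close> norm 1 as \<open>(96 b\<^sub>i x\<^sub>i)\<close>, where \<open>(b\<^sub>i)\<close> is square-summable and
  \<open>(x\<^sub>i)\<close> has weak \<open>\<ell>\<^sub>2\<close> norm at most 1.
\<close>

theorem power_bound_two_imp_one:
  assumes Z: "seminormed Z" and U: "\<And>k. U (coord k) \<in> pts Z" and r: "0 < r"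
    and r': "1 / r' = 1 / 2 + 1 / r"
    and pb: "power_bound normalized2 r Z U"
  shows "power_bound normalized1 r' Z U"
proof -
  obtain c where c: "\<And>V N n. normalized2 V N n \<Longrightarrow>
      (\<Sum>i<n. nrm Z (\<Sum>k<N. V k i *\<^sub>C U (coord k)) powr r) \<le> c"
    using pb unfolding power_bound_def by blast
  have r'0: "0 < r'" using r r' by (metis add_pos_pos zero_less_divide_1_iff zero_less_numeral)
  have \<alpha>: "1 - r' / 2 = r' / r"
    using r'0 r r' by (simp add: field_simps)
  have \<alpha>01: "0 \<le> r' / 2" "r' / 2 \<le> 1"
    using r'0 \<alpha> divide_pos_pos[OF r'0 r] by linarith+
  show ?thesis
    unfolding power_bound_def
  proof (intro exI[of _ "2 * 96\<^sup>2 + c"] allI impI)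
    fix V N n assume V: "normalized1 V N n"
    obtain b where b: "\<And>i. i < n \<Longrightarrow> 0 < b i" "(\<Sum>i<n. (b i)\<^sup>2) \<le> 2"
      and Vb: "\<And>a. (\<Sum>k<N. cmod (\<Sum>i<n. V k i * a i)) \<le> 96 * sqrt (\<Sum>i<n. (b i * cmod (a i))\<^sup>2)"
      using pietsch_weights[where N = N and n = n and V = V] V unfolding normalized1_def by blast
    define V' where "V' k i = V k i / of_real (96 * b i)" for k i
    have "normalized2 V' N n"
      unfolding normalized2_def
    proof
      fix a :: "nat \<Rightarrow> complex"
      have "(\<Sum>k<N. cmod (\<Sum>i<n. V' k i * a i)) = (\<Sum>k<N. cmod (\<Sum>i<n. V k i * (a i / of_real (96 * b i))))"
        by (simp add: V'_def)
      also have "\<dots> \<le> 96 * sqrt (\<Sum>i<n. (b i * cmod (a i / of_real (96 * b i)))\<^sup>2)"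
        by (rule Vb)
      also have "(\<Sum>i<n. (b i * cmod (a i / of_real (96 * b i)))\<^sup>2) = (\<Sum>i<n. (cmod (a i) / 96)\<^sup>2)"
        using b(1) by (intro sum.cong refl) (fastforce simp: norm_divide norm_mult)
      also have "96 * sqrt \<dots> = sqrt (\<Sum>i<n. (cmod (a i))\<^sup>2)"
        by (simp add: power_divide real_sqrt_divide flip: sum_divide_distrib)
      finally show "(\<Sum>k<N. cmod (\<Sum>i<n. V' k i * a i)) \<le> sqrt (\<Sum>i<n. (cmod (a i))\<^sup>2)" .
    qed
    note c' = c[OF this]
    define y where "y i = nrm Z (\<Sum>k<N. V' k i *\<^sub>C U (coord k))" for i
    have in_Z: "(\<Sum>k<N. V' k i *\<^sub>C U (coord k)) \<in> pts Z" for i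
      by (intro pts_sum[OF Z] pts_scale[OF Z] U)
    have y0: "0 \<le> y i" for i unfolding y_def by (rule nrm_nonneg[OF Z in_Z])
    have "nrm Z (\<Sum>k<N. V k i *\<^sub>C U (coord k)) powr r' \<le> 96\<^sup>2 * (b i)\<^sup>2 + y i powr r" if i: "i < n" for i
    proof -
      have bi: "0 < 96 * b i" using b(1)[OF i] by simp
      have "(\<Sum>k<N. V k i *\<^sub>C U (coord k)) = of_real (96 * b i) *\<^sub>C (\<Sum>k<N. V' k i *\<^sub>C U (coord k))"
        using bi by (simp add: V'_def complex_vector.scale_sum_right scaleC_scaleC)
      then have "nrm Z (\<Sum>k<N. V k i *\<^sub>C U (coord k)) = 96 * b i * y i"
        using bi by (simp only: nrm_scale[OF Z in_Z] y_def norm_of_real abs_of_pos)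
      then have "nrm Z (\<Sum>k<N. V k i *\<^sub>C U (coord k)) powr r' = (96 * b i) powr r' * y i powr r'"
        using bi y0[of i] by (simp add: powr_mult)
      also have "\<dots> = ((96 * b i)\<^sup>2) powr (r' / 2) * (y i powr r) powr (1 - r' / 2)"
      proof -
        have "(96 * b i)\<^sup>2 = (96 * b i) powr 2"
          using bi by (subst powr_numeral) auto
        moreover have "2 * (r' / 2) = r'" "r * (r' / r) = r'" using r by simp_all
        ultimately show ?thesis by (simp only: \<alpha> powr_powr)
      qed
      also have "\<dots> \<le> (96 * b i)\<^sup>2 + y i powr r"
        using \<alpha>01 by (intro powr_product_le_add) auto
      finally show ?thesis by (simp add: power_mult_distrib)
    qed
    then have "(\<Sum>i<n. nrm Z (\<Sum>k<N. V k i *\<^sub>C U (coord k)) powr r')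
        \<le> (\<Sum>i<n. 96\<^sup>2 * (b i)\<^sup>2 + y i powr r)"
      by (intro sum_mono) auto
    also have "\<dots> = 96\<^sup>2 * (\<Sum>i<n. (b i)\<^sup>2) + (\<Sum>i<n. y i powr r)"
      by (simp add: sum.distrib sum_distrib_left)
    also have "\<dots> \<le> 2 * 96\<^sup>2 + c"
      using b(2) c' by (simp add: y_def)
    finally show "(\<Sum>i<n. nrm Z (\<Sum>k<N. V k i *\<^sub>C U (coord k)) powr r') \<le> 2 * 96\<^sup>2 + c" .
  qed
qed

text \<open>
  The estimate of \<open>interpolation_factorization\<close> for the Calderon functions that lift the images of the unit vectors; the
  constant depends on \<open>T\<close> alone.
\<close>

theorem mixed_factorization:
  fixes F :: "'v::complex_hausdorff_tvs nspace"
  assumes \<theta>: "0 < \<theta>" "\<theta> < 1" and F: "theta_hilbert \<theta> F" and T: "T \<in> bounded_ops l1 F"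
  obtains c where "0 < c"
    and "\<And>V N n. normalized2 V N n \<Longrightarrow> \<exists>l w. (\<forall>i. w i \<in> pts F) \<and>
      (\<forall>i. (\<Sum>k<N. V k i *\<^sub>C T (coord k)) = l i *\<^sub>C w i) \<and>
      (\<Sum>i<n. cmod (l i) powr (2 / \<theta>)) \<le> c \<and>
      (\<forall>a. (\<Sum>i<n. cmod (a i) powr (2 / (1 + \<theta>))) \<le> 1 \<longrightarrow> nrm F (\<Sum>i<n. a i *\<^sub>C w i) \<le> c)"
proof -
  obtain F0 F1 where couple: "interpolation_couple F0 F1" and H1: "hilbert_space F1"
    and ptsF: "pts F = pts (complex_interpolation F0 F1 \<theta>)"
    and nrmF: "\<And>x. x \<in> pts F \<Longrightarrow> nrm F x = nrm (complex_interpolation F0 F1 \<theta>) x"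
    using F unfolding theta_hilbert_def by blast
  have SF: "seminormed F" using F by (simp add: theta_hilbert_def banach_imp_seminormed)
  have S0: "seminormed F0" and S1: "seminormed F1"
    using couple by (auto simp: interpolation_couple_def banach_imp_seminormed)
  obtain D where D: "0 < D" "\<And>x. x \<in> pts l1 \<Longrightarrow> nrm F (T x) \<le> D * nrm l1 x"
    using bounded_ops_bound[OF T seminormed_l1] by blast
  have Tc: "T (coord k) \<in> pts F" for k
    using T coord_l1 by (auto simp: bounded_ops_def linear_map_def)
  define C where "C = D + 1"
  have C: "0 < C" using D by (simp add: C_def)
  have "\<exists>f\<in>calderon_functions F0 F1. f (of_real \<theta>) = T (coord k) \<and>
      (\<forall>t. nrm F0 (f (Complex 0 t)) \<le> C) \<and> (\<forall>t. nrm F1 (f (Complex 1 t)) \<le> C)" for k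
  proof -
    have "nrm F (T (coord k)) < C" using D(2)[OF coord_l1(1), of k] by (simp add: coord_l1 C_def)
    then have "nrm (complex_interpolation F0 F1 \<theta>) (T (coord k)) < C" using nrmF[OF Tc] by simp
    from complex_interpolation_lift[OF S0 S1 _ this] Tc ptsF show ?thesis by metis
  qed
  then obtain f where f: "\<And>k. f k \<in> calderon_functions F0 F1" "\<And>k. f k (of_real \<theta>) = T (coord k)"
    "\<And>k t. nrm F0 (f k (Complex 0 t)) \<le> C" "\<And>k t. nrm F1 (f k (Complex 1 t)) \<le> C"
    by metis
  define c where "c = (1 + 6 * (96 * C)\<^sup>2 / (1 - \<theta>)) + (exp 1 * C + 2 * exp 2)"
  have c1: "1 + 6 * (96 * C)\<^sup>2 / (1 - \<theta>) \<le> c" and c2: "exp 1 * C + 2 * exp 2 \<le> c" and c0: "0 < c"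
    using C \<theta> by (auto simp: c_def intro!: add_nonneg_nonneg add_pos_nonneg divide_nonneg_pos)
  show thesis
  proof (rule that[OF c0])
    fix V N n assume V: "normalized2 V N n"
    obtain l :: "nat \<Rightarrow> complex" where l: "\<And>i. l i \<noteq> 0"
      and lsum: "(\<Sum>i<n. cmod (l i) powr (2 / \<theta>)) \<le> 1 + 6 * (96 * C)\<^sup>2 / (1 - \<theta>)"
      and bound: "\<And>a. (\<Sum>i<n. cmod (a i) powr (2 / (1 + \<theta>))) \<le> 1 \<Longrightarrow>
        nrm (complex_interpolation F0 F1 \<theta>) (\<Sum>i<n. (a i / l i) *\<^sub>C (\<Sum>k<N. V k i *\<^sub>C f k (of_real \<theta>)))
          \<le> exp 1 * C + 2 * exp 2"
      using interpolation_factorization[of F0 F1 \<theta> N f C V n, OF S0 H1 \<theta> f(1) C f(3) f(4)]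
        V unfolding normalized2_def by blast
    define w where "w i = inverse (l i) *\<^sub>C (\<Sum>k<N. V k i *\<^sub>C T (coord k))" for i
    have w: "w i \<in> pts F" for i
      unfolding w_def by (intro pts_scale[OF SF] pts_sum[OF SF] Tc)
    have lw: "(\<Sum>k<N. V k i *\<^sub>C T (coord k)) = l i *\<^sub>C w i" for i
      using l[of i] by (simp add: w_def scaleC_scaleC scaleC_one)
    have "nrm F (\<Sum>i<n. a i *\<^sub>C w i) \<le> c" if "(\<Sum>i<n. cmod (a i) powr (2 / (1 + \<theta>))) \<le> 1" for a
    proof -
      have "(\<Sum>i<n. a i *\<^sub>C w i) \<in> pts F" by (intro pts_sum[OF SF] pts_scale[OF SF] w)
      moreover have "(\<Sum>i<n. a i *\<^sub>C w i) = (\<Sum>i<n. (a i / l i) *\<^sub>C (\<Sum>k<N. V k i *\<^sub>C f k (of_real \<theta>)))"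
        by (simp add: w_def f(2) scaleC_scaleC divide_inverse)
      ultimately show ?thesis using bound[OF that] c2 by (simp add: nrmF)
    qed
    then show "\<exists>l w. (\<forall>i. w i \<in> pts F) \<and>
      (\<forall>i. (\<Sum>k<N. V k i *\<^sub>C T (coord k)) = l i *\<^sub>C w i) \<and>
      (\<Sum>i<n. cmod (l i) powr (2 / \<theta>)) \<le> c \<and>
      (\<forall>a. (\<Sum>i<n. cmod (a i) powr (2 / (1 + \<theta>))) \<le> 1 \<longrightarrow> nrm F (\<Sum>i<n. a i *\<^sub>C w i) \<le> c)"
      using w lw lsum c1 by (intro exI[of _ l] exI[of _ w]) auto
  qed
qed

text \<open>
  Duality between \<open>\<ell>\<close> with exponents \<open>2 / (1 + \<theta>)\<close> and \<open>s = 2 / (1 - \<theta>)\<close>, in the form that bounds on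
  linear combinations of \<open>(w\<^sub>i)\<close> bound its weak \<open>s\<close>-norm: test with the extremal coefficients for
  the given functional.
\<close>

lemma functional_power_sum_le:
  assumes \<theta>: "0 < \<theta>" "\<theta> < 1" and F: "seminormed F" and w: "\<And>i. w i \<in> pts F" and c: "0 < c"
    and bound: "\<And>a. (\<Sum>i<n. cmod (a i) powr (2 / (1 + \<theta>))) \<le> 1 \<Longrightarrow> nrm F (\<Sum>i<n. a i *\<^sub>C w i) \<le> c"
    and \<phi>: "\<phi> \<in> dual_ball F"
  shows "lp_norm (ereal (2 / (1 - \<theta>))) n (\<lambda>i. cmod (\<phi> (w i))) \<le> c"
proof -
  define s where "s = 2 / (1 - \<theta>)"
  define \<alpha> where "\<alpha> i = cmod (\<phi> (w i))" for i
  define \<Sigma> where "\<Sigma> = (\<Sum>i<n. \<alpha> i powr s)"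
  have s: "0 < s" using \<theta> by (simp add: s_def)
  have "s - 1 = (1 + \<theta>) / (1 - \<theta>)" and s'': "1 - (1 + \<theta>) / 2 = 1 / s"
    using \<theta> by (simp_all add: s_def field_simps)
  moreover have "1 + \<theta> \<noteq> 0" "1 - \<theta> \<noteq> 0" using \<theta> by auto
  ultimately have s': "(s - 1) * (2 / (1 + \<theta>)) = s"
    by (simp only: s_def times_divide_times_eq) (subst frac_eq_eq, simp_all add: mult_ac)
  have \<Sigma>0: "0 \<le> \<Sigma>" by (simp add: \<Sigma>_def sum_nonneg)
  show ?thesis
  proof (cases "\<Sigma> = 0")
    case True
    then show ?thesis using c unfolding lp_norm_real s_def[symmetric] \<alpha>_def[symmetric] \<Sigma>_def[symmetric] by simp
  next
    case False
    then have \<Sigma>: "0 < \<Sigma>" using \<Sigma>0 by simp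
    define a where "a i = cnj (sgn (\<phi> (w i))) * of_real (\<alpha> i powr (s - 1) / \<Sigma> powr ((1 + \<theta>) / 2))" for i
    have cmod_a: "cmod (a i) powr (2 / (1 + \<theta>)) = \<alpha> i powr s / \<Sigma>" for i
    proof (cases "\<phi> (w i) = 0")
      case False
      then have "cmod (a i) = \<alpha> i powr (s - 1) / \<Sigma> powr ((1 + \<theta>) / 2)"
        by (simp add: a_def norm_mult norm_divide norm_sgn)
      then have "cmod (a i) powr (2 / (1 + \<theta>)) = \<alpha> i powr ((s - 1) * (2 / (1 + \<theta>))) / \<Sigma> powr ((1 + \<theta>) / 2 * (2 / (1 + \<theta>)))"
        by (simp add: powr_divide powr_powr)
      also have "(1 + \<theta>) / 2 * (2 / (1 + \<theta>)) = 1" using \<theta> by simp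
      finally show ?thesis using \<Sigma> by (simp only: s' powr_one)
    qed (simp add: a_def \<alpha>_def)
    have "(\<Sum>i<n. cmod (a i) powr (2 / (1 + \<theta>))) = 1"
      unfolding cmod_a using \<Sigma> by (simp add: \<Sigma>_def flip: sum_divide_distrib)
    then have "nrm F (\<Sum>i<n. a i *\<^sub>C w i) \<le> c" by (intro bound) simp
    moreover have "cmod (\<phi> (\<Sum>i<n. a i *\<^sub>C w i)) \<le> nrm F (\<Sum>i<n. a i *\<^sub>C w i)"
      using \<phi> pts_sum[OF F, of "{..<n}" "\<lambda>i. a i *\<^sub>C w i"] pts_scale[OF F w] by (auto simp: dual_ball_def)
    moreover have "\<phi> (\<Sum>i<n. a i *\<^sub>C w i) = of_real (\<Sigma> powr (1 / s))"
    proof -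
      have lin: "linear_map F scalars \<phi>" using \<phi> by (simp add: dual_ball_def bounded_ops_def)
      have sc: "seminormed scalars"
        by (auto simp: seminormed_def scalars_def complex_vector.subspace_def scaleC_complex_def
            norm_mult norm_triangle_ineq)
      have "\<phi> (\<Sum>i<n. a i *\<^sub>C w i) = (\<Sum>i<n. a i * \<phi> (w i))"
        using linear_map_sum[OF F sc lin, of "{..<n}" w a] w by (simp add: scaleC_complex_def)
      also have "\<dots> = (\<Sum>i<n. of_real (\<alpha> i powr s / \<Sigma> powr ((1 + \<theta>) / 2)))"
      proof (intro sum.cong refl)
        fix i
        have "\<alpha> i * \<alpha> i powr (s - 1) = \<alpha> i powr s"
          using powr_mult_base[of "\<alpha> i" "s - 1"] by (simp add: \<alpha>_def)
        moreover have "a i * \<phi> (w i)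
            = (cnj (sgn (\<phi> (w i))) * \<phi> (w i)) * of_real (\<alpha> i powr (s - 1) / \<Sigma> powr ((1 + \<theta>) / 2))"
          by (simp add: a_def)
        ultimately show "a i * \<phi> (w i) = of_real (\<alpha> i powr s / \<Sigma> powr ((1 + \<theta>) / 2))"
          by (simp only: cnj_sgn_mult \<alpha>_def[symmetric] of_real_mult[symmetric] times_divide_eq_right)
      qed
      also have "\<dots> = of_real (\<Sigma> / \<Sigma> powr ((1 + \<theta>) / 2))"
        by (simp only: \<Sigma>_def sum_divide_distrib of_real_sum)
      also have "\<Sigma> / \<Sigma> powr ((1 + \<theta>) / 2) = \<Sigma> powr (1 / s)"
        using \<Sigma> powr_diff[of \<Sigma> 1 "(1 + \<theta>) / 2"] by (simp add: s'')
      finally show ?thesis .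
    qed
    ultimately have "\<Sigma> powr (1 / s) \<le> c" by simp
    then show ?thesis
      unfolding lp_norm_real s_def[symmetric] \<alpha>_def[symmetric] \<Sigma>_def[symmetric] .
  qed
qed

text \<open>
  Unit vectors \<open>a\<close> in \<open>mixed_factorization\<close> give \<open>\<parallel>w\<^sub>i\<parallel> \<le> c\<close>, so \<open>(T x\<^sub>i)\<close> inherits the summability of \<open>(l\<^sub>i)\<close>.
\<close>

theorem power_bound_theta_hilbert:
  fixes F :: "'v::complex_hausdorff_tvs nspace"
  assumes \<theta>: "0 < \<theta>" "\<theta> < 1" and F: "theta_hilbert \<theta> F" and T: "T \<in> bounded_ops l1 F"
  shows "power_bound normalized2 (2 / \<theta>) F T"
proof -
  have SF: "seminormed F" using F by (simp add: theta_hilbert_def banach_imp_seminormed)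
  obtain c where c: "0 < c"
    and fac: "\<And>V N n. normalized2 V N n \<Longrightarrow> \<exists>l w. (\<forall>i. w i \<in> pts F) \<and>
      (\<forall>i. (\<Sum>k<N. V k i *\<^sub>C T (coord k)) = l i *\<^sub>C w i) \<and>
      (\<Sum>i<n. cmod (l i) powr (2 / \<theta>)) \<le> c \<and>
      (\<forall>a. (\<Sum>i<n. cmod (a i) powr (2 / (1 + \<theta>))) \<le> 1 \<longrightarrow> nrm F (\<Sum>i<n. a i *\<^sub>C w i) \<le> c)"
    using mixed_factorization[OF \<theta> F T] by blast
  show ?thesis
    unfolding power_bound_def
  proof (intro exI[of _ "c * c powr (2 / \<theta>)"] allI impI)
    fix V N n assume V: "normalized2 V N n"
    obtain l w where w: "\<And>i. w i \<in> pts F" and lw: "\<And>i. (\<Sum>k<N. V k i *\<^sub>C T (coord k)) = l i *\<^sub>C w i"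
      and l: "(\<Sum>i<n. cmod (l i) powr (2 / \<theta>)) \<le> c"
      and bound: "\<And>a. (\<Sum>i<n. cmod (a i) powr (2 / (1 + \<theta>))) \<le> 1 \<Longrightarrow> nrm F (\<Sum>i<n. a i *\<^sub>C w i) \<le> c"
      using fac[OF V] by blast
    have "nrm F (w i) \<le> c" if i: "i < n" for i
    proof -
      define a where "a j = (if j = i then 1 else 0 :: complex)" for j
      have "(\<Sum>j<n. cmod (a j) powr (2 / (1 + \<theta>))) = (\<Sum>j<n. if j = i then 1 else 0)"
        by (intro sum.cong) (auto simp: a_def)
      moreover have "(\<Sum>j<n. a j *\<^sub>C w j) = (\<Sum>j<n. if j = i then w i else 0)"
        by (intro sum.cong) (auto simp: a_def scaleC_one)
      ultimately show ?thesis using bound[of a] i by simp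
    qed
    then have "nrm F (l i *\<^sub>C w i) powr (2 / \<theta>) \<le> cmod (l i) powr (2 / \<theta>) * c powr (2 / \<theta>)" if "i < n" for i
      using that \<theta> nrm_nonneg[OF SF w, of i]
      by (simp add: nrm_scale[OF SF w] powr_mult) (intro mult_left_mono powr_mono2, auto)
    then have "(\<Sum>i<n. nrm F (l i *\<^sub>C w i) powr (2 / \<theta>)) \<le> (\<Sum>i<n. cmod (l i) powr (2 / \<theta>)) * c powr (2 / \<theta>)"
      unfolding sum_distrib_right by (intro sum_mono) auto
    also have "\<dots> \<le> c * c powr (2 / \<theta>)" using l by (intro mult_right_mono) auto
    finally show "(\<Sum>i<n. nrm F (\<Sum>k<N. V k i *\<^sub>C T (coord k)) powr (2 / \<theta>)) \<le> c * c powr (2 / \<theta>)"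
      by (simp add: lw)
  qed
qed

text \<open>
  By \<open>mixed_factorization\<close>, \<open>S T x\<^sub>i = l\<^sub>i S w\<^sub>i\<close> with \<open>(w\<^sub>i)\<close> weakly \<open>s\<close>-summable, so \<open>(\<parallel>S w\<^sub>i\<parallel>)\<close> is
  \<open>s\<close>-summable, and \<open>1 / 2 = \<theta> / 2 + 1 / s\<close>.
\<close>

theorem power_bound_composition:
  fixes F :: "'v::complex_hausdorff_tvs nspace"
  assumes \<theta>: "0 < \<theta>" "\<theta> < 1" and F: "theta_hilbert \<theta> F" and T: "T \<in> bounded_ops l1 F"
    and Y: "seminormed Y" and S: "S \<in> summing (ereal (2 / (1 - \<theta>))) (ereal (2 / (1 - \<theta>))) F Y"
  shows "power_bound normalized2 2 Y (S \<circ> T)"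
proof -
  define s where "s = 2 / (1 - \<theta>)"
  have s: "0 < s" using \<theta> by (simp add: s_def)
  have SF: "seminormed F" using F by (simp add: theta_hilbert_def banach_imp_seminormed)
  have Tl: "linear_map l1 F T" using T by (simp add: bounded_ops_def)
  have Sl: "linear_map F Y S" using S by (simp add: summing_def bounded_ops_def)
  have Tc: "T (coord k) \<in> pts F" for k using Tl coord_l1 by (simp add: linear_map_def)
  obtain \<rho> where \<rho>: "0 \<le> \<rho>" "\<And>n x. (\<And>i. i < n \<Longrightarrow> x i \<in> pts F) \<Longrightarrow>
      lp_norm (ereal s) n (\<lambda>i. nrm Y (S (x i))) \<le> \<rho> * weak_norm (ereal s) n x F"
    using S unfolding summing_def s_def weak_norm_def by blast
  obtain c where c: "0 < c"
    and fac: "\<And>V N n. normalized2 V N n \<Longrightarrow> \<exists>l w. (\<forall>i. w i \<in> pts F) \<and>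
      (\<forall>i. (\<Sum>k<N. V k i *\<^sub>C T (coord k)) = l i *\<^sub>C w i) \<and>
      (\<Sum>i<n. cmod (l i) powr (2 / \<theta>)) \<le> c \<and>
      (\<forall>a. (\<Sum>i<n. cmod (a i) powr (2 / (1 + \<theta>))) \<le> 1 \<longrightarrow> nrm F (\<Sum>i<n. a i *\<^sub>C w i) \<le> c)"
    using mixed_factorization[OF \<theta> F T] by blast
  show ?thesis
    unfolding power_bound_def
  proof (intro exI[of _ "c + (\<rho> * c) powr s"] allI impI)
    fix V N n assume V: "normalized2 V N n"
    obtain l w where w: "\<And>i. w i \<in> pts F" and lw: "\<And>i. (\<Sum>k<N. V k i *\<^sub>C T (coord k)) = l i *\<^sub>C w i"
      and l: "(\<Sum>i<n. cmod (l i) powr (2 / \<theta>)) \<le> c"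
      and bound: "\<And>a. (\<Sum>i<n. cmod (a i) powr (2 / (1 + \<theta>))) \<le> 1 \<Longrightarrow> nrm F (\<Sum>i<n. a i *\<^sub>C w i) \<le> c"
      using fac[OF V] by blast
    have "weak_norm (ereal s) n w F \<le> c"
      unfolding s_def by (intro weak_norm_le[OF SF] functional_power_sum_le[OF \<theta> SF w c bound])
    then have "lp_norm (ereal s) n (\<lambda>i. nrm Y (S (w i))) \<le> \<rho> * c"
      using \<rho>(2)[of n w] w mult_left_mono[OF _ \<rho>(1)] by (meson order_trans)
    then have "((\<Sum>i<n. nrm Y (S (w i)) powr s) powr (1 / s)) powr s \<le> (\<rho> * c) powr s"
      unfolding lp_norm_real using s by (intro powr_mono2) auto
    then have Sw: "(\<Sum>i<n. nrm Y (S (w i)) powr s) \<le> (\<rho> * c) powr s"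
      using s by (simp add: powr_powr sum_nonneg)
    have Swp: "S (w i) \<in> pts Y" for i using Sl w by (simp add: linear_map_def)
    have "nrm Y (\<Sum>k<N. V k i *\<^sub>C (S \<circ> T) (coord k)) powr 2 \<le> cmod (l i) powr (2 / \<theta>) + nrm Y (S (w i)) powr s" for i
    proof -
      have "(\<Sum>k<N. V k i *\<^sub>C (S \<circ> T) (coord k)) = S (\<Sum>k<N. V k i *\<^sub>C T (coord k))"
        using Tc by (simp add: linear_map_sum[OF SF Y Sl])
      also have "\<dots> = l i *\<^sub>C S (w i)"
        unfolding lw using Sl w by (simp add: linear_map_def)
      finally have "nrm Y (\<Sum>k<N. V k i *\<^sub>C (S \<circ> T) (coord k)) powr 2
          = cmod (l i) powr 2 * nrm Y (S (w i)) powr 2"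
        by (simp add: nrm_scale[OF Y Swp] powr_mult nrm_nonneg[OF Y Swp] del: powr_numeral)
      also have "\<dots> = (cmod (l i) powr (2 / \<theta>)) powr \<theta> * (nrm Y (S (w i)) powr s) powr (1 - \<theta>)"
      proof -
        have "2 / \<theta> * \<theta> = 2" using \<theta> by simp
        moreover have "s * (1 - \<theta>) = 2"
          using \<theta> by (intro nonzero_eq_divide_eq[THEN iffD1]) (auto simp: s_def)
        ultimately show ?thesis by (simp only: powr_powr)
      qed
      also have "\<dots> \<le> cmod (l i) powr (2 / \<theta>) + nrm Y (S (w i)) powr s"
        using \<theta> by (intro powr_product_le_add) auto
      finally show ?thesis .
    qed
    then have "(\<Sum>i<n. nrm Y (\<Sum>k<N. V k i *\<^sub>C (S \<circ> T) (coord k)) powr 2)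
        \<le> (\<Sum>i<n. cmod (l i) powr (2 / \<theta>) + nrm Y (S (w i)) powr s)"
      by (intro sum_mono) auto
    also have "\<dots> \<le> c + (\<rho> * c) powr s"
      using l Sw by (simp add: sum.distrib)
    finally show "(\<Sum>i<n. nrm Y (\<Sum>k<N. V k i *\<^sub>C (S \<circ> T) (coord k)) powr 2) \<le> c + (\<rho> * c) powr s" .
  qed
qed

theorem theorem2p1:
  fixes \<theta> :: real and F :: "'v::complex_hausdorff_tvs nspace"
  assumes "0 < \<theta>" and "\<theta> < 1" and "theta_hilbert \<theta> F"
  shows "(bounded_ops l1 F = mixing TYPE('y::complex_vector) (ereal (2 / (1 - \<theta>))) 2 l1 F \<and>
          mixing TYPE('y) (ereal (2 / (1 - \<theta>))) 2 l1 F = summing (ereal (2 / \<theta>)) 2 l1 F) \<and>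
         (bounded_ops l1 F = mixing TYPE('y) (ereal (2 / (1 - \<theta>))) 1 l1 F \<and>
          mixing TYPE('y) (ereal (2 / (1 - \<theta>))) 1 l1 F = summing (ereal (2 / (1 + \<theta>))) 1 l1 F)"
proof -
  note \<theta> = assms(1,2)
  have F: "seminormed F" using assms(3) by (simp add: theta_hilbert_def banach_imp_seminormed)
  have coord_in: "U (coord k) \<in> pts Z" if "U \<in> bounded_ops l1 Z" for U :: "_ \<Rightarrow> 'z::complex_vector" and Z k
    using that coord_l1 by (simp add: bounded_ops_def linear_map_def)
  have summing2: "T \<in> summing (ereal (2 / \<theta>)) 2 l1 F" if T: "T \<in> bounded_ops l1 F" for T
    using \<theta> by (intro summing_two F T power_bound_theta_hilbert assms) auto
  have summing1: "T \<in> summing (ereal (2 / (1 + \<theta>))) 1 l1 F" if T: "T \<in> bounded_ops l1 F" for T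
    using \<theta>
    by (intro summing_one F T power_bound_two_imp_one[OF F coord_in[OF T] _ _
          power_bound_theta_hilbert[OF assms T]]) (auto simp: field_simps)
  have mix: "S \<circ> T \<in> summing 2 2 l1 Y \<and> S \<circ> T \<in> summing 1 1 l1 Y"
    if T: "T \<in> bounded_ops l1 F" and Y: "banach_space Y"
      and S: "S \<in> summing (ereal (2 / (1 - \<theta>))) (ereal (2 / (1 - \<theta>))) F Y"
    for T S and Y :: "'y nspace"
  proof -
    note Y' = banach_imp_seminormed[OF Y]
    have "S \<in> bounded_ops F Y" using S by (simp add: summing_def)
    then have ST: "S \<circ> T \<in> bounded_ops l1 Y" by (rule bounded_ops_compose[OF seminormed_l1 F T])
    note pb = power_bound_composition[OF assms T Y' S]
    have "S \<circ> T \<in> summing (ereal 2) 2 l1 Y"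
      by (intro summing_two Y' ST pb) simp
    moreover have "S \<circ> T \<in> summing (ereal 1) 1 l1 Y"
      by (intro summing_one Y' ST power_bound_two_imp_one[OF Y' coord_in[OF ST] _ _ pb]) simp_all
    ultimately show ?thesis by (simp add: one_ereal_def)
  qed
  have "bounded_ops l1 F = mixing TYPE('y) (ereal (2 / (1 - \<theta>))) 2 l1 F"
    "bounded_ops l1 F = mixing TYPE('y) (ereal (2 / (1 - \<theta>))) 1 l1 F"
    using mix by (auto simp: mixing_def)
  moreover have "bounded_ops l1 F = summing (ereal (2 / \<theta>)) 2 l1 F"
    "bounded_ops l1 F = summing (ereal (2 / (1 + \<theta>))) 1 l1 F"
    using summing1 summing2 by (auto simp: summing_def)
  ultimately show ?thesis by simp
qed

end
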